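(* Consider the complex projective space $\mathbb{CP}^3={\rm Sp}(2)/({\rm Sp}(1)\times{\rm U}(1))$ equipped with an ${\rm Sp}(2)$-invariant almost Hermitian structure $(g,J)$, where the invariant metric $g$ is parametrized by a pair of positive numbers $(x,y)$. Let $s_1$ be the first Hermitian scalar curvature of $(g,J)$ and $s$ the Riemannian scalar curvature of $g$. Then $2s_1-s=0$ if and only if one of the following holds: (1) $(g,J)\in\mathcal W_1\oplus\mathcal W_2$, $J$ is non-integrable and the metric $g$ satisfies $y=2x(\sqrt{10}+3)$; (2) $(g,J)\in\mathcal W_3$, $J$ is integrable and the metric $g$ satisfies $y=2x$; in this case the pair $(g,J)$ is Kähler.
   Context: Metrics and almost complex structures. Let $\mathfrak h$ be the Cartan subalgebra of diagonal matrices ${\rm diag}(a,b,-a,-b)$ of $\mathfrak{sp}(4,\mathbb C)=\mathfrak{sp}(2)^{\mathbb C}$ and $\lambda_1,\lambda_2$ the functionals $a$, $b$. The isotropy subgroup ${\rm Sp}(1)\times{\rm U}(1)$ has root set $\{\pm2\lambda_2\}$ and the complementary positive roots are $\alpha_1=\lambda_1-\lambda_2$, $\alpha_2=\lambda_1+\lambda_2$, $\alpha_3=2\lambda_1$. The tangent space at the trivial coset is $\mathfrak m=\mathfrak m_1\oplus\mathfrak m_2$ (irreducible isotropy summands), where $\mathfrak m_1$ is the real subspace of $\mathfrak{sp}(2)$ with complexification spanned by the root spaces of $\pm\alpha_1,\pm\alpha_2$, and $\mathfrak m_2$ that of $\pm\alpha_3$. The invariant metric with parameters $(x,y)$ is induced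 by the inner product equal to $-xB$ on $\mathfrak m_1$ and $-yB$ on $\mathfrak m_2$ ($\mathfrak m_1\perp\mathfrak m_2$), $B$ being the Killing form. An invariant almost complex structure is given on $\mathfrak m^{\mathbb C}$ by $JX=\sqrt{-1}\,\varepsilon_\alpha X$ for $X$ in the root space of $\alpha$, with $\varepsilon_\alpha=\pm1$, $\varepsilon_{-\alpha}=-\varepsilon_\alpha$, and $\varepsilon_\alpha$ constant on the positive roots of each $\mathfrak m_i$. Up to conjugation and equivalence there are two: $(+,+)$ (integrable) and $(+,-)$ (non-integrable), the signs being those on $\mathfrak m_1,\mathfrak m_2$. Hermitian scalar curvature. For an almost Hermitian manifold $(M,g,J)$ with Levi-Civita connection $D$, let $\nabla^t$ ($t\in\mathbb R$) be the Gauduchon connections $g(\nabla^{t}_{X}Z,Y)=g(D_{X}Z,Y)-\frac12 g(J(D_{X}J)Z,Y)+\frac t4 g((D_{JY}J+JD_{Y}J)X,Z)-\frac t4 g((D_{JZ}J+JD_{Z}J)X,Y)$; $\nabla^1$ is the Chern connection. With $R^t(X,Y,Z,W)=-g(([\nabla^t_X,\nabla^t_Y]-\nabla^t_{[X,Y]})Z,W)$ extended complex multilinearly and $\{u_i\}$ a unitary frame of $T^{1,0}M$ ($u_{\bar i}=\overline{u_i}$), put $s_1(t)=\sum_{i,j}R^t(u_{\bar i},u_i,u_j,u_{\bar j})$ (sign normalised so that $s_1=s/2$ for Kähler structures). On flag manifolds with invariant $(g,J)$, $s_1(t)$ does not depend on $t$ and is denoted $s_1$; it is the Chern scalar curvature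 $s_1(1)$. Gray–Hervella classes. $F(X,Y)=g(JX,Y)$; $(dF)^-$ and $(dF)^+$ are the $(3,0)+(0,3)$ and $(2,1)+(1,2)$ parts of $dF$, and $(dF)^+_0$ is the primitive part of $(dF)^+$; $\alpha_F=J\delta F$ is the Lee form; $N(X,Y)=[X,Y]-[JX,JY]+J[JX,Y]+J[X,JY]$ and $N^0=N-\mathfrak bN$, where $N(X,Y,Z)=g(N(X,Y),Z)$ and $\mathfrak bN(X,Y,Z)=\frac13[N(X,Y,Z)+N(Y,Z,X)+N(Z,X,Y)]$. $(g,J)\in\mathcal W_1\oplus\mathcal W_2$ means $(dF)^+_0=\alpha_F=0$; $(g,J)\in\mathcal W_3$ means $(dF)^-=N^0=\alpha_F=0$; Kähler means all four of $(dF)^-,N^0,(dF)^+_0,\alpha_F$ vanish. *)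

theory Defs
  imports "HOL-Analysis.Analysis"
begin

section \<open>The groups, the Lie algebras and the root spaces\<close>

type_synonym mat4 = "complex^4^4"

definition cmul :: "complex \<Rightarrow> mat4 \<Rightarrow> mat4" where
  "cmul c A = (\<chi> i j. c * A $ i $ j)"

definition adj :: "mat4 \<Rightarrow> mat4" where
  "adj A = (\<chi> i j. cnj (A $ j $ i))"

definition comm :: "mat4 \<Rightarrow> mat4 \<Rightarrow> mat4" where
  "comm A B = A ** B - B ** A"

definition Omega :: mat4 where
  "Omega = (\<chi> i j. if (i = 1 \<and> j = 3) \<or> (i = 2 \<and> j = 4) then 1
                   else if (i = 3 \<and> j = 1) \<or> (i = 4 \<and> j = 2) then - 1 else 0)"

definition Sp2 :: "mat4 set" where
  "Sp2 = {A. adj A ** A = mat 1 \<and> transpose A ** Omega ** A = Omega}"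

text \<open>The subgroup \<open>Sp(1) \<times> U(1)\<close>: the factor \<open>U(1)\<close> acts on the coordinates 1, 3 as
  \<open>diag(z, cnj z)\<close> and \<open>Sp(1)\<close> acts on the coordinates 2, 4. (The relation between
  the entries at (1,1) and (3,3) is a consequence of membership in \<open>Sp2\<close>.)\<close>

definition isotropy :: "mat4 set" where
  "isotropy = {A \<in> Sp2. \<forall>i\<in>{1, 3}. \<forall>j. j \<noteq> i \<longrightarrow> A $ i $ j = 0 \<and> A $ j $ i = 0}"

definition sp4C :: "mat4 set" where
  "sp4C = {X. transpose X ** Omega + Omega ** X = 0}"

definition sp2 :: "mat4 set" where
  "sp2 = {X \<in> sp4C. adj X = - X}"

definition cartan :: "complex \<Rightarrow> complex \<Rightarrow> mat4" where
  "cartan a b = (\<chi> i j. if i = j then (if i = 1 then a else if i = 2 then b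
                                        else if i = 3 then - a else - b) else 0)"

text \<open>The pair \<open>(k, l)\<close> stands for the functional \<open>k \<lambda>\<^sub>1 + l \<lambda>\<^sub>2\<close>.\<close>

type_synonym root = "int \<times> int"

definition root_space :: "root \<Rightarrow> mat4 set" where
  "root_space \<alpha> = {X \<in> sp4C. \<forall>a b. comm (cartan a b) X
                        = cmul (of_int (fst \<alpha>) * a + of_int (snd \<alpha>) * b) X}"

abbreviation root1 :: root where "root1 \<equiv> (1, - 1)"
abbreviation root2 :: root where "root2 \<equiv> (1, 1)"
abbreviation root3 :: root where "root3 \<equiv> (2, 0)"

definition roots1 :: "root set" where "roots1 = {root1, - root1, root2, - root2}"
definition roots2 :: "root set" where "roots2 = {root3, - root3}"

text \<open>Root spaces are complex subspaces, so the real span of a union of root spaces is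
  also its complex span.\<close>

definition m1 :: "mat4 set" where
  "m1 = sp2 \<inter> span (\<Union>\<alpha>\<in>roots1. root_space \<alpha>)"
definition m2 :: "mat4 set" where
  "m2 = sp2 \<inter> span (\<Union>\<alpha>\<in>roots2. root_space \<alpha>)"
definition mm :: "mat4 set" where
  "mm = sp2 \<inter> span (\<Union>\<alpha>\<in>roots1 \<union> roots2. root_space \<alpha>)"
definition mmC :: "mat4 set" where
  "mmC = span (\<Union>\<alpha>\<in>roots1 \<union> roots2. root_space \<alpha>)"

text \<open>The trace of an endomorphism \<open>f\<close> of the subspace \<open>S\<close>, in any basis of \<open>S\<close>.\<close>

definition trace_on :: "'a::real_vector set \<Rightarrow> ('a \<Rightarrow> 'a) \<Rightarrow> real" where
  "trace_on S f = (let B = (SOME B. independent B \<and> span B = S)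
                   in \<Sum>b\<in>B. representation B (f b) b)"

definition killing :: "mat4 \<Rightarrow> mat4 \<Rightarrow> real" where
  "killing X Y = trace_on sp2 (\<lambda>Z. comm X (comm Y Z))"


section \<open>Invariant metrics and invariant almost complex structures\<close>

definition part1 :: "mat4 \<Rightarrow> mat4" where
  "part1 u = (THE a. a \<in> m1 \<and> u - a \<in> m2)"
definition part2 :: "mat4 \<Rightarrow> mat4" where
  "part2 u = (THE a. a \<in> m2 \<and> u - a \<in> m1)"

definition inner_xy :: "real \<Rightarrow> real \<Rightarrow> mat4 \<Rightarrow> mat4 \<Rightarrow> real" where
  "inner_xy x y u v = - x * killing (part1 u) (part1 v) - y * killing (part2 u) (part2 v)"

text \<open>An almost complex structure on \<open>mm\<close> is represented by a real-linear map that
  is also its complex-linear extension to \<open>mmC\<close> (\<open>mmC\<close> is the direct sum of \<open>mm\<close> and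
  \<open>cmul \<i> ` mm\<close>); its values outside \<open>mmC\<close> are never used.\<close>

definition invariant_acs :: "(mat4 \<Rightarrow> mat4) \<Rightarrow> bool" where
  "invariant_acs J \<longleftrightarrow> linear J \<and>
     (\<exists>\<epsilon> :: root \<Rightarrow> int.
        (\<forall>\<alpha>\<in>roots1 \<union> roots2. \<epsilon> \<alpha> \<in> {1, - 1} \<and> \<epsilon> (- \<alpha>) = - \<epsilon> \<alpha>) \<and>
        \<epsilon> root1 = \<epsilon> root2 \<and>
        (\<forall>\<alpha>\<in>roots1 \<union> roots2. \<forall>X\<in>root_space \<alpha>. J X = cmul (\<i> * of_int (\<epsilon> \<alpha>)) X))"


section \<open>Vector fields on the homogeneous space\<close>

text \<open>The tangent bundle of \<open>G/H\<close> is \<open>G \<times>\<^sub>H mm\<close>: a function on \<open>G/H\<close> is a right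
  \<open>H\<close>-invariant function on \<open>G = Sp2\<close>, and a vector field on \<open>G/H\<close> is an
  \<open>H\<close>-equivariant function \<open>X : G \<rightarrow> mm\<close>, whose value at \<open>gH\<close> is the velocity at
  \<open>t = 0\<close> of \<open>g exp(t X(g)) H\<close>. Since \<open>G\<close> is a closed submanifold of the space of
  matrices, smooth functions on \<open>G\<close> are the restrictions of smooth functions on the
  space of matrices. We use such extensions; only their values on \<open>G\<close> have a meaning.\<close>

primrec Ck :: "nat \<Rightarrow> ('a::real_normed_vector \<Rightarrow> 'b::real_normed_vector) \<Rightarrow> bool" where
  "Ck 0 f = continuous_on UNIV f"
| "Ck (Suc k) f = ((\<forall>p. f differentiable (at p)) \<and>
                   (\<forall>v. Ck k (\<lambda>p. frechet_derivative f (at p) v)))"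

definition smooth :: "('a::real_normed_vector \<Rightarrow> 'b::real_normed_vector) \<Rightarrow> bool" where
  "smooth f \<longleftrightarrow> (\<forall>k. Ck k f)"

definition smooth_function :: "(mat4 \<Rightarrow> real) \<Rightarrow> bool" where
  "smooth_function \<phi> \<longleftrightarrow> smooth \<phi> \<and> (\<forall>p\<in>Sp2. \<forall>h\<in>isotropy. \<phi> (p ** h) = \<phi> p)"

type_synonym vfield = "mat4 \<Rightarrow> mat4"

definition vector_field :: "vfield \<Rightarrow> bool" where
  "vector_field X \<longleftrightarrow> smooth X \<and> (\<forall>p. X p \<in> mm) \<and>
     (\<forall>p\<in>Sp2. \<forall>h\<in>isotropy. X (p ** h) = adj h ** X p ** h)"

text \<open>At \<open>p \<in> Sp2\<close> this is \<open>d/dt \<phi>(p exp(t X(p)))\<close> at \<open>t = 0\<close>.\<close>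

definition deriv_along :: "vfield \<Rightarrow> (mat4 \<Rightarrow> real) \<Rightarrow> mat4 \<Rightarrow> real" where
  "deriv_along X \<phi> = (\<lambda>p. frechet_derivative \<phi> (at p) (p ** X p))"

definition bracket :: "vfield \<Rightarrow> vfield \<Rightarrow> vfield" where
  "bracket X Y = (SOME Z. vector_field Z \<and>
     (\<forall>\<phi>. smooth_function \<phi> \<longrightarrow> (\<forall>p\<in>Sp2. deriv_along Z \<phi> p
        = deriv_along X (deriv_along Y \<phi>) p - deriv_along Y (deriv_along X \<phi>) p)))"

text \<open>Some vector field with a given value at a given point, used to evaluate tensor
  fields on tangent vectors.\<close>

definition extend :: "mat4 \<Rightarrow> mat4 \<Rightarrow> vfield" where
  "extend p a = (SOME X. vector_field X \<and> X p = a)"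

definition metric :: "real \<Rightarrow> real \<Rightarrow> vfield \<Rightarrow> vfield \<Rightarrow> mat4 \<Rightarrow> real" where
  "metric x y X Y = (\<lambda>p. inner_xy x y (X p) (Y p))"


section \<open>Connections and curvature\<close>

type_synonym connection = "vfield \<Rightarrow> vfield \<Rightarrow> vfield"

definition affine_connection :: "connection \<Rightarrow> bool" where
  "affine_connection D \<longleftrightarrow>
     (\<forall>X Y. vector_field X \<longrightarrow> vector_field Y \<longrightarrow> vector_field (D X Y)) \<and>
     (\<forall>X X' Y. vector_field X \<longrightarrow> vector_field X' \<longrightarrow> vector_field Y \<longrightarrow>
        (\<forall>p\<in>Sp2. D (\<lambda>q. X q + X' q) Y p = D X Y p + D X' Y p)) \<and>
     (\<forall>X Y Y'. vector_field X \<longrightarrow> vector_field Y \<longrightarrow> vector_field Y' \<longrightarrow>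
        (\<forall>p\<in>Sp2. D X (\<lambda>q. Y q + Y' q) p = D X Y p + D X Y' p)) \<and>
     (\<forall>\<phi> X Y. smooth_function \<phi> \<longrightarrow> vector_field X \<longrightarrow> vector_field Y \<longrightarrow>
        (\<forall>p\<in>Sp2. D (\<lambda>q. \<phi> q *\<^sub>R X q) Y p = \<phi> p *\<^sub>R D X Y p)) \<and>
     (\<forall>\<phi> X Y. smooth_function \<phi> \<longrightarrow> vector_field X \<longrightarrow> vector_field Y \<longrightarrow>
        (\<forall>p\<in>Sp2. D X (\<lambda>q. \<phi> q *\<^sub>R Y q) p = deriv_along X \<phi> p *\<^sub>R Y p + \<phi> p *\<^sub>R D X Y p))"

definition is_levi_civita :: "real \<Rightarrow> real \<Rightarrow> connection \<Rightarrow> bool" where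
  "is_levi_civita x y D \<longleftrightarrow> affine_connection D \<and>
     (\<forall>X Y. vector_field X \<longrightarrow> vector_field Y \<longrightarrow>
        (\<forall>p\<in>Sp2. D X Y p - D Y X p = bracket X Y p)) \<and>
     (\<forall>X Y Z. vector_field X \<longrightarrow> vector_field Y \<longrightarrow> vector_field Z \<longrightarrow>
        (\<forall>p\<in>Sp2. deriv_along X (metric x y Y Z) p
           = metric x y (D X Y) Z p + metric x y Y (D X Z) p))"

text \<open>Unique up to the irrelevant values outside \<open>Sp2\<close> and on maps that are not
  vector fields.\<close>

definition levi_civita :: "real \<Rightarrow> real \<Rightarrow> connection" where
  "levi_civita x y = (SOME D. is_levi_civita x y D)"

definition covJ :: "connection \<Rightarrow> (mat4 \<Rightarrow> mat4) \<Rightarrow> vfield \<Rightarrow> vfield \<Rightarrow> vfield" where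
  "covJ D J X Z = (\<lambda>p. D X (J \<circ> Z) p - J (D X Z p))"

definition gauduchon :: "real \<Rightarrow> real \<Rightarrow> (mat4 \<Rightarrow> mat4) \<Rightarrow> real \<Rightarrow> connection" where
  "gauduchon x y J t X Z = (let g = metric x y; D = levi_civita x y in
     SOME U. vector_field U \<and> (\<forall>Y. vector_field Y \<longrightarrow> (\<forall>p\<in>Sp2.
        g U Y p = g (D X Z) Y p
          - 1 / 2 * g (J \<circ> covJ D J X Z) Y p
          + t / 4 * g (\<lambda>q. covJ D J (J \<circ> Y) X q + J (covJ D J Y X q)) Z p
          - t / 4 * g (\<lambda>q. covJ D J (J \<circ> Z) X q + J (covJ D J Z X q)) Y p)))"

definition curv :: "connection \<Rightarrow> vfield \<Rightarrow> vfield \<Rightarrow> vfield \<Rightarrow> vfield" where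
  "curv N X Y Z = (\<lambda>p. N X (N Y Z) p - N Y (N X Z) p - N (bracket X Y) Z p)"

definition curv_tensor :: "real \<Rightarrow> real \<Rightarrow> connection \<Rightarrow> mat4
    \<Rightarrow> mat4 \<Rightarrow> mat4 \<Rightarrow> mat4 \<Rightarrow> mat4 \<Rightarrow> real" where
  "curv_tensor x y N p a b c d =
     - metric x y (curv N (extend p a) (extend p b) (extend p c)) (extend p d) p"

definition orthonormal_frame :: "real \<Rightarrow> real \<Rightarrow> (nat \<Rightarrow> mat4) \<Rightarrow> bool" where
  "orthonormal_frame x y e \<longleftrightarrow> (\<forall>i<6. e i \<in> mm) \<and>
     (\<forall>i<6. \<forall>j<6. inner_xy x y (e i) (e j) = (if i = j then 1 else 0))"

definition frame :: "real \<Rightarrow> real \<Rightarrow> nat \<Rightarrow> mat4" where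
  "frame x y = (SOME e. orthonormal_frame x y e)"

text \<open>With the sign convention of \<open>curv_tensor\<close>, sectional curvatures are the values
  at \<open>(a, b, a, b)\<close>.\<close>

definition scalar_curvature :: "real \<Rightarrow> real \<Rightarrow> mat4 \<Rightarrow> real" where
  "scalar_curvature x y p = (\<Sum>i<6. \<Sum>j<6. curv_tensor x y (levi_civita x y) p
      (frame x y i) (frame x y j) (frame x y i) (frame x y j))"


section \<open>Complexification and the Hermitian scalar curvature\<close>

text \<open>The conjugation of \<open>mmC\<close> with respect to its real form \<open>mm\<close> (which consists of
  skew-Hermitian matrices), and the corresponding real and imaginary parts.\<close>

definition conj_mm :: "mat4 \<Rightarrow> mat4" where
  "conj_mm X = - adj X"
definition re_part :: "mat4 \<Rightarrow> mat4" where
  "re_part X = cmul (1 / 2) (X + conj_mm X)"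
definition im_part :: "mat4 \<Rightarrow> mat4" where
  "im_part X = cmul (- \<i> / 2) (X - conj_mm X)"

definition cext :: "(mat4 \<Rightarrow> complex) \<Rightarrow> mat4 \<Rightarrow> complex" where
  "cext f X = f (re_part X) + \<i> * f (im_part X)"

definition cext2 :: "(mat4 \<Rightarrow> mat4 \<Rightarrow> real) \<Rightarrow> mat4 \<Rightarrow> mat4 \<Rightarrow> complex" where
  "cext2 T X Y = cext (\<lambda>a. cext (\<lambda>b. of_real (T a b)) Y) X"
definition cext3 :: "(mat4 \<Rightarrow> mat4 \<Rightarrow> mat4 \<Rightarrow> real)
    \<Rightarrow> mat4 \<Rightarrow> mat4 \<Rightarrow> mat4 \<Rightarrow> complex" where
  "cext3 T X Y Z = cext (\<lambda>a. cext (\<lambda>b. cext (\<lambda>c. of_real (T a b c)) Z) Y) X"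
definition cext4 :: "(mat4 \<Rightarrow> mat4 \<Rightarrow> mat4 \<Rightarrow> mat4 \<Rightarrow> real)
    \<Rightarrow> mat4 \<Rightarrow> mat4 \<Rightarrow> mat4 \<Rightarrow> mat4 \<Rightarrow> complex" where
  "cext4 T X Y Z W =
     cext (\<lambda>a. cext (\<lambda>b. cext (\<lambda>c. cext (\<lambda>d. of_real (T a b c d)) W) Z) Y) X"

definition unitary_frame :: "real \<Rightarrow> real \<Rightarrow> (mat4 \<Rightarrow> mat4) \<Rightarrow> (nat \<Rightarrow> mat4) \<Rightarrow> bool" where
  "unitary_frame x y J u \<longleftrightarrow> (\<forall>i<3. u i \<in> mmC \<and> J (u i) = cmul \<i> (u i)) \<and>
     (\<forall>i<3. \<forall>j<3. cext2 (inner_xy x y) (u i) (conj_mm (u j)) = (if i = j then 1 else 0))"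

definition hermitian_scalar ::
    "real \<Rightarrow> real \<Rightarrow> (mat4 \<Rightarrow> mat4) \<Rightarrow> real \<Rightarrow> mat4 \<Rightarrow> complex" where
  "hermitian_scalar x y J t p = (let u = (SOME u. unitary_frame x y J u) in
     \<Sum>i<3. \<Sum>j<3. cext4 (curv_tensor x y (gauduchon x y J t) p)
        (conj_mm (u i)) (u i) (u j) (conj_mm (u j)))"

definition chern_scalar :: "real \<Rightarrow> real \<Rightarrow> (mat4 \<Rightarrow> mat4) \<Rightarrow> mat4 \<Rightarrow> complex" where
  "chern_scalar x y J = hermitian_scalar x y J 1"


section \<open>The fundamental form, the Nijenhuis tensor and the Gray-Hervella classes\<close>

type_synonym form3 = "mat4 \<Rightarrow> mat4 \<Rightarrow> mat4 \<Rightarrow> real"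

definition fund :: "real \<Rightarrow> real \<Rightarrow> (mat4 \<Rightarrow> mat4) \<Rightarrow> vfield \<Rightarrow> vfield \<Rightarrow> mat4 \<Rightarrow> real" where
  "fund x y J X Y = metric x y (J \<circ> X) Y"

definition d_fund ::
    "real \<Rightarrow> real \<Rightarrow> (mat4 \<Rightarrow> mat4) \<Rightarrow> vfield \<Rightarrow> vfield \<Rightarrow> vfield \<Rightarrow> mat4 \<Rightarrow> real" where
  "d_fund x y J X Y Z = (let F = fund x y J in (\<lambda>p.
       deriv_along X (F Y Z) p - deriv_along Y (F X Z) p + deriv_along Z (F X Y) p
       - F (bracket X Y) Z p + F (bracket X Z) Y p - F (bracket Y Z) X p))"

definition dF :: "real \<Rightarrow> real \<Rightarrow> (mat4 \<Rightarrow> mat4) \<Rightarrow> mat4 \<Rightarrow> form3" where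
  "dF x y J p a b c = d_fund x y J (extend p a) (extend p b) (extend p c) p"

definition hol_part :: "(mat4 \<Rightarrow> mat4) \<Rightarrow> mat4 \<Rightarrow> mat4" where
  "hol_part J a = cmul (1 / 2) (a - cmul \<i> (J a))"
definition antihol_part :: "(mat4 \<Rightarrow> mat4) \<Rightarrow> mat4 \<Rightarrow> mat4" where
  "antihol_part J a = cmul (1 / 2) (a + cmul \<i> (J a))"

text \<open>The \<open>(3,0) + (0,3)\<close> part and the \<open>(2,1) + (1,2)\<close> part of a real 3-form. The
  complex number in the first definition is real.\<close>

definition minus_part :: "(mat4 \<Rightarrow> mat4) \<Rightarrow> form3 \<Rightarrow> form3" where
  "minus_part J \<psi> a b c =
     Re (cext3 \<psi> (hol_part J a) (hol_part J b) (hol_part J c)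
       + cext3 \<psi> (antihol_part J a) (antihol_part J b) (antihol_part J c))"
definition plus_part :: "(mat4 \<Rightarrow> mat4) \<Rightarrow> form3 \<Rightarrow> form3" where
  "plus_part J \<psi> a b c = \<psi> a b c - minus_part J \<psi> a b c"

text \<open>The contraction with \<open>F\<close>, normalised so that it sends \<open>\<beta> \<and> F\<close> to \<open>(n - 1) \<beta> = 2 \<beta>\<close>
  in complex dimension \<open>n = 3\<close>; a 3-form is primitive if it is in the kernel. The
  Lefschetz decomposition of a 3-form is \<open>\<psi> = \<psi>\<^sub>0 + \<beta> \<and> F\<close> with \<open>\<psi>\<^sub>0\<close> primitive, whence
  \<open>\<beta>\<close> is one half of the contraction of \<open>\<psi>\<close>.\<close>

definition contraction :: "real \<Rightarrow> real \<Rightarrow> (mat4 \<Rightarrow> mat4) \<Rightarrow> form3 \<Rightarrow> mat4 \<Rightarrow> real" where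
  "contraction x y J \<psi> a = 1 / 2 * (\<Sum>i<6. \<psi> (frame x y i) (J (frame x y i)) a)"

definition primitive_part :: "real \<Rightarrow> real \<Rightarrow> (mat4 \<Rightarrow> mat4) \<Rightarrow> form3 \<Rightarrow> form3" where
  "primitive_part x y J \<psi> a b c =
     (let \<beta> = (\<lambda>v. 1 / 2 * contraction x y J \<psi> v); F = (\<lambda>u v. inner_xy x y (J u) v)
      in \<psi> a b c - (\<beta> a * F b c + \<beta> b * F c a + \<beta> c * F a b))"

definition dF_minus :: "real \<Rightarrow> real \<Rightarrow> (mat4 \<Rightarrow> mat4) \<Rightarrow> mat4 \<Rightarrow> form3" where
  "dF_minus x y J p = minus_part J (dF x y J p)"

definition dF_plus0 :: "real \<Rightarrow> real \<Rightarrow> (mat4 \<Rightarrow> mat4) \<Rightarrow> mat4 \<Rightarrow> form3" where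
  "dF_plus0 x y J p = primitive_part x y J (plus_part J (dF x y J p))"

definition cov_fund ::
    "real \<Rightarrow> real \<Rightarrow> (mat4 \<Rightarrow> mat4) \<Rightarrow> vfield \<Rightarrow> vfield \<Rightarrow> vfield \<Rightarrow> mat4 \<Rightarrow> real" where
  "cov_fund x y J X Y Z = (let F = fund x y J; D = levi_civita x y in
     (\<lambda>p. deriv_along X (F Y Z) p - F (D X Y) Z p - F Y (D X Z) p))"

definition codiff_F :: "real \<Rightarrow> real \<Rightarrow> (mat4 \<Rightarrow> mat4) \<Rightarrow> mat4 \<Rightarrow> mat4 \<Rightarrow> real" where
  "codiff_F x y J p a = - (\<Sum>i<6. cov_fund x y J
     (extend p (frame x y i)) (extend p (frame x y i)) (extend p a) p)"

text \<open>\<open>J\<close> acts on 1-forms by \<open>(J \<beta>)(a) = - \<beta>(J a)\<close>; only the vanishing of the Lee form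
  is used below.\<close>

definition lee_form :: "real \<Rightarrow> real \<Rightarrow> (mat4 \<Rightarrow> mat4) \<Rightarrow> mat4 \<Rightarrow> mat4 \<Rightarrow> real" where
  "lee_form x y J p a = - codiff_F x y J p (J a)"

definition nijenhuis :: "(mat4 \<Rightarrow> mat4) \<Rightarrow> vfield \<Rightarrow> vfield \<Rightarrow> vfield" where
  "nijenhuis J X Y = (\<lambda>p. bracket X Y p - bracket (J \<circ> X) (J \<circ> Y) p
     + J (bracket (J \<circ> X) Y p) + J (bracket X (J \<circ> Y) p))"

definition integrable_acs :: "(mat4 \<Rightarrow> mat4) \<Rightarrow> bool" where
  "integrable_acs J \<longleftrightarrow> (\<forall>X Y. vector_field X \<longrightarrow> vector_field Y \<longrightarrow>
     (\<forall>p\<in>Sp2. nijenhuis J X Y p = 0))"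

definition N3 :: "real \<Rightarrow> real \<Rightarrow> (mat4 \<Rightarrow> mat4) \<Rightarrow> mat4 \<Rightarrow> form3" where
  "N3 x y J p a b c = metric x y (nijenhuis J (extend p a) (extend p b)) (extend p c) p"

definition N0 :: "real \<Rightarrow> real \<Rightarrow> (mat4 \<Rightarrow> mat4) \<Rightarrow> mat4 \<Rightarrow> form3" where
  "N0 x y J p a b c = N3 x y J p a b c
     - 1 / 3 * (N3 x y J p a b c + N3 x y J p b c a + N3 x y J p c a b)"

definition vanishes1 :: "(mat4 \<Rightarrow> mat4 \<Rightarrow> real) \<Rightarrow> bool" where
  "vanishes1 T \<longleftrightarrow> (\<forall>p\<in>Sp2. \<forall>a\<in>mm. T p a = 0)"
definition vanishes3 :: "(mat4 \<Rightarrow> form3) \<Rightarrow> bool" where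
  "vanishes3 T \<longleftrightarrow> (\<forall>p\<in>Sp2. \<forall>a\<in>mm. \<forall>b\<in>mm. \<forall>c\<in>mm. T p a b c = 0)"

definition class_W1_W2 :: "real \<Rightarrow> real \<Rightarrow> (mat4 \<Rightarrow> mat4) \<Rightarrow> bool" where
  "class_W1_W2 x y J \<longleftrightarrow> vanishes3 (dF_plus0 x y J) \<and> vanishes1 (lee_form x y J)"

definition class_W3 :: "real \<Rightarrow> real \<Rightarrow> (mat4 \<Rightarrow> mat4) \<Rightarrow> bool" where
  "class_W3 x y J \<longleftrightarrow> vanishes3 (dF_minus x y J) \<and> vanishes3 (N0 x y J)
     \<and> vanishes1 (lee_form x y J)"

definition kaehler :: "real \<Rightarrow> real \<Rightarrow> (mat4 \<Rightarrow> mat4) \<Rightarrow> bool" where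
  "kaehler x y J \<longleftrightarrow> vanishes3 (dF_minus x y J) \<and> vanishes3 (N0 x y J)
     \<and> vanishes3 (dF_plus0 x y J) \<and> vanishes1 (lee_form x y J)"

end

theory Submission
  imports Defs
begin

text \<open>Everything is reduced to algebra on the tangent space \<open>mm\<close> at the base point. A vector field is an
  equivariant function on the group, and differentiating it along left-invariant directions is an
  invariant (not torsion-free) connection; every other invariant connection differs from it by an
  equivariant bilinear map \<open>\<Lambda>\<close> on \<open>mm\<close>. The Koszul argument and the defining formula of the
  Gauduchon connections identify \<open>\<Lambda>\<close> for the Levi-Civita and the Chern connection, and the curvature is
  \<open>[\<Lambda> a, \<Lambda> b] - \<Lambda> [a, b]\<^sub>m - ad [a, b]\<^sub>h\<close>. Evaluating the traces gives
  \<open>s = (4 x\<^sup>2 + 12 x y - y\<^sup>2) / (6 x\<^sup>2 y)\<close>, and \<open>s\<^sub>1 = 2 (x + y) / (3 x y)\<close> or \<open>s\<^sub>1 = 0\<close> according as \<open>J\<close> is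
  integrable or not. In the integrable case \<open>2 s\<^sub>1 - s = (y - 2 x)\<^sup>2 / (6 x\<^sup>2 y)\<close>; in the other case
  \<open>s = 0\<close> is a quadratic equation for \<open>y / x\<close>. As to the classes, the Lee form always vanishes, and \<open>dF\<close> is of
  type \<open>(3,0) + (0,3)\<close> for the non-integrable \<open>J\<close>, and of type \<open>(2,1) + (1,2)\<close> with factor \<open>y - 2 x\<close> for the
  integrable one.\<close>

section \<open>Smooth maps\<close>

text \<open>The bracket, the two kinds of connection, the extensions of tangent vectors, the frames
  and the basis inside \<open>trace_on\<close> are all obtained by choice, so each needs a witness
  and an argument that the choice does not matter. For the bracket this rests on having enough
  functions on the homogeneous space, for the connections on testing against a vector field equal to
  the difference, and traces are moved to one fixed orthogonal basis. The second obstacle is that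
  smooth maps live on all matrices but mean something only on \<open>Sp2\<close>: equalities there
  may be differentiated only in directions \<open>p ** A\<close> with \<open>A\<close> in
  \<open>sp2\<close>. Commutators of directions in \<open>mm\<close> leave \<open>mm\<close>; their
  isotropy part kills functions on the quotient but acts on vector fields by the adjoint action, and
  this produces the last curvature term. All equivariant maps that occur lie in the family
  \<open>nomizu a b c\<close>, in which torsion and metric compatibility are linear conditions on
  \<open>a\<close>, \<open>b\<close>, \<open>c\<close>.\<close>

lemma Ck_Suc_imp: "Ck (Suc k) f \<Longrightarrow> Ck k f"
proof (induction k arbitrary: f)
  case 0
  then show ?case
    by (auto simp: continuous_on_eq_continuous_at intro: differentiable_imp_continuous_within)
next
  case (Suc k)
  then show ?case by (simp only: Ck.simps) blast
qed

lemma Ck_continuous: "Ck k f \<Longrightarrow> continuous_on UNIV f"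
proof (induction k)
  case 0
  then show ?case by simp
next
  case (Suc k)
  then show ?case using Ck_Suc_imp by blast
qed

lemma Ck_SucI:
  assumes "\<And>p. (f has_derivative f' p) (at p)" and "\<And>v. Ck k (\<lambda>p. f' p v)"
  shows "Ck (Suc k) f"
proof -
  have "frechet_derivative f (at p) = f' p" for p
    using frechet_derivative_at[OF assms(1)] by simp
  then show ?thesis
    using assms by (auto simp: differentiable_def)
qed

lemma Ck_has_derivative:
  "Ck (Suc k) f \<Longrightarrow> (f has_derivative frechet_derivative f (at p)) (at p)"
  by (simp add: frechet_derivative_works[symmetric])

lemma Ck_const: "Ck k (\<lambda>_. c)"
  by (induction k arbitrary: c) (auto intro!: continuous_intros)

lemma Ck_linear:
  assumes "bounded_linear L" and "Ck k f"
  shows "Ck k (\<lambda>p. L (f p))"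
  using assms(2)
proof (induction k arbitrary: f)
  case 0
  then show ?case
    using bounded_linear.continuous_on[OF assms(1)] by auto
next
  case (Suc k)
  show ?case
  proof (rule Ck_SucI)
    fix p
    show "((\<lambda>p. L (f p)) has_derivative (\<lambda>v. L (frechet_derivative f (at p) v))) (at p)"
      by (rule bounded_linear.has_derivative[OF assms(1) Ck_has_derivative[OF Suc.prems]])
  next
    fix v
    show "Ck k (\<lambda>p. L (frechet_derivative f (at p) v))"
      using Suc by simp
  qed
qed

lemma Ck_add:
  assumes "Ck k f" and "Ck k g"
  shows "Ck k (\<lambda>p. f p + g p)"
  using assms
proof (induction k arbitrary: f g)
  case 0
  then show ?case by (auto intro: continuous_intros)
next
  case (Suc k)
  show ?case
  proof (rule Ck_SucI)
    fix p
    show "((\<lambda>p. f p + g p) has_derivative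
        (\<lambda>v. frechet_derivative f (at p) v + frechet_derivative g (at p) v)) (at p)"
      by (rule has_derivative_add[OF Suc.prems[THEN Ck_has_derivative]])
  next
    fix v
    show "Ck k (\<lambda>p. frechet_derivative f (at p) v + frechet_derivative g (at p) v)"
      using Suc by simp
  qed
qed

lemma Ck_bilinear:
  assumes b: "bounded_bilinear b" and "Ck k f" and "Ck k g"
  shows "Ck k (\<lambda>p. b (f p) (g p))"
  using assms(2,3)
proof (induction k arbitrary: f g)
  case 0
  then show ?case by (auto intro: bounded_bilinear.continuous_on[OF b])
next
  case (Suc k)
  show ?case
  proof (rule Ck_SucI)
    fix p
    show "((\<lambda>p. b (f p) (g p)) has_derivative
        (\<lambda>v. b (f p) (frechet_derivative g (at p) v) + b (frechet_derivative f (at p) v) (g p)))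
            (at p)"
      by (rule bounded_bilinear.FDERIV[OF b Suc.prems[THEN Ck_has_derivative]])
  next
    fix v
    show "Ck k (\<lambda>p. b (f p) (frechet_derivative g (at p) v)
                  + b (frechet_derivative f (at p) v) (g p))"
      using Suc.prems Ck_Suc_imp[OF Suc.prems(1)] Ck_Suc_imp[OF Suc.prems(2)]
      by (intro Ck_add Suc.IH) auto
  qed
qed

lemma Ck_sum: "(\<And>i. i \<in> I \<Longrightarrow> Ck k (f i)) \<Longrightarrow> Ck k (\<lambda>p. \<Sum>i\<in>I. f i p)"
  by (induction I rule: infinite_finite_induct) (auto intro: Ck_const Ck_add)

lemma smooth_const: "smooth (\<lambda>_. c)"
  by (simp add: smooth_def Ck_const)

lemma smooth_id: "smooth (\<lambda>p. p)"
proof -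
  have "Ck k (\<lambda>p. p :: 'a)" for k
  proof (cases k)
    case (Suc m)
    then show ?thesis using Ck_SucI[OF has_derivative_ident Ck_const] by simp
  qed (auto intro: continuous_intros)
  then show ?thesis by (simp add: smooth_def)
qed

lemma smooth_linear: "bounded_linear L \<Longrightarrow> smooth f \<Longrightarrow> smooth (\<lambda>p. L (f p))"
  by (simp add: smooth_def Ck_linear)

lemma smooth_add: "smooth f \<Longrightarrow> smooth g \<Longrightarrow> smooth (\<lambda>p. f p + g p)"
  by (simp add: smooth_def Ck_add)

lemma smooth_bilinear:
  "bounded_bilinear b \<Longrightarrow> smooth f \<Longrightarrow> smooth g \<Longrightarrow> smooth (\<lambda>p. b (f p) (g p))"
  by (simp add: smooth_def Ck_bilinear)

lemma smooth_sum: "(\<And>i. i \<in> I \<Longrightarrow> smooth (f i)) \<Longrightarrow> smooth (\<lambda>p. \<Sum>i\<in>I. f i p)"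
  by (simp add: smooth_def Ck_sum)

lemma smooth_has_derivative:
  "smooth f \<Longrightarrow> (f has_derivative frechet_derivative f (at p)) (at p)"
  using Ck_has_derivative smooth_def by blast

lemma smooth_linear_derivative: "smooth f \<Longrightarrow> linear (frechet_derivative f (at p))"
  using smooth_has_derivative has_derivative_linear by blast

lemma smooth_continuous: "smooth f \<Longrightarrow> continuous_on UNIV f"
  using Ck_continuous smooth_def by blast

lemma smooth_derivative: "smooth f \<Longrightarrow> smooth (\<lambda>p. frechet_derivative f (at p) v)"
  unfolding smooth_def using Ck.simps(2) by blast

section \<open>Derivatives along moving directions and symmetry of second derivatives\<close>

lemma linear_basis_expansion:
  fixes w :: "'a::euclidean_space"
  assumes "linear L"
  shows "L w = (\<Sum>b\<in>Basis. (w \<bullet> b) *\<^sub>R L b)"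
  using linear_sum[OF assms, of "\<lambda>b. (w \<bullet> b) *\<^sub>R b" Basis] linear_cmul[OF assms]
  by (simp add: euclidean_representation)

text \<open>\<open>Ck\<close> controls derivatives in fixed directions only; expanding the moving
  direction in \<open>Basis\<close> gives a finite sum of fixed directions with smooth
  coefficients.\<close>

lemma smooth_derivative_along:
  fixes f :: "'a::euclidean_space \<Rightarrow> 'b::real_normed_vector"
  assumes "smooth f" and "smooth w"
  shows "smooth (\<lambda>p. frechet_derivative f (at p) (w p))"
proof -
  have "(\<lambda>p. frechet_derivative f (at p) (w p))
      = (\<lambda>p. \<Sum>b\<in>Basis. (w p \<bullet> b) *\<^sub>R frechet_derivative f (at p) b)"
    using linear_basis_expansion[OF smooth_linear_derivative[OF assms(1)]] by blast
  then show ?thesis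
    by (auto intro!: smooth_sum smooth_bilinear[OF bounded_bilinear_scaleR]
        smooth_linear[OF bounded_linear_inner_left] smooth_derivative assms)
qed

definition second_derivative ::
    "('a::real_normed_vector \<Rightarrow> 'b::real_normed_vector) \<Rightarrow> 'a \<Rightarrow> 'a \<Rightarrow> 'a \<Rightarrow> 'b" where
  "second_derivative f p v u = frechet_derivative (\<lambda>q. frechet_derivative f (at q) u) (at p) v"

text \<open>Product rule for the pairing of the derivative of \<open>f\<close> with a moving
  direction. The second-order term is the one that cancels in commutators.\<close>

lemma derivative_along_has_derivative:
  fixes f :: "'a::euclidean_space \<Rightarrow> 'b::real_normed_vector"
  assumes f: "smooth f" and w: "(w has_derivative w') (at p)"
  shows "((\<lambda>q. frechet_derivative f (at q) (w q)) has_derivative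
      (\<lambda>v. frechet_derivative f (at p) (w' v) + second_derivative f p v (w p))) (at p)"
proof -
  have lin: "linear (frechet_derivative f (at q))" for q
    by (rule smooth_linear_derivative[OF f])
  have "frechet_derivative f (at p) (w' v) + second_derivative f p v (w p) =
     (\<Sum>b\<in>Basis. (w p \<bullet> b) *\<^sub>R second_derivative f p v b
         + (w' v \<bullet> b) *\<^sub>R frechet_derivative f (at p) b)" for v
  proof -
    have "((\<lambda>q. \<Sum>b\<in>Basis. (w p \<bullet> b) *\<^sub>R frechet_derivative f (at q) b) has_derivative
       (\<lambda>v. \<Sum>b\<in>Basis. (w p \<bullet> b) *\<^sub>R second_derivative f p v b)) (at p)"
      unfolding second_derivative_def
      by (intro has_derivative_sum has_derivative_scaleR_right smooth_has_derivative
          smooth_derivative f)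
    then have "second_derivative f p v (w p)
        = (\<Sum>b\<in>Basis. (w p \<bullet> b) *\<^sub>R second_derivative f p v b)"
      unfolding linear_basis_expansion[OF lin, of _ "w p", symmetric]
      by (simp add: frechet_derivative_at[symmetric] second_derivative_def)
    then show ?thesis
      using linear_basis_expansion[OF lin, of p "w' v"] by (simp add: sum.distrib)
  qed
  moreover have "((\<lambda>q. \<Sum>b\<in>Basis. (w q \<bullet> b) *\<^sub>R frechet_derivative f (at q) b) has_derivative
     (\<lambda>v. \<Sum>b\<in>Basis. (w p \<bullet> b) *\<^sub>R second_derivative f p v b
         + (w' v \<bullet> b) *\<^sub>R frechet_derivative f (at p) b)) (at p)"
    unfolding second_derivative_def
    by (intro has_derivative_sum has_derivative_scaleR has_derivative_inner_left
        smooth_has_derivative smooth_derivative f w)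
  moreover have "(\<lambda>q. frechet_derivative f (at q) (w q))
      = (\<lambda>q. \<Sum>b\<in>Basis. (w q \<bullet> b) *\<^sub>R frechet_derivative f (at q) b)"
    using linear_basis_expansion[OF lin] by blast
  ultimately show ?thesis by simp
qed

text \<open>The mean value theorem in direction \<open>u\<close> and then in direction
  \<open>v\<close> turns the quotient into a second derivative at a nearby point, and continuity
  does the rest. Since the quotient is symmetric in \<open>u\<close> and \<open>v\<close>, the
  second derivative is symmetric too.\<close>

lemma second_difference_quotient:
  fixes f :: "'a::real_normed_vector \<Rightarrow> real"
  assumes f: "smooth f"
  shows "((\<lambda>h. (f (p + h *\<^sub>R u + h *\<^sub>R v) - f (p + h *\<^sub>R u) - f (p + h *\<^sub>R v) + f p) / h\<^sup>2)
      \<longlongrightarrow> second_derivative f p v u) (at_right 0)"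
proof (rule tendstoI)
  fix e :: real
  assume "e > 0"
  let ?D2 = "\<lambda>q. second_derivative f q v u"
  have "continuous_on UNIV ?D2"
    unfolding second_derivative_def by (intro smooth_continuous smooth_derivative f)
  then have "isCont ?D2 p" by (simp add: continuous_on_eq_continuous_at)
  then obtain d where d: "d > 0" "\<And>q. dist q p < d \<Longrightarrow> dist (?D2 q) (?D2 p) < e"
    using \<open>e > 0\<close> unfolding continuous_at_eps_delta by blast
  have deriv: "((\<lambda>s. g (q + s *\<^sub>R a)) has_real_derivative frechet_derivative g (at (q + s *\<^sub>R a)) a)
      (at s)"
    if g: "smooth g" for g :: "'a \<Rightarrow> real" and q a s
  proof -
    have "((\<lambda>s. q + s *\<^sub>R a) has_derivative (\<lambda>s. s *\<^sub>R a)) (at s)"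
      by (auto intro!: derivative_eq_intros)
    from has_derivative_compose[OF this smooth_has_derivative[OF g]]
    have "((\<lambda>s. g (q + s *\<^sub>R a)) has_derivative
        (\<lambda>t. frechet_derivative g (at (q + s *\<^sub>R a)) (t *\<^sub>R a))) (at s)" .
    then show ?thesis
      by (simp add: linear_cmul[OF smooth_linear_derivative[OF g]] has_field_derivative_def
          mult.commute[of _ "frechet_derivative g (at (q + s *\<^sub>R a)) a"])
  qed
  have "dist ((f (p + h *\<^sub>R u + h *\<^sub>R v) - f (p + h *\<^sub>R u) - f (p + h *\<^sub>R v) + f p) / h\<^sup>2) (?D2 p) < e"
    if h: "0 < h" "h < d / (norm u + norm v + 1)" for h
  proof -
    \<comment> \<open>The difference in direction \<open>v\<close>, restricted to the line along
      \<open>u\<close>; its increment from 0 to \<open>h\<close> is the numerator of the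
      quotient.\<close>
    define \<phi> where "\<phi> = (\<lambda>s. f ((p + h *\<^sub>R v) + s *\<^sub>R u) - f (p + s *\<^sub>R u))"
    define \<phi>' where "\<phi>' = (\<lambda>s. frechet_derivative f (at ((p + h *\<^sub>R v) + s *\<^sub>R u)) u
        - frechet_derivative f (at (p + s *\<^sub>R u)) u)"
    have "(\<phi> has_real_derivative \<phi>' s) (at s)" for s
      unfolding \<phi>_def \<phi>'_def by (intro DERIV_diff deriv f)
    then obtain s where s: "0 < s" "s < h" "\<phi> h - \<phi> 0 = h * \<phi>' s"
      using MVT2[of 0 h \<phi> \<phi>'] h by auto
    have "((\<lambda>t. frechet_derivative f (at ((p + s *\<^sub>R u) + t *\<^sub>R v)) u) has_real_derivative
        ?D2 ((p + s *\<^sub>R u) + t *\<^sub>R v)) (at t)" for t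
      unfolding second_derivative_def by (intro deriv smooth_derivative f)
    then obtain t where t: "0 < t" "t < h"
      "frechet_derivative f (at ((p + s *\<^sub>R u) + h *\<^sub>R v)) u
          - frechet_derivative f (at ((p + s *\<^sub>R u) + 0 *\<^sub>R v)) u
         = h * ?D2 ((p + s *\<^sub>R u) + t *\<^sub>R v)"
      using MVT2[of 0 h "\<lambda>t. frechet_derivative f (at ((p + s *\<^sub>R u) + t *\<^sub>R v)) u"
          "\<lambda>t. ?D2 ((p + s *\<^sub>R u) + t *\<^sub>R v)"] h by auto
    have "\<phi> h - \<phi> 0 = h\<^sup>2 * ?D2 ((p + s *\<^sub>R u) + t *\<^sub>R v)"
      using s(3) t(3) unfolding \<phi>'_def by (simp add: power2_eq_square algebra_simps)
    then have eq: "(f (p + h *\<^sub>R u + h *\<^sub>R v) - f (p + h *\<^sub>R u) - f (p + h *\<^sub>R v) + f p) / h\<^sup>2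
        = ?D2 ((p + s *\<^sub>R u) + t *\<^sub>R v)"
      using h by (simp add: \<phi>_def field_simps)
    have "norm (s *\<^sub>R u + t *\<^sub>R v) \<le> h * norm u + h * norm v"
      using s t by (intro norm_triangle_le add_mono) (auto intro: mult_right_mono)
    also have "\<dots> < h * (norm u + norm v + 1)" using h by (simp add: algebra_simps)
    also have "\<dots> < d"
      using h by (simp add: pos_less_divide_eq add_nonneg_pos)
    finally have "dist ((p + s *\<^sub>R u) + t *\<^sub>R v) p < d" by (simp add: dist_norm add.assoc)
    then show ?thesis using d eq by simp
  qed
  then show "\<forall>\<^sub>F h in at_right 0. dist ((f (p + h *\<^sub>R u + h *\<^sub>R v) - f (p + h *\<^sub>R u)
      - f (p + h *\<^sub>R v) + f p) / h\<^sup>2) (?D2 p) < e"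
    unfolding eventually_at_right_field
    using d(1) by (intro exI[of _ "d / (norm u + norm v + 1)"]) (auto simp: add_nonneg_pos)
qed

lemma second_derivative_commute_real:
  fixes f :: "'a::real_normed_vector \<Rightarrow> real"
  assumes "smooth f"
  shows "second_derivative f p u v = second_derivative f p v u"
proof -
  have "(\<lambda>h. (f (p + h *\<^sub>R u + h *\<^sub>R v) - f (p + h *\<^sub>R u) - f (p + h *\<^sub>R v) + f p) / h\<^sup>2)
      = (\<lambda>h. (f (p + h *\<^sub>R v + h *\<^sub>R u) - f (p + h *\<^sub>R v) - f (p + h *\<^sub>R u) + f p) / h\<^sup>2)"
    by (simp add: algebra_simps)
  then have "((\<lambda>h. (f (p + h *\<^sub>R u + h *\<^sub>R v) - f (p + h *\<^sub>R u) - f (p + h *\<^sub>R v) + f p) / h\<^sup>2)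
      \<longlongrightarrow> second_derivative f p u v) (at_right 0)"
    using second_difference_quotient[OF assms, of p v u] by simp
  then show ?thesis
    using tendsto_unique[OF trivial_limit_at_right_real _ second_difference_quotient[OF assms]]
      by blast
qed

lemma frechet_derivative_linear:
  assumes "bounded_linear L" and "smooth f"
  shows "frechet_derivative (\<lambda>q. L (f q)) (at p) v = L (frechet_derivative f (at p) v)"
  using frechet_derivative_at[OF bounded_linear.has_derivative[OF assms(1)
      smooth_has_derivative[OF assms(2)]]]
  by metis

lemma second_derivative_commute:
  fixes f :: "'a::real_normed_vector \<Rightarrow> 'b::euclidean_space"
  assumes f: "smooth f"
  shows "second_derivative f p u v = second_derivative f p v u"
proof (rule euclidean_eqI)
  fix b :: 'b
  have "second_derivative f p u v \<bullet> b = second_derivative (\<lambda>q. f q \<bullet> b) p u v" for u v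
    unfolding second_derivative_def
    by (simp add: frechet_derivative_linear[OF bounded_linear_inner_left] f smooth_derivative)
  then show "second_derivative f p u v \<bullet> b = second_derivative f p v u \<bullet> b"
    using second_derivative_commute_real smooth_linear[OF bounded_linear_inner_left f] by metis
qed

section \<open>The Lie algebra in coordinates\<close>

text \<open>In block form these are the matrices \<open>(A, B; - B\<^sup>*, - A\<^sup>T)\<close> with \<open>A\<close> skew-Hermitian and \<open>B\<close>
  symmetric: the arguments \<open>a, b, v\<close> are the coordinates of the isotropy algebra, while \<open>z, w, u\<close>
  belong to the roots \<open>\<lambda>\<^sub>1 - \<lambda>\<^sub>2\<close>, \<open>\<lambda>\<^sub>1 + \<lambda>\<^sub>2\<close> and \<open>2 \<lambda>\<^sub>1\<close>.\<close>

definition sp2_mat :: "real \<Rightarrow> real \<Rightarrow> complex \<Rightarrow> complex \<Rightarrow> complex \<Rightarrow> complex \<Rightarrow> mat4" where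
  "sp2_mat a b v z w u = (\<chi> i j.
     if i = 1 then (if j = 1 then \<i> * a else if j = 2 then z else if j = 3 then u else w)
     else if i = 2 then (if j = 1 then - cnj z else if j = 2 then \<i> * b else if j = 3 then w else v)
     else if i = 3 then (if j = 1 then - cnj u else if j = 2 then - cnj w else if j = 3 then
         - \<i> * a else cnj z)
     else (if j = 1 then - cnj w else if j = 2 then - cnj v else if j = 3 then - z else - \<i> * b))"

lemma sp2_mat_nth [simp]:
  "sp2_mat a b v z w u $ 1 $ 1 = \<i> * a" "sp2_mat a b v z w u $ 1 $ 2 = z"
  "sp2_mat a b v z w u $ 1 $ 3 = u" "sp2_mat a b v z w u $ 1 $ 4 = w"
  "sp2_mat a b v z w u $ 2 $ 1 = - cnj z" "sp2_mat a b v z w u $ 2 $ 2 = \<i> * b"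
  "sp2_mat a b v z w u $ 2 $ 3 = w" "sp2_mat a b v z w u $ 2 $ 4 = v"
  "sp2_mat a b v z w u $ 3 $ 1 = - cnj u" "sp2_mat a b v z w u $ 3 $ 2 = - cnj w"
  "sp2_mat a b v z w u $ 3 $ 3 = - \<i> * a" "sp2_mat a b v z w u $ 3 $ 4 = cnj z"
  "sp2_mat a b v z w u $ 4 $ 1 = - cnj w" "sp2_mat a b v z w u $ 4 $ 2 = - cnj v"
  "sp2_mat a b v z w u $ 4 $ 3 = - z" "sp2_mat a b v z w u $ 4 $ 4 = - \<i> * b"
  by (simp_all add: sp2_mat_def)

lemma Omega_nth:
  "Omega $ 1 $ 1 = 0" "Omega $ 1 $ 2 = 0" "Omega $ 1 $ 3 = 1" "Omega $ 1 $ 4 = 0"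
  "Omega $ 2 $ 1 = 0" "Omega $ 2 $ 2 = 0" "Omega $ 2 $ 3 = 0" "Omega $ 2 $ 4 = 1"
  "Omega $ 3 $ 1 = - 1" "Omega $ 3 $ 2 = 0" "Omega $ 3 $ 3 = 0" "Omega $ 3 $ 4 = 0"
  "Omega $ 4 $ 1 = 0" "Omega $ 4 $ 2 = - 1" "Omega $ 4 $ 3 = 0" "Omega $ 4 $ 4 = 0"
  by (simp_all add: Omega_def)

lemma adj_nth: "adj A $ i $ j = cnj (A $ j $ i)"
  by (simp add: adj_def)

lemma cmul_nth: "cmul c A $ i $ j = c * A $ i $ j"
  by (simp add: cmul_def)

lemma mat4_mult_nth:
  "((A :: mat4) ** B) $ i $ j = A$i$1 * B$1$j + A$i$2 * B$2$j + A$i$3 * B$3$j + A$i$4 * B$4$j"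
  by (simp add: matrix_matrix_mult_def sum_4)

lemma mat4_eq_iff: "A = B \<longleftrightarrow> (\<forall>i j. (A :: mat4) $ i $ j = B $ i $ j)"
  by (simp add: vec_eq_iff)

lemma sp4C_iff:
  "X \<in> sp4C \<longleftrightarrow> X$3$3 = - X$1$1 \<and> X$4$4 = - X$2$2 \<and> X$3$4 = - X$2$1 \<and> X$4$3 = - X$1$2
     \<and> X$1$4 = X$2$3 \<and> X$3$2 = X$4$1"
  unfolding sp4C_def mat4_eq_iff mem_Collect_eq forall_4
  by (simp add: mat4_mult_nth transpose_def Omega_nth) (auto simp: algebra_simps add_eq_0_iff)

lemma sp2_eq_sp2_mat:
  assumes "X \<in> sp2"
  shows "X = sp2_mat (Im (X$1$1)) (Im (X$2$2)) (X$2$4) (X$1$2) (X$1$4) (X$1$3)"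
proof -
  have X: "X \<in> sp4C" and "adj X = - X" using assms by (auto simp: sp2_def)
  then have cnj: "cnj (X $ j $ i) = - X $ i $ j" for i j
    by (metis adj_nth vector_uminus_component)
  have "Re (X$1$1) = 0" "Re (X$2$2) = 0"
    using cnj[of 1 1] cnj[of 2 2] by (simp_all add: complex_eq_iff)
  then have d: "X$1$1 = \<i> * Im (X$1$1)" "X$2$2 = \<i> * Im (X$2$2)" by (simp_all add: complex_eq_iff)
  have c: "X$2$1 = - cnj (X$1$2)" "X$3$1 = - cnj (X$1$3)" "X$4$1 = - cnj (X$1$4)"
     "X$4$2 = - cnj (X$2$4)"
    using cnj[of 1 2] cnj[of 1 3] cnj[of 1 4] cnj[of 2 4] by simp_all
  show ?thesis
    using X c d unfolding mat4_eq_iff forall_4 sp4C_iff by simp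
qed

lemma sp2_mat_in_sp2 [simp, intro]: "sp2_mat a b v z w u \<in> sp2"
  by (simp add: sp2_def sp4C_iff mat4_eq_iff forall_4 adj_nth)

lemma sp2_sp2_mat_cases:
  assumes "X \<in> sp2" obtains a b v z w u where "X = sp2_mat a b v z w u"
  using sp2_eq_sp2_mat[OF assms] by metis

lemma sp2_mat_add: "sp2_mat a b v z w u + sp2_mat a' b' v' z' w' u'
    = sp2_mat (a+a') (b+b') (v+v') (z+z') (w+w') (u+u')"
  by (simp add: mat4_eq_iff forall_4 algebra_simps)

lemma sp2_mat_minus: "- sp2_mat a b v z w u = sp2_mat (-a) (-b) (-v) (-z) (-w) (-u)"
  by (simp add: mat4_eq_iff forall_4)

lemma sp2_mat_diff: "sp2_mat a b v z w u - sp2_mat a' b' v' z' w' u'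
    = sp2_mat (a-a') (b-b') (v-v') (z-z') (w-w') (u-u')"
  by (simp add: mat4_eq_iff forall_4 algebra_simps)

lemma sp2_mat_scaleR:
  "t *\<^sub>R sp2_mat a b v z w u
      = sp2_mat (t * a) (t * b) (of_real t * v) (of_real t * z) (of_real t * w) (of_real t * u)"
  by (simp add: mat4_eq_iff forall_4) (simp add: complex_eq_iff)

lemma sp2_mat_0: "sp2_mat 0 0 0 0 0 0 = 0"
  by (simp add: mat4_eq_iff forall_4)

lemma sp2_mat_inject: "sp2_mat a b v z w u = sp2_mat a' b' v' z' w' u' \<longleftrightarrow>
    a = a' \<and> b = b' \<and> v = v' \<and> z = z' \<and> w = w' \<and> u = u'"
  by (auto simp: mat4_eq_iff forall_4)

lemma comm_sp2_mat: "comm (sp2_mat a b v z w u) (sp2_mat a' b' v' z' w' u') = sp2_mat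
   (2 * Im (z' * cnj z + u' * cnj u + w' * cnj w))
   (2 * Im (cnj z' * z + w' * cnj w + v' * cnj v))
   (2 * (w * cnj z' - w' * cnj z) + 2 * \<i> * (b * v' - b' * v))
   (\<i> * (a - b) * z' - \<i> * (a' - b') * z + u' * cnj w - u * cnj w' + w' * cnj v - w * cnj v')
   (\<i> * (a + b) * w' - \<i> * (a' + b') * w + u * cnj z' - u' * cnj z + z * v' - z' * v)
   (2 * (z * w' - w * z') + 2 * \<i> * (a * u' - a' * u))"
  by (simp add: mat4_eq_iff forall_4 comm_def mat4_mult_nth)
      (auto simp: complex_eq_iff algebra_simps)

lemma inner_mat4: "(A :: mat4) \<bullet> B = (\<Sum>i\<in>UNIV. \<Sum>j\<in>UNIV. Re (A $ i $ j * cnj (B $ i $ j)))"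
  by (simp add: inner_vec_def inner_complex_def)

lemma inner_sp2_mat: "sp2_mat a b v z w u \<bullet> sp2_mat a' b' v' z' w' u'
   = 2 * a * a' + 2 * b * b' + 2 * (v \<bullet> v') + 4 * (z \<bullet> z') + 4 * (w \<bullet> w') + 2 * (u \<bullet> u')"
  by (simp add: inner_mat4 sum_4 inner_complex_def algebra_simps)

lemma subspace_sp2: "subspace sp2"
  by (rule subspaceI) (auto elim!: sp2_sp2_mat_cases simp: sp2_mat_add sp2_mat_scaleR, metis
      sp2_mat_0 sp2_mat_in_sp2)

lemma comm_in_sp2: "X \<in> sp2 \<Longrightarrow> Y \<in> sp2 \<Longrightarrow> comm X Y \<in> sp2"
  by (auto elim!: sp2_sp2_mat_cases simp: comm_sp2_mat)

abbreviation mm_mat :: "complex \<Rightarrow> complex \<Rightarrow> complex \<Rightarrow> mat4" where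
  "mm_mat z w u \<equiv> sp2_mat 0 0 0 z w u"

text \<open>Together with \<open>gens_m\<close> an orthogonal, not orthonormal, basis of
  \<open>sp2\<close> for the Euclidean inner product. Integer entries keep all traces computable by
  simplification, at the price of dividing by squared lengths.\<close>

definition gens_h :: "mat4 set" where
  "gens_h = {sp2_mat 1 0 0 0 0 0, sp2_mat 0 1 0 0 0 0, sp2_mat 0 0 1 0 0 0, sp2_mat 0 0 \<i> 0 0 0}"
definition gens_m :: "mat4 set" where
  "gens_m = {mm_mat 1 0 0, mm_mat \<i> 0 0, mm_mat 0 1 0, mm_mat 0 \<i> 0, mm_mat 0 0 1, mm_mat 0 0 \<i>}"

lemma span_gens_h: "sp2_mat a b v 0 0 0 \<in> span gens_h"
proof -
  have "sp2_mat a b v 0 0 0 = a *\<^sub>R sp2_mat 1 0 0 0 0 0 + b *\<^sub>R sp2_mat 0 1 0 0 0 0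
      + Re v *\<^sub>R sp2_mat 0 0 1 0 0 0 + Im v *\<^sub>R sp2_mat 0 0 \<i> 0 0 0"
    unfolding sp2_mat_scaleR sp2_mat_add sp2_mat_inject by (simp add: complex_eq_iff)
  also have "\<dots> \<in> span gens_h"
    by (intro span_add span_scale span_base) (auto simp: gens_h_def)
  finally show ?thesis .
qed

lemma span_gens_m: "mm_mat z w u \<in> span gens_m"
proof -
  have "mm_mat z w u = Re z *\<^sub>R mm_mat 1 0 0 + Im z *\<^sub>R mm_mat \<i> 0 0 + Re w *\<^sub>R mm_mat 0 1 0
      + Im w *\<^sub>R mm_mat 0 \<i> 0 + Re u *\<^sub>R mm_mat 0 0 1 + Im u *\<^sub>R mm_mat 0 0 \<i>"
    unfolding sp2_mat_scaleR sp2_mat_add sp2_mat_inject by (simp add: complex_eq_iff)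
  also have "\<dots> \<in> span gens_m"
    by (intro span_add span_scale span_base) (auto simp: gens_m_def)
  finally show ?thesis .
qed

lemma span_gens: "span (gens_h \<union> gens_m) = sp2"
proof
  show "span (gens_h \<union> gens_m) \<subseteq> sp2"
    by (rule span_minimal[OF _ subspace_sp2]) (auto simp: gens_h_def gens_m_def)
  show "sp2 \<subseteq> span (gens_h \<union> gens_m)"
  proof
    fix X assume "X \<in> sp2"
    then obtain a b v z w u where "X = sp2_mat a b v z w u" by (rule sp2_sp2_mat_cases)
    then have "X = sp2_mat a b v 0 0 0 + mm_mat z w u" by (simp add: sp2_mat_add)
    then show "X \<in> span (gens_h \<union> gens_m)"
      using span_gens_h[of a b v] span_gens_m[of z w u]
        span_mono[of gens_h "gens_h \<union> gens_m"] span_mono[of gens_m "gens_h \<union> gens_m"]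
      by (auto intro!: span_add)
  qed
qed

section \<open>Traces and the Killing form\<close>

lemma orthogonal_basis_expansion:
  fixes v :: "'a::real_inner"
  assumes "finite E" and "\<And>e e'. e \<in> E \<Longrightarrow> e' \<in> E \<Longrightarrow> e \<noteq> e' \<Longrightarrow> e \<bullet> e' = 0" and "v \<in> span E"
  shows "v = (\<Sum>e\<in>E. ((v \<bullet> e) / (e \<bullet> e)) *\<^sub>R e)"
proof -
  obtain c where c: "v = (\<Sum>e\<in>E. c e *\<^sub>R e)"
    using assms(3) unfolding span_finite[OF assms(1)] by auto
  have "((v \<bullet> e) / (e \<bullet> e)) *\<^sub>R e = c e *\<^sub>R e" if "e \<in> E" for e
  proof -
    have "v \<bullet> e = (\<Sum>e'\<in>E. c e' * (e' \<bullet> e))" by (simp add: c inner_sum_left)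
    also have "\<dots> = (\<Sum>e'\<in>E. if e' = e then c e * (e \<bullet> e) else 0)"
      using assms(2) that by (intro sum.cong) auto
    \<comment> \<open>\<open>E\<close> may contain 0; that term is zero on both sides whatever its
      coefficient.\<close>
    finally show ?thesis using assms(1) that by (cases "e = 0") simp_all
  qed
  then have "(\<Sum>e\<in>E. ((v \<bullet> e) / (e \<bullet> e)) *\<^sub>R e) = (\<Sum>e\<in>E. c e *\<^sub>R e)" by (rule sum.cong[OF refl])
  with c show ?thesis by (rule trans[OF _ sym])
qed

text \<open>The basis \<open>B\<close> behind \<open>trace_on\<close> is unknown. Each
  \<open>b\<close> in \<open>B\<close> is expanded along \<open>E\<close>; after exchanging the
  sums, the inner sum over \<open>B\<close> reassembles \<open>f e\<close> from its
  coordinates.\<close>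

lemma trace_on_orthogonal_basis:
  fixes f :: "'a::euclidean_space \<Rightarrow> 'a"
  assumes E: "finite E" "\<And>e e'. e \<in> E \<Longrightarrow> e' \<in> E \<Longrightarrow> e \<noteq> e' \<Longrightarrow> e \<bullet> e' = 0"
    and S: "span E = S" and f: "linear f" "f ` S \<subseteq> S"
  shows "trace_on S f = (\<Sum>e\<in>E. (f e \<bullet> e) / (e \<bullet> e))"
proof -
  define B where "B = (SOME B. independent B \<and> span B = S)"
  have "\<exists>B. independent B \<and> span B = S"
    using maximal_independent_subset[of S] S
      by (metis span_eq span_span span_superset subset_antisym span_mono)
  then have B: "independent B" "span B = S" unfolding B_def
    by (metis (mono_tags, lifting) someI_ex)+
  have fin: "finite B" using B(1) by (rule independent_imp_finite)
  have "representation B (f b) b = (\<Sum>e\<in>E. ((b \<bullet> e) / (e \<bullet> e)) * representation B (f e) b)"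
    if b: "b \<in> B" for b
  proof -
    have "b \<in> span E" using b B S span_base by blast
    then have "f b = (\<Sum>e\<in>E. ((b \<bullet> e) / (e \<bullet> e)) *\<^sub>R f e)"
      using orthogonal_basis_expansion[OF E] linear_sum[OF f(1)] linear_cmul[OF f(1)]
      by (smt (verit, best) sum.cong)
    moreover have "f e \<in> span B" if "e \<in> E" for e
      using f(2) B S that span_base by blast
    ultimately show ?thesis
      using B(1) by (simp add: representation_sum representation_scale span_scale)
  qed
  then have "trace_on S f
      = (\<Sum>b\<in>B. \<Sum>e\<in>E. ((b \<bullet> e) / (e \<bullet> e)) * representation B (f e) b)"
    unfolding trace_on_def B_def[symmetric] by simp
  also have "\<dots> = (\<Sum>e\<in>E. ((\<Sum>b\<in>B. representation B (f e) b *\<^sub>R b) \<bullet> e) / (e \<bullet> e))"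
    by (subst sum.swap) (simp add: inner_sum_left sum_divide_distrib mult.commute)
  also have "\<dots> = (\<Sum>e\<in>E. (f e \<bullet> e) / (e \<bullet> e))"
  proof (rule sum.cong)
    fix e assume "e \<in> E"
    then have "f e \<in> span B" using f(2) B S span_base by blast
    then show "((\<Sum>b\<in>B. representation B (f e) b *\<^sub>R b) \<bullet> e) / (e \<bullet> e) = (f e \<bullet> e) / (e \<bullet> e)"
      using sum_representation_eq[OF B(1) _ fin order_refl] by simp
  qed simp
  finally show ?thesis .
qed

lemma comm_distribs:
  "comm A (B + C) = comm A B + comm A C" "comm (B + C) A = comm B A + comm C A"
  "comm A (t *\<^sub>R B) = t *\<^sub>R comm A B" "comm (t *\<^sub>R B) A = t *\<^sub>R comm B A"
  by (simp_all add: mat4_eq_iff comm_def mat4_mult_nth algebra_simps)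

text \<open>The Killing form of the symplectic algebra of rank n is 2 (n + 1) times the trace of the
  product, hence 6 times it here, and on skew-Hermitian matrices that trace is
  \<open>- (X \<bullet> Y)\<close>.\<close>

lemma killing_eq:
  assumes "X \<in> sp2" and "Y \<in> sp2"
  shows "killing X Y = - 6 * (X \<bullet> Y)"
proof -
  have "killing X Y = (\<Sum>e\<in>gens_h \<union> gens_m. (comm X (comm Y e) \<bullet> e) / (e \<bullet> e))"
    unfolding killing_def
  proof (rule trace_on_orthogonal_basis)
    show "finite (gens_h \<union> gens_m)" by (simp add: gens_h_def gens_m_def)
    show "span (gens_h \<union> gens_m) = sp2" by (rule span_gens)
    show "linear (\<lambda>Z. comm X (comm Y Z))" by (rule linearI) (simp_all add: comm_distribs)
    show "(\<lambda>Z. comm X (comm Y Z)) ` sp2 \<subseteq> sp2" using assms comm_in_sp2 by blast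
    show "e \<bullet> e' = 0" if "e \<in> gens_h \<union> gens_m" "e' \<in> gens_h \<union> gens_m" "e \<noteq> e'" for e e'
      using that by (auto simp: gens_h_def gens_m_def inner_sp2_mat inner_complex_def)
  qed
  also have "\<dots> = - 6 * (X \<bullet> Y)"
    using assms
    by (elim sp2_sp2_mat_cases)
       (simp add: gens_h_def gens_m_def sp2_mat_inject complex_eq_iff comm_sp2_mat inner_sp2_mat
           inner_complex_def
         add_divide_distrib diff_divide_distrib algebra_simps)
  finally show ?thesis .
qed

text \<open>The arguments are the components along the roots \<open>\<lambda>\<^sub>1 - \<lambda>\<^sub>2\<close>, \<open>\<lambda>\<^sub>1 + \<lambda>\<^sub>2\<close> and \<open>2 \<lambda>\<^sub>1\<close>, each
  followed by the component along the opposite root.\<close>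

definition mmC_mat :: "complex \<Rightarrow> complex \<Rightarrow> complex \<Rightarrow> complex \<Rightarrow> complex \<Rightarrow> complex \<Rightarrow> mat4" where
  "mmC_mat p q r s t m = (\<chi> i j.
     if i = 1 then (if j = 1 then 0 else if j = 2 then p else if j = 3 then t else r)
     else if i = 2 then (if j = 1 then q else if j = 2 then 0 else if j = 3 then r else 0)
     else if i = 3 then (if j = 1 then m else if j = 2 then s else if j = 3 then 0 else - q)
     else (if j = 1 then s else if j = 2 then 0 else if j = 3 then - p else 0))"

lemma mmC_mat_nth [simp]:
  "mmC_mat p q r s t m $ 1 $ 1 = 0" "mmC_mat p q r s t m $ 1 $ 2 = p"
  "mmC_mat p q r s t m $ 1 $ 3 = t" "mmC_mat p q r s t m $ 1 $ 4 = r"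
  "mmC_mat p q r s t m $ 2 $ 1 = q" "mmC_mat p q r s t m $ 2 $ 2 = 0"
  "mmC_mat p q r s t m $ 2 $ 3 = r" "mmC_mat p q r s t m $ 2 $ 4 = 0"
  "mmC_mat p q r s t m $ 3 $ 1 = m" "mmC_mat p q r s t m $ 3 $ 2 = s"
  "mmC_mat p q r s t m $ 3 $ 3 = 0" "mmC_mat p q r s t m $ 3 $ 4 = - q"
  "mmC_mat p q r s t m $ 4 $ 1 = s" "mmC_mat p q r s t m $ 4 $ 2 = 0"
  "mmC_mat p q r s t m $ 4 $ 3 = - p" "mmC_mat p q r s t m $ 4 $ 4 = 0"
  by (simp_all add: mmC_mat_def)

lemma mm_mat_mmC_mat: "mm_mat z w u = mmC_mat z (- cnj z) w (- cnj w) u (- cnj u)"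
  by (simp add: mat4_eq_iff forall_4)

lemma mmC_mat_add: "mmC_mat p q r s t m + mmC_mat p' q' r' s' t' m'
    = mmC_mat (p+p') (q+q') (r+r') (s+s') (t+t') (m+m')"
  by (simp add: mat4_eq_iff forall_4)

lemma mmC_mat_diff: "mmC_mat p q r s t m - mmC_mat p' q' r' s' t' m'
    = mmC_mat (p-p') (q-q') (r-r') (s-s') (t-t') (m-m')"
  by (simp add: mat4_eq_iff forall_4)

lemma mmC_mat_minus: "- mmC_mat p q r s t m = mmC_mat (-p) (-q) (-r) (-s) (-t) (-m)"
  by (simp add: mat4_eq_iff forall_4)

lemma mmC_mat_cmul: "cmul c (mmC_mat p q r s t m)
    = mmC_mat (c * p) (c * q) (c * r) (c * s) (c * t) (c * m)"
  by (simp add: mat4_eq_iff forall_4 cmul_nth)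

lemma mmC_mat_scaleR: "x *\<^sub>R mmC_mat p q r s t m
   = mmC_mat (of_real x * p) (of_real x * q) (of_real x * r) (of_real x * s) (of_real x * t)
       (of_real x * m)"
  by (simp add: mat4_eq_iff forall_4) (simp add: complex_eq_iff)

lemma mmC_mat_adj: "adj (mmC_mat p q r s t m)
    = mmC_mat (cnj q) (cnj p) (cnj s) (cnj r) (cnj m) (cnj t)"
  by (simp add: mat4_eq_iff forall_4 adj_nth)

lemma mmC_mat_inject: "mmC_mat p q r s t m = mmC_mat p' q' r' s' t' m' \<longleftrightarrow>
    p = p' \<and> q = q' \<and> r = r' \<and> s = s' \<and> t = t' \<and> m = m'"
  by (auto simp: mat4_eq_iff forall_4)

section \<open>Root spaces and the isotropy summands\<close>

lemma cartan_nth: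
  "cartan a b $ 1 $ 1 = a" "cartan a b $ 2 $ 2 = b" "cartan a b $ 3 $ 3 = - a"
      "cartan a b $ 4 $ 4 = - b"
  "i \<noteq> j \<Longrightarrow> cartan a b $ i $ j = 0"
  by (simp_all add: cartan_def)

text \<open>Bracketing with a diagonal matrix multiplies each entry by a difference of diagonal
  entries, so membership in a root space is an entrywise condition.\<close>

lemma root_space_iff: "X \<in> root_space \<alpha> \<longleftrightarrow> X \<in> sp4C \<and>
  (\<forall>a b i j. (cartan a b $ i $ i - cartan a b $ j $ j) * X $ i $ j
      = (of_int (fst \<alpha>) * a + of_int (snd \<alpha>) * b) * X $ i $ j)"
proof -
  have "comm (cartan a b) X $ i $ j = (cartan a b $ i $ i - cartan a b $ j $ j) * X $ i $ j" for a
      b i j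
  proof -
    have "(cartan a b ** X) $ i $ j
        = (\<Sum>k\<in>UNIV. if k = i then cartan a b $ i $ i * X $ i $ j else 0)"
      by (subst matrix_matrix_mult_def, simp only: vec_lambda_beta, rule sum.cong[OF refl])
          (auto simp: cartan_nth)
    moreover have "(X ** cartan a b) $ i $ j
        = (\<Sum>k\<in>UNIV. if k = j then cartan a b $ j $ j * X $ i $ j else 0)"
      by (subst matrix_matrix_mult_def, simp only: vec_lambda_beta, rule sum.cong[OF refl])
          (auto simp: cartan_nth)
    ultimately show ?thesis by (simp add: comm_def algebra_simps)
  qed
  then show ?thesis by (simp add: root_space_def mat4_eq_iff cmul_nth)
qed

lemma mmC_mat_in_root_space:
  "mmC_mat c 0 0 0 0 0 \<in> root_space root1" "mmC_mat 0 c 0 0 0 0 \<in> root_space (- root1)"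
  "mmC_mat 0 0 c 0 0 0 \<in> root_space root2" "mmC_mat 0 0 0 c 0 0 \<in> root_space (- root2)"
  "mmC_mat 0 0 0 0 c 0 \<in> root_space root3" "mmC_mat 0 0 0 0 0 c \<in> root_space (- root3)"
  unfolding root_space_iff sp4C_iff forall_4 by (simp_all, simp_all add: cartan_nth)

lemma root_space_roots1:
  assumes "\<alpha> \<in> roots1" and "X \<in> root_space \<alpha>"
  shows "\<exists>p q r s. X = mmC_mat p q r s 0 0"
proof -
  have X: "X \<in> sp4C" and eq: "(cartan a b $ i $ i - cartan a b $ j $ j) * X $ i $ j
      = (of_int (fst \<alpha>) * a + of_int (snd \<alpha>) * b) * X $ i $ j" for a b i j
    using assms(2) by (auto simp: root_space_iff)
  \<comment> \<open>Each of these entries has a weight that differs from the root at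
    \<open>(a, b) = (1, 0)\<close> or at \<open>(0, 1)\<close>, so it must vanish.\<close>
  have "X$1$1 = 0" "X$2$2 = 0" "X$2$4 = 0" "X$4$2 = 0" "X$1$3 = 0" "X$3$1 = 0"
    using assms(1) eq[of 1 0 1 1, unfolded cartan_nth] eq[of 1 0 2 2, unfolded cartan_nth]
      eq[of 1 0 2 4, unfolded cartan_nth] eq[of 1 0 4 2, unfolded cartan_nth]
      eq[of 0 1 1 3, unfolded cartan_nth] eq[of 0 1 3 1, unfolded cartan_nth]
    unfolding roots1_def by (elim insertE; simp)+
  then have "X = mmC_mat (X$1$2) (X$2$1) (X$1$4) (X$4$1) 0 0"
    using X by (simp add: sp4C_iff mat4_eq_iff forall_4)
  then show ?thesis by blast
qed

lemma root_space_roots2: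
  assumes "\<alpha> \<in> roots2" and "X \<in> root_space \<alpha>"
  shows "\<exists>t m. X = mmC_mat 0 0 0 0 t m"
proof -
  have X: "X \<in> sp4C" and eq: "(cartan a b $ i $ i - cartan a b $ j $ j) * X $ i $ j
      = (of_int (fst \<alpha>) * a + of_int (snd \<alpha>) * b) * X $ i $ j" for a b i j
    using assms(2) by (auto simp: root_space_iff)
  have "X$1$1 = 0" "X$2$2 = 0" "X$2$4 = 0" "X$4$2 = 0" "X$1$2 = 0" "X$2$1 = 0" "X$1$4 = 0"
      "X$4$1 = 0"
    using assms(1) eq[of 1 0 1 1, unfolded cartan_nth] eq[of 1 0 2 2, unfolded cartan_nth]
      eq[of 1 0 2 4, unfolded cartan_nth] eq[of 1 0 4 2, unfolded cartan_nth]
      eq[of 0 1 1 2, unfolded cartan_nth] eq[of 0 1 2 1, unfolded cartan_nth]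
      eq[of 0 1 1 4, unfolded cartan_nth] eq[of 0 1 4 1, unfolded cartan_nth]
    unfolding roots2_def by (elim insertE; simp)+
  then have "X = mmC_mat 0 0 0 0 (X$1$3) (X$3$1)"
    using X by (simp add: sp4C_iff mat4_eq_iff forall_4)
  then show ?thesis by blast
qed

lemma mmC_mat_0: "mmC_mat 0 0 0 0 0 0 = 0"
  by (simp add: mat4_eq_iff forall_4)

lemma span_roots1: "span (\<Union>\<alpha>\<in>roots1. root_space \<alpha>) = {mmC_mat p q r s 0 0 |p q r s. True}"
proof
  have "subspace {mmC_mat p q r s 0 0 |p q r s. True}"
  proof (rule subspaceI)
    show "0 \<in> {mmC_mat p q r s 0 0 |p q r s. True}" using mmC_mat_0[symmetric] by blast
    fix X Y assume "X \<in> {mmC_mat p q r s 0 0 |p q r s. True}"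
        and "Y \<in> {mmC_mat p q r s 0 0 |p q r s. True}"
    then show "X + Y \<in> {mmC_mat p q r s 0 0 |p q r s. True}"
      by (auto simp: mmC_mat_add mmC_mat_inject)
  next
    fix c :: real and X assume "X \<in> {mmC_mat p q r s 0 0 |p q r s. True}"
    then show "c *\<^sub>R X \<in> {mmC_mat p q r s 0 0 |p q r s. True}"
      by (auto simp: mmC_mat_scaleR mmC_mat_inject)
  qed
  then show "span (\<Union>\<alpha>\<in>roots1. root_space \<alpha>) \<subseteq> {mmC_mat p q r s 0 0 |p q r s. True}"
    using root_space_roots1 by (intro span_minimal) auto
  have "mmC_mat p q r s 0 0 \<in> span (\<Union>\<alpha>\<in>roots1. root_space \<alpha>)" for p q r s
  proof -
    have "mmC_mat p q r s 0 0 = mmC_mat p 0 0 0 0 0 + mmC_mat 0 q 0 0 0 0 + mmC_mat 0 0 r 0 0 0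
        + mmC_mat 0 0 0 s 0 0"
      by (simp add: mmC_mat_add)
    also have "\<dots> \<in> span (\<Union>\<alpha>\<in>roots1. root_space \<alpha>)"
      by (intro span_add span_base; rule UN_I[rotated], rule mmC_mat_in_root_space,
          simp add: roots1_def)
    finally show ?thesis .
  qed
  then show "{mmC_mat p q r s 0 0 |p q r s. True} \<subseteq> span (\<Union>\<alpha>\<in>roots1. root_space \<alpha>)" by blast
qed

lemma span_roots2: "span (\<Union>\<alpha>\<in>roots2. root_space \<alpha>) = {mmC_mat 0 0 0 0 t m |t m. True}"
proof
  have "subspace {mmC_mat 0 0 0 0 t m |t m. True}"
  proof (rule subspaceI)
    show "0 \<in> {mmC_mat 0 0 0 0 t m |t m. True}" using mmC_mat_0[symmetric] by blast
    fix X Y assume "X \<in> {mmC_mat 0 0 0 0 t m |t m. True}" and "Y \<in> {mmC_mat 0 0 0 0 t m |t m. True}"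
    then show "X + Y \<in> {mmC_mat 0 0 0 0 t m |t m. True}" by (auto simp: mmC_mat_add mmC_mat_inject)
  next
    fix c :: real and X assume "X \<in> {mmC_mat 0 0 0 0 t m |t m. True}"
    then show "c *\<^sub>R X \<in> {mmC_mat 0 0 0 0 t m |t m. True}"
      by (auto simp: mmC_mat_scaleR mmC_mat_inject)
  qed
  then show "span (\<Union>\<alpha>\<in>roots2. root_space \<alpha>) \<subseteq> {mmC_mat 0 0 0 0 t m |t m. True}"
    using root_space_roots2 by (intro span_minimal) auto
  have "mmC_mat 0 0 0 0 t m \<in> span (\<Union>\<alpha>\<in>roots2. root_space \<alpha>)" for t m
  proof -
    have "mmC_mat 0 0 0 0 t m = mmC_mat 0 0 0 0 t 0 + mmC_mat 0 0 0 0 0 m"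
      by (simp add: mmC_mat_add)
    also have "\<dots> \<in> span (\<Union>\<alpha>\<in>roots2. root_space \<alpha>)"
      by (intro span_add span_base; rule UN_I[rotated], rule mmC_mat_in_root_space,
          simp add: roots2_def)
    finally show ?thesis .
  qed
  then show "{mmC_mat 0 0 0 0 t m |t m. True} \<subseteq> span (\<Union>\<alpha>\<in>roots2. root_space \<alpha>)" by blast
qed

lemma mmC_eq: "mmC = {mmC_mat p q r s t m |p q r s t m. True}"
proof -
  have "mmC = {X + Y |X Y. X \<in> {mmC_mat p q r s 0 0 |p q r s. True}
      \<and> Y \<in> {mmC_mat 0 0 0 0 t m |t m. True}}"
    unfolding mmC_def UN_Un span_Un span_roots1 span_roots2 ..
  then show ?thesis by (force simp: mmC_mat_add)
qed

lemma mmC_mat_sp2_iff: "mmC_mat p q r s t m \<in> sp2 \<longleftrightarrow> q = - cnj p \<and> s = - cnj r \<and> m = - cnj t"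
  by (auto simp: sp2_def sp4C_iff mat4_eq_iff forall_4 adj_nth complex_eq_iff)

lemma mm_eq: "mm = {mm_mat z w u |z w u. True}"
  unfolding mm_def mmC_def[symmetric] mmC_eq
    by (auto simp: mmC_mat_sp2_iff mm_mat_mmC_mat mmC_mat_inject)

lemma m1_eq: "m1 = {mm_mat z w 0 |z w. True}"
  unfolding m1_def span_roots1 by (auto simp: mmC_mat_sp2_iff mm_mat_mmC_mat mmC_mat_inject)

lemma m2_eq: "m2 = {mm_mat 0 0 u |u. True}"
  unfolding m2_def span_roots2 by (auto simp: mmC_mat_sp2_iff mm_mat_mmC_mat mmC_mat_inject)

lemma mm_cases:
  assumes "X \<in> mm" obtains z w u where "X = mm_mat z w u"
  using assms mm_eq by blast

lemma mm_mat_in_mm [simp, intro]: "mm_mat z w u \<in> mm"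
  by (auto simp: mm_eq)

lemma mm_sp2: "X \<in> mm \<Longrightarrow> X \<in> sp2"
  by (simp add: mm_def)

lemma part1_mm_mat: "part1 (mm_mat z w u) = mm_mat z w 0"
  unfolding part1_def m1_eq m2_eq by (rule the_equality) (auto simp: sp2_mat_diff sp2_mat_inject)

lemma part2_mm_mat: "part2 (mm_mat z w u) = mm_mat 0 0 u"
  unfolding part2_def m1_eq m2_eq by (rule the_equality) (auto simp: sp2_mat_diff sp2_mat_inject)

text \<open>On \<open>sp2\<close> the Killing form is \<open>- 6\<close> times the Euclidean inner product, in which \<open>z\<close> and \<open>w\<close> count
  four times and \<open>u\<close> twice; hence the factors 24 and 12.\<close>

definition metric_form :: "real \<Rightarrow> real \<Rightarrow> mat4 \<Rightarrow> mat4 \<Rightarrow> real" where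
  "metric_form x y X Y = 24 * x * (X$1$2 \<bullet> Y$1$2 + X$1$4 \<bullet> Y$1$4) + 12 * y * (X$1$3 \<bullet> Y$1$3)"

lemma inner_xy_eq: "X \<in> mm \<Longrightarrow> Y \<in> mm \<Longrightarrow> inner_xy x y X Y = metric_form x y X Y"
  by (elim mm_cases) (simp add: inner_xy_def part1_mm_mat part2_mm_mat killing_eq inner_sp2_mat
      metric_form_def algebra_simps)

section \<open>The compact group and the isotropy group\<close>

lemma bounded_bilinear_mat4_mult: "bounded_bilinear ((**) :: mat4 \<Rightarrow> mat4 \<Rightarrow> mat4)"
  unfolding bilinear_conv_bounded_bilinear[symmetric] bilinear_def
  by (auto intro!: linearI simp: mat4_eq_iff mat4_mult_nth algebra_simps)

interpretation mult4: bounded_bilinear "(**) :: mat4 \<Rightarrow> mat4 \<Rightarrow> mat4"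
  by (rule bounded_bilinear_mat4_mult)

lemmas mult4_distribs = mult4.add_left mult4.add_right mult4.diff_left mult4.diff_right
  mult4.minus_left mult4.minus_right mult4.scaleR_left mult4.scaleR_right

lemma bounded_linear_adj: "bounded_linear adj"
  unfolding linear_conv_bounded_linear[symmetric]
  by (rule linearI) (simp_all add: mat4_eq_iff adj_nth)

lemma adj_mult: "adj (A ** B) = adj B ** adj A"
  by (simp add: mat4_eq_iff adj_nth mat4_mult_nth mult.commute)

lemma adj_adj: "adj (adj A) = A"
  by (simp add: mat4_eq_iff adj_nth)

lemma Sp2_inverse: "p \<in> Sp2 \<Longrightarrow> adj p ** p = mat 1" "p \<in> Sp2 \<Longrightarrow> p ** adj p = mat 1"
  by (auto simp: Sp2_def matrix_left_right_inverse)

text \<open>Unitarity turns the symplectic condition into an intertwining relation; the second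
  equation is the transpose of the first, as \<open>Omega\<close> is skew.\<close>

lemma Sp2_Omega:
  assumes "p \<in> Sp2"
  shows "transpose p ** Omega = Omega ** adj p" and "Omega ** p = transpose (adj p) ** Omega"
proof -
  have "transpose p ** Omega ** p ** adj p = Omega ** adj p"
    using assms by (simp add: Sp2_def)
  then show 1: "transpose p ** Omega = Omega ** adj p"
    by (metis Sp2_inverse(2)[OF assms] matrix_mul_assoc matrix_mul_rid)
  have "transpose Omega = - Omega"
    by (simp add: mat4_eq_iff forall_4 transpose_def Omega_nth)
  then show "Omega ** p = transpose (adj p) ** Omega"
    using arg_cong[OF 1, of transpose]
      by (simp add: matrix_transpose_mul transpose_transpose mult4_distribs)
qed

lemma Sp2_mult: "p \<in> Sp2 \<Longrightarrow> q \<in> Sp2 \<Longrightarrow> p ** q \<in> Sp2"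
  by (simp add: Sp2_def adj_mult matrix_transpose_mul) (metis matrix_mul_assoc matrix_mul_lid)

lemma Sp2_conjugate_sp2:
  assumes p: "p \<in> Sp2" and X: "X \<in> sp2"
  shows "adj p ** X ** p \<in> sp2" and "p ** X ** adj p \<in> sp2"
proof -
  have X1: "adj X = - X" and X2: "transpose X ** Omega = - (Omega ** X)"
    using X by (auto simp: sp2_def sp4C_def add_eq_0_iff)
  have "transpose (adj p ** X ** p) ** Omega
      = transpose p ** (transpose X ** (transpose (adj p) ** Omega))"
    by (simp add: matrix_transpose_mul matrix_mul_assoc)
  also have "\<dots> = transpose p ** ((transpose X ** Omega) ** p)"
    by (simp add: Sp2_Omega(2)[OF p, symmetric] matrix_mul_assoc)
  also have "\<dots> = - ((transpose p ** Omega) ** X ** p)"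
    by (simp add: X2 mult4_distribs matrix_mul_assoc)
  also have "\<dots> = - (Omega ** (adj p ** X ** p))"
    by (simp add: Sp2_Omega(1)[OF p] matrix_mul_assoc)
  finally show "adj p ** X ** p \<in> sp2"
    by (simp add: sp2_def sp4C_def adj_mult adj_adj X1 mult4_distribs matrix_mul_assoc)
  have "transpose (p ** X ** adj p) ** Omega
      = transpose (adj p) ** (transpose X ** (transpose p ** Omega))"
    by (simp add: matrix_transpose_mul matrix_mul_assoc)
  also have "\<dots> = transpose (adj p) ** ((transpose X ** Omega) ** adj p)"
    by (simp add: Sp2_Omega(1)[OF p] matrix_mul_assoc)
  also have "\<dots> = - ((transpose (adj p) ** Omega) ** X ** adj p)"
    by (simp add: X2 mult4_distribs matrix_mul_assoc)
  also have "\<dots> = - (Omega ** (p ** X ** adj p))"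
    by (simp add: Sp2_Omega(2)[OF p, symmetric] matrix_mul_assoc)
  finally show "p ** X ** adj p \<in> sp2"
    by (simp add: sp2_def sp4C_def adj_mult adj_adj X1 mult4_distribs matrix_mul_assoc)
qed

text \<open>This is \<open>exp (t A)\<close> if \<open>A\<^sup>3 = - A\<close>; a basis of \<open>sp2\<close> consists of such matrices.\<close>

definition rot :: "mat4 \<Rightarrow> real \<Rightarrow> mat4" where
  "rot A t = mat 1 + sin t *\<^sub>R A + (1 - cos t) *\<^sub>R (A ** A)"

section \<open>One-parameter subgroups and derivatives tangent to the group\<close>

lemma gens_cube: "A \<in> gens_h \<union> gens_m \<Longrightarrow> A ** A ** A = - A"
  by (auto simp: gens_h_def gens_m_def mat4_eq_iff forall_4 mat4_mult_nth)

lemma gens_sp2: "A \<in> gens_h \<union> gens_m \<Longrightarrow> A \<in> sp2"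
  by (auto simp: gens_h_def gens_m_def)

lemma adj_mat1: "adj (mat 1) = mat 1"
  by (simp add: mat4_eq_iff adj_nth mat_def)

lemma rot_in_Sp2:
  assumes A: "A \<in> sp2" and cube: "A ** A ** A = - A"
  shows "rot A t \<in> Sp2"
proof -
  define B where "B = A ** A"
  define s k where "s = sin t" and "k = 1 - cos t"
  have adjA: "adj A = - A" and tA: "transpose A ** Omega = - (Omega ** A)"
    using A by (auto simp: sp2_def sp4C_def add_eq_0_iff)
  have rot: "rot A t = mat 1 + s *\<^sub>R A + k *\<^sub>R B" by (simp add: rot_def B_def s_def k_def)
  have prods: "A ** A = B" "A ** B = - A" "B ** A = - A" "B ** B = - B"
    using cube by (simp_all add: B_def matrix_mul_assoc) (simp add: mult4_distribs)
  have adj: "adj (rot A t) = mat 1 - s *\<^sub>R A + k *\<^sub>R B"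
    by (simp add: rot B_def linear_add[OF bounded_linear.linear[OF bounded_linear_adj]]
       linear_cmul[OF bounded_linear.linear[OF bounded_linear_adj]] adj_mult adjA adj_mat1
           mult4_distribs)
  \<comment> \<open>The powers of \<open>A\<close> close up in the span of 1, \<open>A\<close> and
    \<open>B\<close>, so unitarity reduces to the coefficient of \<open>B\<close>, where the
    Pythagorean identity enters.\<close>
  have trig: "k + k - s * s - k * k = 0"
    using sin_cos_squared_add[of t] by (simp add: s_def k_def power2_eq_square algebra_simps)
  have "adj (rot A t) ** rot A t
      = mat 1 + (k + k - s * s - k * k) *\<^sub>R B"
    unfolding adj unfolding rot mult4_distribs prods
    by (simp add: mat4_eq_iff) (simp add: complex_eq_iff algebra_simps)
  then have 1: "adj (rot A t) ** rot A t = mat 1" unfolding trig by simp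
  have tadd: "transpose (X + Y) = transpose X + transpose Y" "transpose (c *\<^sub>R X) = c *\<^sub>R transpose X"
    for X Y :: mat4 and c by (simp_all add: mat4_eq_iff transpose_def)
  have "transpose B ** Omega = Omega ** B"
  proof -
    have "transpose B ** Omega = transpose A ** (transpose A ** Omega)"
      by (simp add: B_def matrix_transpose_mul matrix_mul_assoc)
    also have "\<dots> = - ((transpose A ** Omega) ** A)"
      by (simp add: tA mult4_distribs matrix_mul_assoc)
    finally show ?thesis by (simp add: tA B_def mult4_distribs matrix_mul_assoc)
  qed
  then have "transpose (rot A t) ** Omega = Omega ** adj (rot A t)"
    unfolding adj unfolding rot tadd mult4_distribs by (simp add: tA)
  then have "transpose (rot A t) ** Omega ** rot A t = Omega"
    using 1 by (simp add: matrix_mul_assoc[symmetric])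
  then show ?thesis using 1 by (simp add: Sp2_def)
qed

lemma rot_in_isotropy:
  assumes "A \<in> gens_h"
  shows "rot A t \<in> isotropy"
proof -
  have "rot A t \<in> Sp2" using assms gens_sp2 gens_cube by (intro rot_in_Sp2) auto
  then show ?thesis
    using assms by (auto simp: isotropy_def gens_h_def rot_def mat4_mult_nth mat_def forall_4)
qed

lemma rot_0: "rot A 0 = mat 1"
  by (simp add: rot_def)

lemma rot_has_vector_derivative: "(rot A has_vector_derivative A) (at 0)"
  unfolding rot_def by (auto intro!: derivative_eq_intros)

lemma has_vector_derivative_along_rot:
  fixes p :: mat4
  assumes "(f has_derivative f') (at p)"
  shows "((\<lambda>t. f (p ** rot A t)) has_vector_derivative f' (p ** A)) (at 0)"
proof -
  have "((\<lambda>t. p ** rot A t) has_vector_derivative p ** A) (at 0)"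
    using bounded_linear.has_vector_derivative[OF mult4.bounded_linear_right[of p]
        rot_has_vector_derivative] .
  then have "((f \<circ> (\<lambda>t. p ** rot A t)) has_vector_derivative f' (p ** A)) (at 0)"
    using assms vector_derivative_diff_chain_within[of "\<lambda>t. p ** rot A t"
        "p ** A" 0 UNIV f f'] rot_0
    by (auto intro: has_derivative_at_withinI)
  then show ?thesis by (simp add: comp_def)
qed

text \<open>Both sides are linear in \<open>A\<close>, so \<open>A\<close> may be taken among the
  generators; for these the curve \<open>p ** rot A t\<close> stays in \<open>Sp2\<close>, where
  \<open>f\<close> and \<open>g\<close> agree. This is how data known only on \<open>Sp2\<close> get
  differentiated.\<close>

lemma derivative_eq_on_Sp2:
  assumes f: "(f has_derivative f') (at p)" and g: "(g has_derivative g') (at p)"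
    and eq: "\<And>q. q \<in> Sp2 \<Longrightarrow> f q = g q" and p: "p \<in> Sp2" and A: "A \<in> sp2"
  shows "f' (p ** A) = g' (p ** A)"
proof -
  have lin: "linear (\<lambda>A. f' (p ** A))" "linear (\<lambda>A. g' (p ** A))"
    using linear_compose[OF bounded_linear.linear[OF mult4.bounded_linear_right[of p]]
        has_derivative_linear[OF f]]
      linear_compose[OF bounded_linear.linear[OF mult4.bounded_linear_right[of p]]
        has_derivative_linear[OF g]] by (simp_all add: comp_def)
  have "f' (p ** A) = g' (p ** A)" if "A \<in> gens_h \<union> gens_m" for A
  proof -
    have "f (p ** rot A t) = g (p ** rot A t)" for t
      using that by (intro eq Sp2_mult p rot_in_Sp2 gens_sp2 gens_cube)
    then show ?thesis
      using has_vector_derivative_along_rot[OF f, of A] has_vector_derivative_along_rot[OF g, of A]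
      by (simp add: vector_derivative_unique_at)
  qed
  then show ?thesis
    using linear_eq_on_span[OF lin, of "gens_h \<union> gens_m" A] A span_gens by blast
qed

section \<open>The isotropy group and its action on \<open>mm\<close>\<close>

definition isotropy_mat :: "complex \<Rightarrow> complex \<Rightarrow> complex \<Rightarrow> mat4" where
  "isotropy_mat a p q = (\<chi> i j.
     if i = 1 then (if j = 1 then a else 0)
     else if i = 2 then (if j = 2 then p else if j = 4 then q else 0)
     else if i = 3 then (if j = 3 then cnj a else 0)
     else (if j = 2 then - cnj q else if j = 4 then cnj p else 0))"

lemma isotropy_mat_nth [simp]:
  "isotropy_mat a p q $ 1 $ 1 = a" "isotropy_mat a p q $ 1 $ 2 = 0"
      "isotropy_mat a p q $ 1 $ 3 = 0" "isotropy_mat a p q $ 1 $ 4 = 0"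
  "isotropy_mat a p q $ 2 $ 1 = 0" "isotropy_mat a p q $ 2 $ 2 = p"
      "isotropy_mat a p q $ 2 $ 3 = 0" "isotropy_mat a p q $ 2 $ 4 = q"
  "isotropy_mat a p q $ 3 $ 1 = 0" "isotropy_mat a p q $ 3 $ 2 = 0"
      "isotropy_mat a p q $ 3 $ 3 = cnj a" "isotropy_mat a p q $ 3 $ 4 = 0"
  "isotropy_mat a p q $ 4 $ 1 = 0" "isotropy_mat a p q $ 4 $ 2 = - cnj q"
      "isotropy_mat a p q $ 4 $ 3 = 0" "isotropy_mat a p q $ 4 $ 4 = cnj p"
  by (simp_all add: isotropy_mat_def)

lemma isotropy_cases:
  assumes "h \<in> isotropy"
  obtains a p q where "h = isotropy_mat a p q" "a * cnj a = 1" "p * cnj p + q * cnj q = 1"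
proof -
  have h: "h \<in> Sp2" and "\<forall>i\<in>{1, 3}. \<forall>j. j \<noteq> i \<longrightarrow> h $ i $ j = 0 \<and> h $ j $ i = 0"
    using assms unfolding isotropy_def by blast+
  then have zero: "h$1$2 = 0" "h$1$3 = 0" "h$1$4 = 0" "h$2$1 = 0" "h$3$1 = 0" "h$4$1 = 0"
    "h$3$2 = 0" "h$3$4 = 0" "h$2$3 = 0" "h$4$3 = 0" by (simp_all add: forall_4)
  \<comment> \<open>As \<open>transpose (adj h)\<close> is the entrywise conjugate of
    \<open>h\<close>, this says that \<open>h\<close> commutes with the quaternionic structure,
    which fixes the lower half of the matrix by the upper half.\<close>
  have om: "(Omega ** h) $ i $ j = (transpose (adj h) ** Omega) $ i $ j" for i j
    using Sp2_Omega(2)[OF h] by simp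
  have quat: "h$3$3 = cnj (h$1$1)" "h$4$4 = cnj (h$2$2)" "h$4$2 = - cnj (h$2$4)"
    using om[of 1 3] om[of 2 4] om[of 2 2]
    by (simp_all add: mat4_mult_nth Omega_nth transpose_def adj_nth)
  have "(adj h ** h) $ i $ j = (mat 1 :: mat4) $ i $ j" for i j
    using Sp2_inverse(1)[OF h] by simp
  from this[of 1 1] this[of 2 2]
  have "h$1$1 * cnj (h$1$1) = 1" "h$2$2 * cnj (h$2$2) + h$2$4 * cnj (h$2$4) = 1"
    by (simp_all add: mat4_mult_nth adj_nth zero quat mat_def mult.commute)
  moreover have "h = isotropy_mat (h$1$1) (h$2$2) (h$2$4)"
    by (simp add: mat4_eq_iff forall_4 zero quat)
  ultimately show ?thesis using that by blast
qed

lemma isotropy_Sp2: "h \<in> isotropy \<Longrightarrow> h \<in> Sp2"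
  by (simp add: isotropy_def)

lemma isotropy_mat_conjugate_mm_mat:
  assumes "a * cnj a = 1" "p * cnj p + q * cnj q = 1"
  shows "adj (isotropy_mat a p q) ** mm_mat z w u ** isotropy_mat a p q
     = mm_mat (cnj a * (z * p - w * cnj q)) (cnj a * (z * q + w * cnj p)) (cnj a * cnj a * u)"
  by (simp add: mat4_eq_iff forall_4 mat4_mult_nth adj_nth algebra_simps)

text \<open>On \<open>sp2\<close> this is the projection along the isotropy algebra. Reading only
  the first row makes it a linear map on all matrices, so that it can be composed with smooth maps
  given off \<open>Sp2\<close>.\<close>

definition proj_mm :: "mat4 \<Rightarrow> mat4" where
  "proj_mm X = mm_mat (X$1$2) (X$1$4) (X$1$3)"

lemma proj_mm_sp2_mat: "proj_mm (sp2_mat a b v z w u) = mm_mat z w u"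
  by (simp add: proj_mm_def)

lemma proj_mm_mm: "X \<in> mm \<Longrightarrow> proj_mm X = X"
  by (elim mm_cases) (simp add: proj_mm_sp2_mat)

lemma proj_mm_in_mm [simp]: "proj_mm X \<in> mm"
  by (simp add: proj_mm_def)

lemma bounded_linear_proj_mm: "bounded_linear proj_mm"
  unfolding linear_conv_bounded_linear[symmetric]
  by (rule linearI) (simp_all add: proj_mm_def sp2_mat_add sp2_mat_scaleR sp2_mat_inject, simp_all
      add: complex_eq_iff)

text \<open>The decomposition into isotropy algebra and \<open>mm\<close> is reductive: both
  summands are preserved by conjugation with the isotropy group.\<close>

lemma proj_mm_conjugate:
  assumes "h \<in> isotropy" and "X \<in> sp2"
  shows "proj_mm (adj h ** X ** h) = adj h ** proj_mm X ** h"
  using assms by (elim isotropy_cases sp2_sp2_mat_cases)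
    (simp add: isotropy_mat_conjugate_mm_mat proj_mm_def sp2_mat_inject mat4_mult_nth adj_nth,
        simp add: algebra_simps)

lemma subspace_mm: "subspace mm"
  unfolding mm_def by (intro subspace_inter subspace_sp2 subspace_span)

lemma sp2_diff_proj_mm:
  assumes "X \<in> sp2" obtains a b v where "X - proj_mm X = sp2_mat a b v 0 0 0"
  using assms by (elim sp2_sp2_mat_cases) (simp add: proj_mm_sp2_mat sp2_mat_diff)

section \<open>Vector fields and invariant connections\<close>

lemma vector_field_smooth: "vector_field X \<Longrightarrow> smooth X"
  and vector_field_mm: "vector_field X \<Longrightarrow> X p \<in> mm"
  and vector_field_conjugate:
    "vector_field X \<Longrightarrow> p \<in> Sp2 \<Longrightarrow> h \<in> isotropy \<Longrightarrow> X (p ** h) = adj h ** X p ** h"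
  by (auto simp: vector_field_def)

lemma vector_field_add: "vector_field X \<Longrightarrow> vector_field Y \<Longrightarrow> vector_field (\<lambda>p. X p + Y p)"
  by (simp add: vector_field_def smooth_add subspace_add[OF subspace_mm] mult4_distribs)

lemma vector_field_scaleR:
  "smooth_function \<phi> \<Longrightarrow> vector_field X \<Longrightarrow> vector_field (\<lambda>p. \<phi> p *\<^sub>R X p)"
  by (simp add: vector_field_def smooth_function_def smooth_bilinear[OF bounded_bilinear_scaleR]
      subspace_scale[OF subspace_mm] mult4_distribs)

lemma vector_field_diff:
  assumes "vector_field X" and "vector_field Y"
  shows "vector_field (\<lambda>p. X p - Y p)"
proof -
  have "smooth_function (\<lambda>_. - 1)" by (simp add: smooth_function_def smooth_const)
  from vector_field_add[OF assms(1) vector_field_scaleR[OF this assms(2)]] show ?thesis by simp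
qed

text \<open>This is the fundamental field of the one-parameter group generated by
  \<open>p ** a ** adj p\<close>, acting by left translations: its generator is conjugated back to
  the point \<open>q\<close> and projected to \<open>mm\<close>.\<close>

lemma vector_field_through:
  assumes p: "p \<in> Sp2" and a: "a \<in> mm"
  shows "vector_field (\<lambda>q. proj_mm (adj q ** (p ** a ** adj p) ** q))"
  unfolding vector_field_def
proof (intro conjI allI ballI)
  let ?A = "p ** a ** adj p"
  show "smooth (\<lambda>q. proj_mm (adj q ** ?A ** q))"
    by (intro smooth_linear[OF bounded_linear_proj_mm]
        smooth_bilinear[OF bounded_bilinear_mat4_mult]
        smooth_linear[OF bounded_linear_adj] smooth_id smooth_const)
  show "proj_mm (adj q ** ?A ** q) \<in> mm" for q by simp
  fix q h assume q: "q \<in> Sp2" and h: "h \<in> isotropy"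
  have "?A \<in> sp2" using Sp2_conjugate_sp2(2)[OF p] a mm_sp2 by blast
  then have "adj q ** ?A ** q \<in> sp2" using Sp2_conjugate_sp2(1)[OF q] by blast
  from proj_mm_conjugate[OF h this]
  show "proj_mm (adj (q ** h) ** ?A ** (q ** h)) = adj h ** proj_mm (adj q ** ?A ** q) ** h"
    by (simp add: adj_mult matrix_mul_assoc)
qed

lemma extend:
  assumes p: "p \<in> Sp2" and a: "a \<in> mm"
  shows "vector_field (extend p a)" and "extend p a p = a"
proof -
  have "adj p ** (p ** a ** adj p) ** p = (adj p ** p) ** a ** (adj p ** p)"
    by (simp add: matrix_mul_assoc)
  then have "proj_mm (adj p ** (p ** a ** adj p) ** p) = a"
    using Sp2_inverse(1)[OF p] proj_mm_mm[OF a] by simp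
  then have "\<exists>X. vector_field X \<and> X p = a" using vector_field_through[OF assms] by blast
  from someI_ex[OF this] show "vector_field (extend p a)" and "extend p a p = a"
    unfolding extend_def by auto
qed

lemma derivative_conjugate:
  assumes Y: "vector_field Y" and p: "p \<in> Sp2" and h: "h \<in> isotropy" and A: "A \<in> sp2"
  shows "frechet_derivative Y (at (p ** h)) (p ** A ** h)
      = adj h ** frechet_derivative Y (at p) (p ** A) ** h"
proof -
  have "((\<lambda>q. q ** h) has_derivative (\<lambda>v. v ** h)) (at p)"
    by (rule bounded_linear.has_derivative[OF mult4.bounded_linear_left has_derivative_ident])
  from has_derivative_compose[OF this smooth_has_derivative[OF vector_field_smooth[OF Y]]]
  have 1: "((\<lambda>q. Y (q ** h)) has_derivative (\<lambda>v. frechet_derivative Y (at (p ** h)) (v ** h)))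
      (at p)" .
  have 2: "((\<lambda>q. adj h ** Y q ** h) has_derivative
      (\<lambda>v. adj h ** frechet_derivative Y (at p) v ** h)) (at p)"
    by (rule bounded_linear.has_derivative[OF mult4.bounded_linear_left
        bounded_linear.has_derivative[OF mult4.bounded_linear_right
          smooth_has_derivative[OF vector_field_smooth[OF Y]]]])
  show ?thesis
    using derivative_eq_on_Sp2[OF 1 2 vector_field_conjugate[OF Y _ h] p A] .
qed

text \<open>Differentiating the equivariance law along \<open>rot A t\<close> with \<open>A\<close>
  in the isotropy algebra: in these directions the derivative of a vector field is determined by its
  value. This is the origin of the adjoint term in \<open>curv_form\<close>.\<close>

lemma derivative_vertical:
  assumes Z: "vector_field Z" and p: "p \<in> Sp2"
  shows "frechet_derivative Z (at p) (p ** sp2_mat a b v 0 0 0) = comm (Z p) (sp2_mat a b v 0 0 0)"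
proof -
  let ?D = "frechet_derivative Z (at p)"
  have lin: "linear (\<lambda>A. ?D (p ** A))"
    using linear_compose[OF bounded_linear.linear[OF mult4.bounded_linear_right[of p]]
        smooth_linear_derivative[OF vector_field_smooth[OF Z]]] by (simp add: comp_def)
  have lin': "linear (comm (Z p))" by (rule linearI) (simp_all add: comm_distribs)
  have "?D (p ** A) = comm (Z p) A" if A: "A \<in> gens_h" for A
  proof -
    have adjA: "adj A = - A" using gens_sp2[of A] A by (simp add: sp2_def)
    have "((\<lambda>t. adj (rot A t) ** Z p ** rot A t) has_vector_derivative
        adj (rot A 0) ** Z p ** A + (adj (rot A 0) ** 0 + adj A ** Z p) ** rot A 0) (at 0)"
      by (intro has_vector_derivative_mult mult4.has_vector_derivative
          bounded_linear.has_vector_derivative[OF bounded_linear_adj] rot_has_vector_derivative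
          has_vector_derivative_const)
    moreover have "adj (rot A 0) ** Z p ** A + (adj (rot A 0) ** 0 + adj A ** Z p) ** rot A 0
        = comm (Z p) A"
      by (simp add: rot_0 adj_mat1 adjA comm_def mult4_distribs)
    moreover have "Z (p ** rot A t) = adj (rot A t) ** Z p ** rot A t" for t
      using vector_field_conjugate[OF Z p rot_in_isotropy[OF A]] .
    ultimately show ?thesis
      using has_vector_derivative_along_rot[OF
          smooth_has_derivative[OF vector_field_smooth[OF Z]], of p A]
      by (simp add: vector_derivative_unique_at)
  qed
  then show ?thesis using linear_eq_on_span[OF lin lin' _ span_gens_h] by blast
qed

lemma derivative_vertical_function:
  assumes \<phi>: "smooth_function \<phi>" and p: "p \<in> Sp2"
  shows "frechet_derivative \<phi> (at p) (p ** sp2_mat a b v 0 0 0) = 0"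
proof -
  let ?D = "frechet_derivative \<phi> (at p)"
  have sm: "smooth \<phi>" using \<phi> by (simp add: smooth_function_def)
  have lin: "linear (\<lambda>A. ?D (p ** A))"
    using linear_compose[OF bounded_linear.linear[OF mult4.bounded_linear_right[of p]]
        smooth_linear_derivative[OF sm]] by (simp add: comp_def)
  have lin': "linear (\<lambda>A :: mat4. 0 :: real)" by (rule linearI) simp_all
  have "?D (p ** A) = 0" if A: "A \<in> gens_h" for A
  proof -
    have "\<phi> (p ** rot A t) = \<phi> p" for t
      using \<phi> p rot_in_isotropy[OF A] by (simp add: smooth_function_def)
    then show ?thesis
      using has_vector_derivative_along_rot[OF smooth_has_derivative[OF sm], of p A]
        has_vector_derivative_const[of "\<phi> p" "at 0"]
      by (simp add: vector_derivative_unique_at)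
  qed
  then show ?thesis using linear_eq_on_span[OF lin lin' _ span_gens_h] by blast
qed

lemma derivative_in_mm:
  assumes "smooth f" and "\<And>q. f q \<in> mm"
  shows "frechet_derivative f (at p) v \<in> mm"
proof -
  have "(\<lambda>q. proj_mm (f q)) = f" using assms(2) proj_mm_mm by blast
  then have "frechet_derivative f (at p) v = proj_mm (frechet_derivative f (at p) v)"
    using frechet_derivative_linear[OF bounded_linear_proj_mm assms(1), of p v] by simp
  then show ?thesis by (metis proj_mm_in_mm)
qed

text \<open>Values in \<open>mm\<close> are required for all arguments because
  \<open>vector_field\<close> asks for values in \<open>mm\<close> at every matrix; equivariance
  only concerns arguments in \<open>mm\<close>.\<close>

definition equivariant_bilinear :: "(mat4 \<Rightarrow> mat4 \<Rightarrow> mat4) \<Rightarrow> bool" where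
  "equivariant_bilinear \<Lambda> \<longleftrightarrow> bounded_bilinear \<Lambda> \<and> (\<forall>a b. \<Lambda> a b \<in> mm) \<and>
     (\<forall>h\<in>isotropy. \<forall>a\<in>mm. \<forall>b\<in>mm. \<Lambda> (adj h ** a ** h) (adj h ** b ** h) = adj h ** \<Lambda> a b ** h)"

definition nomizu_connection :: "(mat4 \<Rightarrow> mat4 \<Rightarrow> mat4) \<Rightarrow> connection" where
  "nomizu_connection \<Lambda> X Y = (\<lambda>p. frechet_derivative Y (at p) (p ** X p) + \<Lambda> (X p) (Y p))"

lemma vector_field_nomizu_connection:
  assumes X: "vector_field X" and Y: "vector_field Y" and L: "equivariant_bilinear \<Lambda>"
  shows "vector_field (nomizu_connection \<Lambda> X Y)"
  unfolding vector_field_def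
proof (intro conjI allI ballI)
  have bil: "bounded_bilinear \<Lambda>" and Lmm: "\<And>a b. \<Lambda> a b \<in> mm" using L
    by (auto simp: equivariant_bilinear_def)
  show "smooth (nomizu_connection \<Lambda> X Y)"
    unfolding nomizu_connection_def
    by (intro smooth_add smooth_derivative_along smooth_bilinear[OF bounded_bilinear_mat4_mult]
        smooth_bilinear[OF bil] smooth_id vector_field_smooth X Y)
  show "nomizu_connection \<Lambda> X Y p \<in> mm" for p
    unfolding nomizu_connection_def
    by (intro subspace_add[OF subspace_mm] derivative_in_mm Lmm vector_field_smooth
        vector_field_mm Y)
  fix p h assume p: "p \<in> Sp2" and h: "h \<in> isotropy"
  have "p ** h ** (adj h ** X p ** h) = p ** (h ** adj h) ** X p ** h"
    by (simp add: matrix_mul_assoc)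
  then have "p ** h ** (adj h ** X p ** h) = p ** X p ** h"
    by (simp add: Sp2_inverse(2) isotropy_Sp2[OF h])
  then have "frechet_derivative Y (at (p ** h)) (p ** h ** (adj h ** X p ** h))
      = adj h ** frechet_derivative Y (at p) (p ** X p) ** h"
    using derivative_conjugate[OF Y p h mm_sp2[OF vector_field_mm[OF X]]] by simp
  moreover have "\<Lambda> (adj h ** X p ** h) (adj h ** Y p ** h) = adj h ** \<Lambda> (X p) (Y p) ** h"
    using L h vector_field_mm[OF X] vector_field_mm[OF Y] by (simp add: equivariant_bilinear_def)
  ultimately show "nomizu_connection \<Lambda> X Y (p ** h) = adj h ** nomizu_connection \<Lambda> X Y p ** h"
    unfolding nomizu_connection_def
      by (simp add: vector_field_conjugate[OF X p h] vector_field_conjugate[OF Y p h]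
        mult4_distribs)
qed

text \<open>The equivariant bilinear maps on \<open>mm\<close> that occur: the \<open>mm\<close>-component of the Lie bracket has the
  parameters \<open>(1, 1, 2)\<close>, and those of the Levi-Civita connection and of the Chern connection are
  given in \<open>lc_form\<close> and \<open>chern_form\<close> below.\<close>

definition nomizu :: "real \<Rightarrow> real \<Rightarrow> real \<Rightarrow> mat4 \<Rightarrow> mat4 \<Rightarrow> mat4" where
  "nomizu a b c X Y = mm_mat
     (of_real a * Y$1$3 * cnj (X$1$4) - of_real b * X$1$3 * cnj (Y$1$4))
     (of_real b * X$1$3 * cnj (Y$1$2) - of_real a * Y$1$3 * cnj (X$1$2))
     (of_real c * (X$1$2 * Y$1$4 - X$1$4 * Y$1$2))"

lemma nomizu_sp2_mat: "nomizu a b c (sp2_mat k l v z w u) (sp2_mat k' l' v' z' w' u') = mm_mat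
    (of_real a * u' * cnj w - of_real b * u * cnj w')
    (of_real b * u * cnj z' - of_real a * u' * cnj z) (of_real c * (z * w' - w * z'))"
  by (simp add: nomizu_def)

lemma equivariant_bilinear_nomizu: "equivariant_bilinear (nomizu a b c)"
  unfolding equivariant_bilinear_def
proof (intro conjI allI ballI)
  show "bounded_bilinear (nomizu a b c)"
    unfolding bilinear_conv_bounded_bilinear[symmetric] bilinear_def
    by (auto intro!: linearI simp: nomizu_def sp2_mat_add sp2_mat_scaleR sp2_mat_inject,
        simp_all add: complex_eq_iff algebra_simps)
  show "nomizu a b c X Y \<in> mm" for X Y by (simp add: nomizu_def)
  fix h X Y assume h: "h \<in> isotropy" and X: "X \<in> mm" and Y: "Y \<in> mm"
  obtain k p q where iso: "h = isotropy_mat k p q" "k * cnj k = 1" "p * cnj p + q * cnj q = 1"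
    using h by (rule isotropy_cases)
  have k: "s * (cnj k * cnj k * x) * (k * t) = cnj k * (s * x * t)" for s x t
  proof -
    have "s * (cnj k * cnj k * x) * (k * t) = (k * cnj k) * (cnj k * (s * x * t))"
      by (simp only: mult_ac)
    then show ?thesis using iso(2) by simp
  qed
  obtain z w u z' w' u' where XY: "X = mm_mat z w u" "Y = mm_mat z' w' u'"
    using X Y mm_cases by metis
  \<comment> \<open>The last coordinate of \<open>nomizu\<close> is a determinant of the pairs
    \<open>(z, w)\<close> and \<open>(z', w')\<close>; the isotropy group acts on such pairs by a
    matrix of determinant \<open>p * cnj p + q * cnj q\<close>, which is 1, followed by a unit
    scalar.\<close>
  have det: "(z * p - w * cnj q) * (z' * q + w' * cnj p) - (z * q + w * cnj p) * (z' * p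
      - w' * cnj q)
      = (z * w' - w * z') * (p * cnj p + q * cnj q)"
    by (simp add: algebra_simps)
  have "nomizu a b c (adj h ** X ** h) (adj h ** Y ** h) = mm_mat
     (of_real a * (cnj k * cnj k * u') * (k * (cnj z * cnj q + cnj w * p))
         - of_real b * (cnj k * cnj k * u) * (k * (cnj z' * cnj q + cnj w' * p)))
     (of_real b * (cnj k * cnj k * u) * (k * (cnj z' * cnj p - cnj w' * q))
         - of_real a * (cnj k * cnj k * u') * (k * (cnj z * cnj p - cnj w * q)))
     (of_real c * (cnj k * cnj k) *
        ((z * p - w * cnj q) * (z' * q + w' * cnj p) - (z * q + w * cnj p) * (z' * p
            - w' * cnj q)))"
    unfolding XY iso(1) isotropy_mat_conjugate_mm_mat[OF iso(2,3)] nomizu_sp2_mat sp2_mat_inject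
    by (simp add: algebra_simps)
  also have "\<dots> = adj h ** nomizu a b c X Y ** h"
    unfolding XY iso(1) isotropy_mat_conjugate_mm_mat[OF iso(2,3)] nomizu_sp2_mat sp2_mat_inject
        det iso(3) k
    by (simp add: algebra_simps)
  finally show "nomizu a b c (adj h ** X ** h) (adj h ** Y ** h) = adj h ** nomizu a b c X Y ** h" .
qed

lemma nomizu_distribs:
  "nomizu a b c (X + X') Y = nomizu a b c X Y + nomizu a b c X' Y"
  "nomizu a b c X (Y + Y') = nomizu a b c X Y + nomizu a b c X Y'"
  "nomizu a b c (t *\<^sub>R X) Y = t *\<^sub>R nomizu a b c X Y"
  "nomizu a b c X (t *\<^sub>R Y) = t *\<^sub>R nomizu a b c X Y"
  "nomizu a b c (X - X') Y = nomizu a b c X Y - nomizu a b c X' Y"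
  "nomizu a b c X (Y - Y') = nomizu a b c X Y - nomizu a b c X Y'"
  using equivariant_bilinear_nomizu[of a b c] unfolding equivariant_bilinear_def
  by (auto simp: bounded_bilinear.add_left bounded_bilinear.add_right bounded_bilinear.scaleR_left
     bounded_bilinear.scaleR_right bounded_bilinear.diff_left bounded_bilinear.diff_right)

lemma proj_mm_comm: "X \<in> mm \<Longrightarrow> Y \<in> mm \<Longrightarrow> proj_mm (comm X Y) = nomizu 1 1 2 X Y"
  by (elim mm_cases) (simp add: comm_sp2_mat proj_mm_sp2_mat nomizu_sp2_mat)

lemma nomizu_in_mm [simp]: "nomizu a b c X Y \<in> mm"
  by (simp add: nomizu_def)

section \<open>Commutators of derivatives and the bracket of vector fields\<close>

lemma derivative_nomizu_connection_frame:
  fixes Z :: "mat4 \<Rightarrow> 'b::euclidean_space" and Y :: vfield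
  assumes Z: "smooth Z" and Y: "smooth Y"
  shows "frechet_derivative (\<lambda>q. frechet_derivative Z (at q) (q ** Y q)) (at p) v
     = frechet_derivative Z (at p) (v ** Y p + p ** frechet_derivative Y (at p) v)
       + second_derivative Z p v (p ** Y p)"
proof -
  have "((\<lambda>q. q ** Y q) has_derivative
      (\<lambda>v. p ** frechet_derivative Y (at p) v + v ** Y p)) (at p)"
    by (rule mult4.FDERIV[OF has_derivative_ident[of "at p"] smooth_has_derivative[OF Y]])
  from derivative_along_has_derivative[OF Z this]
  show ?thesis by (subst frechet_derivative_at[symmetric]) (auto simp: add.commute)
qed

text \<open>Second derivatives cancel by symmetry; moving the base point in \<open>q ** Y q\<close>
  leaves the products that form \<open>comm (X p) (Y p)\<close>. It serves real functions, for the
  bracket, and vector fields, for the curvature.\<close>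

lemma derivative_nomizu_connection_commutator:
  fixes Z :: "mat4 \<Rightarrow> 'b::euclidean_space" and X Y :: vfield
  assumes Z: "smooth Z" and X: "smooth X" and Y: "smooth Y"
  shows "frechet_derivative (\<lambda>q. frechet_derivative Z (at q) (q ** Y q)) (at p) (p ** X p)
       - frechet_derivative (\<lambda>q. frechet_derivative Z (at q) (q ** X q)) (at p) (p ** Y p)
     = frechet_derivative Z (at p) (p ** (frechet_derivative Y (at p) (p ** X p)
          - frechet_derivative X (at p) (p ** Y p) + comm (X p) (Y p)))"
  unfolding derivative_nomizu_connection_frame[OF Z Y] derivative_nomizu_connection_frame[OF Z X]
    second_derivative_commute[OF Z, of p "p ** Y p" "p ** X p"]
  by (simp add: linear_add[OF smooth_linear_derivative[OF Z], symmetric]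
      linear_diff[OF smooth_linear_derivative[OF Z], symmetric] comm_def mult4_distribs
          matrix_mul_assoc)
     (simp add: algebra_simps)

text \<open>The bracket of vector fields, in terms of derivatives along left-invariant directions: a
  function on the homogeneous space does not see the isotropy component of \<open>comm (X p) (Y p)\<close>.\<close>

definition lie :: "vfield \<Rightarrow> vfield \<Rightarrow> vfield" where
  "lie X Y = (\<lambda>p. nomizu_connection (nomizu 1 1 2) X Y p - frechet_derivative X (at p) (p ** Y p))"

lemma vector_field_lie:
  assumes "vector_field X" and "vector_field Y"
  shows "vector_field (lie X Y)"
proof -
  \<comment> \<open>Plain differentiation along left-invariant directions is the connection with
    zero map, so \<open>lie X Y\<close> is a difference of two vector fields.\<close>
  have "lie X Y = (\<lambda>p. nomizu_connection (nomizu 1 1 2) X Y p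
      - nomizu_connection (nomizu 0 0 0) Y X p)"
    by (auto simp: lie_def nomizu_connection_def nomizu_def sp2_mat_0)
  then show ?thesis
    using assms by (simp add: vector_field_diff vector_field_nomizu_connection
        equivariant_bilinear_nomizu)
qed

lemma deriv_along_lie:
  assumes X: "vector_field X" and Y: "vector_field Y" and \<phi>: "smooth_function \<phi>" and p: "p \<in> Sp2"
  shows "deriv_along (lie X Y) \<phi> p
     = deriv_along X (deriv_along Y \<phi>) p - deriv_along Y (deriv_along X \<phi>) p"
proof -
  let ?D = "frechet_derivative \<phi> (at p)"
  have sm: "smooth \<phi>" using \<phi> by (simp add: smooth_function_def)
  have "comm (X p) (Y p) \<in> sp2"
    using X Y by (intro comm_in_sp2 mm_sp2 vector_field_mm)
  then obtain a b v where "comm (X p) (Y p) - proj_mm (comm (X p) (Y p)) = sp2_mat a b v 0 0 0"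
    by (rule sp2_diff_proj_mm)
  then have "comm (X p) (Y p) = nomizu 1 1 2 (X p) (Y p) + sp2_mat a b v 0 0 0"
    using X Y by (simp add: proj_mm_comm vector_field_mm algebra_simps)
  then have "frechet_derivative Y (at p) (p ** X p) - frechet_derivative X (at p) (p ** Y p)
       + comm (X p) (Y p) = lie X Y p + sp2_mat a b v 0 0 0"
    by (simp add: lie_def nomizu_connection_def)
  then show ?thesis
    unfolding deriv_along_def
    by (simp add: derivative_nomizu_connection_commutator sm X Y vector_field_smooth mult4_distribs
        linear_add[OF smooth_linear_derivative[OF sm]] derivative_vertical_function[OF \<phi> p])
qed

lemma inner_mult_left:
  fixes p A B :: mat4
  shows "(p ** A) \<bullet> B = A \<bullet> (adj p ** B)"
proof -
  have "(p ** A) \<bullet> B = Re (\<Sum>i\<in>UNIV. \<Sum>j\<in>UNIV. \<Sum>k\<in>UNIV. p $ i $ k * A $ k $ j * cnj (B $ i $ j))"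
    by (simp add: inner_mat4 matrix_matrix_mult_def sum_distrib_right)
  also have "(\<Sum>i\<in>UNIV. \<Sum>j\<in>UNIV. \<Sum>k\<in>UNIV. p $ i $ k * A $ k $ j * cnj (B $ i $ j))
      = (\<Sum>k\<in>UNIV. \<Sum>j\<in>UNIV. \<Sum>i\<in>UNIV. p $ i $ k * A $ k $ j * cnj (B $ i $ j))"
    by (subst (2) sum.swap, subst sum.swap, subst (2) sum.swap) (rule refl)
  also have "Re \<dots> = A \<bullet> (adj p ** B)"
    by (simp add: inner_mat4 matrix_matrix_mult_def sum_distrib_left adj_nth mult_ac)
  finally show ?thesis .
qed

lemma inner_mult_right:
  fixes p A B :: mat4
  shows "(A ** p) \<bullet> B = A \<bullet> (B ** adj p)"
proof -
  have "(A ** p) \<bullet> B = Re (\<Sum>i\<in>UNIV. \<Sum>j\<in>UNIV. \<Sum>k\<in>UNIV. A $ i $ k * p $ k $ j * cnj (B $ i $ j))"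
    by (simp add: inner_mat4 matrix_matrix_mult_def sum_distrib_right)
  also have "(\<Sum>i\<in>UNIV. \<Sum>j\<in>UNIV. \<Sum>k\<in>UNIV. A $ i $ k * p $ k $ j * cnj (B $ i $ j))
      = (\<Sum>i\<in>UNIV. \<Sum>k\<in>UNIV. \<Sum>j\<in>UNIV. A $ i $ k * p $ k $ j * cnj (B $ i $ j))"
    by (subst (2) sum.swap) (rule refl)
  also have "Re \<dots> = A \<bullet> (B ** adj p)"
    by (simp add: inner_mat4 matrix_matrix_mult_def sum_distrib_left adj_nth mult_ac)
  finally show ?thesis .
qed

text \<open>The conjugates of \<open>diag(i, 0, -i, 0)\<close>, whose centraliser is the isotropy group, provide
  enough functions on the homogeneous space to separate tangent vectors.\<close>

lemma deriv_along_separates: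
  assumes p: "p \<in> Sp2" and a: "a \<in> mm" and b: "b \<in> mm"
    and eq: "\<And>\<phi>. smooth_function \<phi> \<Longrightarrow>
      frechet_derivative \<phi> (at p) (p ** a) = frechet_derivative \<phi> (at p) (p ** b)"
  shows "a = b"
proof -
  define H where "H = sp2_mat 1 0 0 0 0 0"
  have "comm a H = comm b H"
  proof (rule euclidean_eqI)
    fix c :: mat4
    \<comment> \<open>The derivative of the conjugate along \<open>p ** a\<close> is
      \<open>p ** comm a H ** adj p\<close>; pairing with the equally conjugated \<open>c\<close>
      therefore returns \<open>comm a H \<bullet> c\<close>, the inner product being invariant under
      unitary conjugation.\<close>
    define \<phi> where "\<phi> = (\<lambda>q. (q ** H ** adj q) \<bullet> (p ** c ** adj p))"
    have "smooth \<phi>"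
      unfolding \<phi>_def
      by (intro smooth_linear[OF bounded_linear_inner_left]
          smooth_bilinear[OF bounded_bilinear_mat4_mult]
          smooth_linear[OF bounded_linear_adj] smooth_id smooth_const)
    moreover have "\<phi> (q ** h) = \<phi> q" if h: "h \<in> isotropy" for q h
    proof -
      obtain k r s where "h = isotropy_mat k r s" using h by (rule isotropy_cases)
      then have "h ** H = H ** h"
        by (simp add: H_def mat4_eq_iff forall_4 mat4_mult_nth)
      then have "q ** h ** H ** adj (q ** h) = q ** H ** (h ** adj h) ** adj q"
        by (simp add: adj_mult matrix_mul_assoc[symmetric])
      then show ?thesis
        by (simp add: \<phi>_def Sp2_inverse(2)[OF isotropy_Sp2[OF that]])
    qed
    ultimately have \<phi>: "smooth_function \<phi>" by (simp add: smooth_function_def)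
    have "(\<phi> has_derivative (\<lambda>v. (p ** H ** adj v
        + (p ** 0 + v ** H) ** adj p) \<bullet> (p ** c ** adj p))) (at p)"
      unfolding \<phi>_def
      by (intro has_derivative_inner_left mult4.FDERIV has_derivative_ident has_derivative_const
          bounded_linear.has_derivative[OF bounded_linear_adj])
    then have D: "frechet_derivative \<phi> (at p)
        = (\<lambda>v. (p ** H ** adj v + (p ** 0 + v ** H) ** adj p) \<bullet> (p ** c ** adj p))"
      by (rule frechet_derivative_at[symmetric])
    have ip: "(p ** A ** adj p) \<bullet> (p ** B ** adj p) = A \<bullet> B" for A B
    proof -
      have "(p ** A ** adj p) \<bullet> (p ** B ** adj p) = A \<bullet> ((adj p ** p) ** B ** (adj p ** p))"
        unfolding inner_mult_right[of "p ** A"] inner_mult_left[of p A] adj_adj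
        by (simp add: matrix_mul_assoc)
      then show ?thesis using Sp2_inverse(1)[OF p] by simp
    qed
    have "frechet_derivative \<phi> (at p) (p ** a) = comm a H \<bullet> c" if "a \<in> mm" for a
    proof -
      have "adj a = - a" using mm_sp2[OF that] by (simp add: sp2_def)
      then have "p ** H ** adj (p ** a) + (p ** 0 + p ** a ** H) ** adj p = p ** comm a H ** adj p"
        by (simp add: adj_mult comm_def mult4_distribs matrix_mul_assoc)
      then show ?thesis unfolding D by (simp only: ip)
    qed
    then show "comm a H \<bullet> c = comm b H \<bullet> c" using eq[OF \<phi>] a b by simp
  qed
  \<comment> \<open>No root of \<open>mm\<close> vanishes on \<open>H\<close>, so the bracket with
    \<open>H\<close> is injective on \<open>mm\<close>.\<close>
  then show ?thesis
    using a b by (elim mm_cases) (auto simp: H_def comm_sp2_mat sp2_mat_inject complex_eq_iff)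
qed

text \<open>\<open>lie X Y\<close> shows that the choice is possible, and the separation of tangent
  vectors by functions shows that the chosen field agrees with it on \<open>Sp2\<close>.\<close>

lemma bracket:
  assumes X: "vector_field X" and Y: "vector_field Y"
  shows "vector_field (bracket X Y)" and "p \<in> Sp2 \<Longrightarrow> bracket X Y p = lie X Y p"
proof -
  have "vector_field (bracket X Y) \<and> (\<forall>\<phi>. smooth_function \<phi> \<longrightarrow> (\<forall>p\<in>Sp2. deriv_along (bracket X Y) \<phi> p
        = deriv_along X (deriv_along Y \<phi>) p - deriv_along Y (deriv_along X \<phi>) p))"
    unfolding bracket_def
    by (rule someI[of _ "lie X Y"]) (simp add: vector_field_lie deriv_along_lie X Y)
  then show v: "vector_field (bracket X Y)"
    and "p \<in> Sp2 \<Longrightarrow> bracket X Y p = lie X Y p"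
    using deriv_along_lie[OF X Y] vector_field_lie[OF X Y] deriv_along_separates[of p]
    by (auto simp: deriv_along_def vector_field_mm)
qed

section \<open>The Levi-Civita connection and curvature\<close>

lemma bounded_bilinear_metric_form: "bounded_bilinear (metric_form x y)"
  unfolding bilinear_conv_bounded_bilinear[symmetric] bilinear_def
  by (auto intro!: linearI simp: metric_form_def inner_distrib algebra_simps)

lemmas metric_form_distribs =
  bounded_bilinear.add_left[OF bounded_bilinear_metric_form]
      bounded_bilinear.add_right[OF bounded_bilinear_metric_form]
  bounded_bilinear.diff_left[OF bounded_bilinear_metric_form]
      bounded_bilinear.diff_right[OF bounded_bilinear_metric_form]
  bounded_bilinear.minus_left[OF bounded_bilinear_metric_form]
      bounded_bilinear.minus_right[OF bounded_bilinear_metric_form]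
  bounded_bilinear.scaleR_left[OF bounded_bilinear_metric_form]
      bounded_bilinear.scaleR_right[OF bounded_bilinear_metric_form]

lemma metric_form_commute: "metric_form x y a b = metric_form x y b a"
  by (simp add: metric_form_def inner_commute)

lemma metric_form_eq_0:
  assumes "x > 0" "y > 0" "a \<in> mm" "metric_form x y a a = 0"
  shows "a = 0"
proof -
  obtain z w u where a: "a = mm_mat z w u" using assms(3) by (rule mm_cases)
  have "24 * x * (z \<bullet> z + w \<bullet> w) + 12 * y * (u \<bullet> u) = 0"
    using assms(4) by (simp add: a metric_form_def)
  moreover have "0 \<le> 24 * x * (z \<bullet> z + w \<bullet> w)" "0 \<le> 12 * y * (u \<bullet> u)"
    using assms(1,2) by (simp_all add: add_nonneg_nonneg)
  ultimately have "24 * x * (z \<bullet> z + w \<bullet> w) = 0" "12 * y * (u \<bullet> u) = 0" by linarith+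
  then have "z \<bullet> z + w \<bullet> w = 0" "u \<bullet> u = 0" using assms(1,2) by auto
  then have "z = 0" "w = 0" "u = 0" by (auto simp: add_nonneg_eq_0_iff)
  then show ?thesis by (simp add: a sp2_mat_0)
qed

lemma metric_eq: "X p \<in> mm \<Longrightarrow> Y p \<in> mm \<Longrightarrow> metric x y X Y p = metric_form x y (X p) (Y p)"
  by (simp add: metric_def inner_xy_eq)

lemma deriv_along_metric:
  assumes "smooth Y" "smooth Z" "\<And>q. Y q \<in> mm" "\<And>q. Z q \<in> mm"
  shows "deriv_along X (metric x y Y Z) p
      = metric_form x y (frechet_derivative Y (at p) (p ** X p)) (Z p)
     + metric_form x y (Y p) (frechet_derivative Z (at p) (p ** X p))"
proof -
  have "metric x y Y Z = (\<lambda>q. metric_form x y (Y q) (Z q))"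
    using assms by (auto simp: metric_eq)
  moreover have "((\<lambda>q. metric_form x y (Y q) (Z q)) has_derivative
     (\<lambda>v. metric_form x y (Y p) (frechet_derivative Z (at p) v)
         + metric_form x y (frechet_derivative Y (at p) v) (Z p))) (at p)"
    by (rule bounded_bilinear.FDERIV[OF bounded_bilinear_metric_form
        smooth_has_derivative[OF assms(1)]
          smooth_has_derivative[OF assms(2)]])
  ultimately show ?thesis
    by (simp add: deriv_along_def frechet_derivative_at[symmetric])
qed

text \<open>Agreement is demanded on \<open>Sp2\<close> only, since a chosen connection is
  uncontrolled elsewhere; the results being vector fields allows the connection to be
  iterated.\<close>

definition represents :: "connection \<Rightarrow> (mat4 \<Rightarrow> mat4 \<Rightarrow> mat4) \<Rightarrow> bool" where
  "represents N \<Lambda> \<longleftrightarrow> (\<forall>X Y. vector_field X \<longrightarrow> vector_field Y \<longrightarrow>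
     vector_field (N X Y) \<and> (\<forall>p\<in>Sp2. N X Y p = nomizu_connection \<Lambda> X Y p))"

lemma frechet_derivative_add:
  assumes "smooth f" "smooth g"
  shows "frechet_derivative (\<lambda>q. f q + g q) (at p) v = frechet_derivative f (at p) v
      + frechet_derivative g (at p) v"
  using frechet_derivative_at[OF has_derivative_add[OF smooth_has_derivative[OF assms(1)]
      smooth_has_derivative[OF assms(2)]]]
  by metis

lemma frechet_derivative_bilinear:
  assumes "bounded_bilinear b" "smooth f" "smooth g"
  shows "frechet_derivative (\<lambda>q. b (f q) (g q)) (at p) v
     = b (f p) (frechet_derivative g (at p) v) + b (frechet_derivative f (at p) v) (g p)"
  using frechet_derivative_at[OF bounded_bilinear.FDERIV[OF assms(1)
      smooth_has_derivative[OF assms(2)]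
        smooth_has_derivative[OF assms(3)]]]
  by metis

text \<open>Zero torsion against the bracket \<open>nomizu 1 1 2\<close> forces a + b = 1 and c = 1
  in \<open>nomizu a b c\<close>; metric compatibility forces 2 x a = y c, while the part with b is
  skew by itself.\<close>

definition lc_form :: "real \<Rightarrow> real \<Rightarrow> mat4 \<Rightarrow> mat4 \<Rightarrow> mat4" where
  "lc_form x y = nomizu (y / (2 * x)) (1 - y / (2 * x)) 1"

lemma lc_form_torsion: "lc_form x y a b - lc_form x y b a = nomizu 1 1 2 a b"
  unfolding lc_form_def nomizu_def sp2_mat_diff sp2_mat_inject by (simp add: algebra_simps)

lemma lc_form_metric:
  assumes "x > 0" "a \<in> mm" "b \<in> mm" "c \<in> mm"
  shows "metric_form x y (lc_form x y a b) c + metric_form x y b (lc_form x y a c) = 0"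
proof -
  \<comment> \<open>With \<open>y = 2 * x * r\<close> the claim becomes polynomial in
    \<open>x\<close> and \<open>r\<close>.\<close>
  define r where "r = y / (2 * x)"
  have y: "y = 2 * x * r" using assms(1) by (simp add: r_def)
  have lc_form: "lc_form x y = nomizu r (1 - r) 1" by (simp add: lc_form_def r_def)
  show ?thesis
    unfolding lc_form unfolding y using assms(2-4)
    by (elim mm_cases) (simp add: nomizu_sp2_mat metric_form_def inner_complex_def algebra_simps)
qed

lemma affine_connection_nomizu_connection:
  assumes "equivariant_bilinear \<Lambda>"
  shows "affine_connection (nomizu_connection \<Lambda>)"
proof -
  have bil: "bounded_bilinear \<Lambda>" using assms by (simp add: equivariant_bilinear_def)
  note lin = linear_add[OF smooth_linear_derivative] linear_cmul[OF smooth_linear_derivative]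
  note bils = bounded_bilinear.add_left[OF bil] bounded_bilinear.add_right[OF bil]
    bounded_bilinear.scaleR_left[OF bil] bounded_bilinear.scaleR_right[OF bil]
  show ?thesis
    unfolding affine_connection_def
    by (simp add: vector_field_nomizu_connection assms)
       (simp add: nomizu_connection_def bils mult4_distribs lin vector_field_smooth
           frechet_derivative_add
         frechet_derivative_bilinear[OF bounded_bilinear_scaleR] smooth_function_def
         deriv_along_def algebra_simps)
qed

lemma is_levi_civita_lc_form:
  assumes "x > 0"
  shows "is_levi_civita x y (nomizu_connection (lc_form x y))"
  unfolding is_levi_civita_def
proof (intro conjI allI impI ballI)
  have eb: "equivariant_bilinear (lc_form x y)"
    by (simp add: lc_form_def equivariant_bilinear_nomizu)
  then show "affine_connection (nomizu_connection (lc_form x y))"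
    by (rule affine_connection_nomizu_connection)
  fix X Y :: vfield and p assume X: "vector_field X" and Y: "vector_field Y" and p: "p \<in> Sp2"
  show "nomizu_connection (lc_form x y) X Y p - nomizu_connection (lc_form x y) Y X p
      = bracket X Y p"
    unfolding bracket(2)[OF X Y p] lie_def nomizu_connection_def using lc_form_torsion[of x y
        "X p" "Y p"]
    by (simp add: algebra_simps)
  fix Z :: vfield assume Z: "vector_field Z"
  note mm = vector_field_mm[OF X] vector_field_mm[OF Y] vector_field_mm[OF Z]
  have "metric x y (nomizu_connection (lc_form x y) X Y) Z p
      = metric_form x y (nomizu_connection (lc_form x y) X Y p) (Z p)"
    "metric x y Y (nomizu_connection (lc_form x y) X Z) p
        = metric_form x y (Y p) (nomizu_connection (lc_form x y) X Z p)"
    by (simp_all add: metric_eq mm vector_field_mm[OF vector_field_nomizu_connection[OF X Y eb]]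
         vector_field_mm[OF vector_field_nomizu_connection[OF X Z eb]])
  then show "deriv_along X (metric x y Y Z) p
      = metric x y (nomizu_connection (lc_form x y) X Y) Z p
          + metric x y Y (nomizu_connection (lc_form x y) X Z) p"
    using lc_form_metric[OF assms mm(1)[of p] mm(2)[of p] mm(3)[of p], of y]
    by (simp add: deriv_along_metric vector_field_smooth X Y Z mm nomizu_connection_def
        metric_form_distribs)
qed

text \<open>The difference \<open>T\<close> of two torsion-free metric connections is symmetric and its
  contraction with the metric is skew in the last two arguments, hence zero.\<close>

lemma levi_civita_represents:
  assumes xy: "x > 0" "y > 0"
  shows "represents (levi_civita x y) (lc_form x y)"
proof -
  define D where "D = levi_civita x y"
  define D0 where "D0 = nomizu_connection (lc_form x y)"
  have D0: "is_levi_civita x y D0" unfolding D0_def by (rule is_levi_civita_lc_form[OF xy(1)])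
  then have D: "is_levi_civita x y D" unfolding D_def levi_civita_def
    by (rule someI[of "is_levi_civita x y"])
  have vf: "vector_field (D X Y)" "vector_field (D0 X Y)" if "vector_field X"
      "vector_field Y" for X Y
    using D[unfolded is_levi_civita_def affine_connection_def, THEN conjunct1, THEN conjunct1]
      D0[unfolded is_levi_civita_def affine_connection_def, THEN conjunct1, THEN conjunct1] that
        by auto
  have "D X Y p = D0 X Y p" if X: "vector_field X" and Y: "vector_field Y"
      and p: "p \<in> Sp2" for X Y p
  proof -
    define T where "T = (\<lambda>X Y. D X Y p - D0 X Y p)"
    have sym: "T X Y = T Y X" if "vector_field X" "vector_field Y" for X Y
    proof -
      have "D X Y p - D Y X p = D0 X Y p - D0 Y X p"
        using D D0 that p unfolding is_levi_civita_def by metis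
      then show ?thesis by (simp add: T_def algebra_simps)
    qed
    have skew: "metric_form x y (T X Y) (Z p) = - metric_form x y (Y p) (T X Z)"
      if "vector_field X" "vector_field Y" "vector_field Z" for X Y Z
    proof -
      have "metric x y (D X Y) Z p + metric x y Y (D X Z) p
          = metric x y (D0 X Y) Z p + metric x y Y (D0 X Z) p"
        using D D0 that p unfolding is_levi_civita_def by metis
      then show ?thesis
        using that by (simp add: T_def metric_form_distribs metric_eq vector_field_mm vf)
    qed
    \<comment> \<open>The test field whose value at \<open>p\<close> is \<open>T X Y\<close>:
      alternating symmetry and skewness then makes the squared length of \<open>T X Y\<close> equal
      to its own negative.\<close>
    define Z where "Z = (\<lambda>q. D X Y q - D0 X Y q)"
    have Z: "vector_field Z" unfolding Z_def by (intro vector_field_diff vf X Y)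
    have Zp: "Z p = T X Y" by (simp add: Z_def T_def)
    have "metric_form x y (T X Y) (Z p) = - metric_form x y (Y p) (T Z X)"
        using skew[OF X Y Z] sym[OF X Z] by simp
    also have "\<dots> = metric_form x y (T Z Y) (X p)" using skew[OF Z Y X] by simp
    also have "\<dots> = - metric_form x y (Z p) (T X Y)" using skew[OF Y Z X] sym[OF Y Z] sym[OF X Y]
      by simp
    finally have "metric_form x y (T X Y) (T X Y) = 0" unfolding Zp by simp
    moreover have "T X Y \<in> mm" using vector_field_mm[OF Z, of p] Zp by simp
    ultimately have "T X Y = 0" using metric_form_eq_0[OF xy] by blast
    then show ?thesis by (simp add: T_def)
  qed
  then show ?thesis using vf unfolding represents_def D_def D0_def by blast
qed

section \<open>The curvature of an invariant connection\<close>

definition curv_form :: "(mat4 \<Rightarrow> mat4 \<Rightarrow> mat4) \<Rightarrow> mat4 \<Rightarrow> mat4 \<Rightarrow> mat4 \<Rightarrow> mat4" where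
  "curv_form \<Lambda> a b c = \<Lambda> a (\<Lambda> b c) - \<Lambda> b (\<Lambda> a c) - \<Lambda> (nomizu 1 1 2 a b) c
     - comm (comm a b - nomizu 1 1 2 a b) c"

text \<open>The mixed terms, with one derivative and one factor \<Lambda>, cancel against each other
  and the bracket term. The commutator of derivatives leaves the derivative along
  \<open>lie X Y\<close> and a vertical derivative, which is algebraic.\<close>

lemma curv_eq_curv_form:
  assumes N: "represents N \<Lambda>" and L: "equivariant_bilinear \<Lambda>"
    and X: "vector_field X" and Y: "vector_field Y" and Z: "vector_field Z" and p: "p \<in> Sp2"
  shows "curv N X Y Z p = curv_form \<Lambda> (X p) (Y p) (Z p)"
proof -
  have bil: "bounded_bilinear \<Lambda>" using L by (simp add: equivariant_bilinear_def)
  note bils = bounded_bilinear.add_left[OF bil] bounded_bilinear.add_right[OF bil]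
    bounded_bilinear.diff_left[OF bil] bounded_bilinear.diff_right[OF bil]
  let ?DX = "frechet_derivative X (at p)" and ?DY = "frechet_derivative Y (at p)"
    and ?DZ = "frechet_derivative Z (at p)"
  have second: "N X (N Y Z) p = frechet_derivative (\<lambda>q. frechet_derivative Z (at q) (q ** Y q))
      (at p) (p ** X p)
      + \<Lambda> (frechet_derivative Y (at p) (p ** X p)) (Z p) + \<Lambda> (Y p) (?DZ (p ** X p))
      + \<Lambda> (X p) (?DZ (p ** Y p)) + \<Lambda> (X p) (\<Lambda> (Y p) (Z p))"
    if X: "vector_field X" and Y: "vector_field Y" for X Y
  proof -
    let ?DY = "frechet_derivative Y (at p)"
    have W: "vector_field (N Y Z)" and eq: "\<And>q. q \<in> Sp2 \<Longrightarrow> N Y Z q = nomizu_connection \<Lambda> Y Z q"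
      using N Y Z by (auto simp: represents_def)
    have sm: "smooth (\<lambda>q. frechet_derivative Z (at q) (q ** Y q))"
      by (intro smooth_derivative_along smooth_bilinear[OF bounded_bilinear_mat4_mult] smooth_id
          vector_field_smooth Y Z)
    have "N X (N Y Z) p = frechet_derivative (N Y Z) (at p) (p ** X p)
        + \<Lambda> (X p) (nomizu_connection \<Lambda> Y Z p)"
      using N X W p eq[OF p] by (simp add: represents_def nomizu_connection_def)
    \<comment> \<open>\<open>N Y Z\<close> is known only on \<open>Sp2\<close>, but the direction
      \<open>p ** X p\<close> is tangent to it.\<close>
    also have "frechet_derivative (N Y Z) (at p) (p ** X p)
        = frechet_derivative (nomizu_connection \<Lambda> Y Z) (at p) (p ** X p)"
      by (rule derivative_eq_on_Sp2[OF smooth_has_derivative[OF vector_field_smooth[OF W]]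
           smooth_has_derivative[OF vector_field_smooth[OF vector_field_nomizu_connection[OF Y Z
               L]]] eq p
           mm_sp2[OF vector_field_mm[OF X]]])
    also have "\<dots> = frechet_derivative (\<lambda>q. frechet_derivative Z (at q) (q ** Y q)) (at p) (p ** X p)
      + \<Lambda> (Y p) (?DZ (p ** X p)) + \<Lambda> (?DY (p ** X p)) (Z p)"
      unfolding nomizu_connection_def
      by (simp add: frechet_derivative_add[OF sm] frechet_derivative_bilinear[OF bil]
          smooth_bilinear[OF bil] vector_field_smooth Y Z)
    finally show ?thesis by (simp add: nomizu_connection_def bils)
  qed
  have "N (bracket X Y) Z p = ?DZ (p ** lie X Y p) + \<Lambda> (lie X Y p) (Z p)"
    using N bracket[OF X Y] Z p by (simp add: represents_def nomizu_connection_def)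
  moreover have "frechet_derivative (\<lambda>q. frechet_derivative Z (at q) (q ** Y q)) (at p) (p ** X p)
       - frechet_derivative (\<lambda>q. frechet_derivative Z (at q) (q ** X q)) (at p) (p ** Y p)
     = ?DZ (p ** lie X Y p) - comm (comm (X p) (Y p) - nomizu 1 1 2 (X p) (Y p)) (Z p)"
  proof -
    have lin: "linear ?DZ" by (rule smooth_linear_derivative[OF vector_field_smooth[OF Z]])
    have "comm (X p) (Y p) \<in> sp2"
      using X Y by (intro comm_in_sp2 mm_sp2 vector_field_mm)
    then obtain a b v where "comm (X p) (Y p) - proj_mm (comm (X p) (Y p)) = sp2_mat a b v 0 0 0"
      by (rule sp2_diff_proj_mm)
    then have H: "comm (X p) (Y p) - nomizu 1 1 2 (X p) (Y p) = sp2_mat a b v 0 0 0"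
      using X Y by (simp add: proj_mm_comm vector_field_mm)
    have "?DY (p ** X p) - ?DX (p ** Y p) + comm (X p) (Y p)
        = lie X Y p + (comm (X p) (Y p) - nomizu 1 1 2 (X p) (Y p))"
      by (simp add: lie_def nomizu_connection_def)
    also have "\<dots> = lie X Y p + sp2_mat a b v 0 0 0" unfolding H ..
    finally have "?DZ (p ** (?DY (p ** X p) - ?DX (p ** Y p) + comm (X p) (Y p)))
        = ?DZ (p ** lie X Y p) + comm (Z p) (sp2_mat a b v 0 0 0)"
      by (simp add: mult4_distribs linear_add[OF lin] derivative_vertical[OF Z p])
    then show ?thesis
      unfolding H by (simp add: derivative_nomizu_connection_commutator X Y Z vector_field_smooth)
          (simp add: comm_def)
  qed
  ultimately show ?thesis
    unfolding curv_def second[OF X Y] second[OF Y X] curv_form_def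
    by (simp add: lie_def nomizu_connection_def bils algebra_simps)
qed

text \<open>The curvature depends on the fields through their values at \<open>p\<close> only, so
  the extensions chosen by \<open>extend\<close> do not matter.\<close>

lemma curv_tensor_eq:
  assumes "represents N \<Lambda>" "equivariant_bilinear \<Lambda>" "p \<in> Sp2" "a \<in> mm" "b \<in> mm" "c \<in> mm" "d \<in> mm"
  shows "curv_tensor x y N p a b c d = - metric_form x y (curv_form \<Lambda> a b c) d"
proof -
  have "curv N (extend p a) (extend p b) (extend p c) p = curv_form \<Lambda> a b c"
    using curv_eq_curv_form[OF assms(1,2)] assms extend by metis
  moreover have "curv_form \<Lambda> a b c \<in> mm"
  proof -
    obtain k l v where "comm a b - proj_mm (comm a b) = sp2_mat k l v 0 0 0"
      using comm_in_sp2[of a b] assms(4,5) mm_sp2 sp2_diff_proj_mm by metis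
    then have "comm (comm a b - nomizu 1 1 2 a b) c \<in> mm"
      using assms(4-6) by (elim mm_cases[of c]) (simp add: proj_mm_comm comm_sp2_mat)
    then show ?thesis
      using assms(2) unfolding curv_form_def equivariant_bilinear_def
      by (intro subspace_diff[OF subspace_mm]) auto
  qed
  ultimately show ?thesis
    using extend(2)[OF assms(3,7)] assms(7) by (simp add: curv_tensor_def metric_eq)
qed

section \<open>Almost complex structures and the Chern connection\<close>

text \<open>\<open>e\<close> is the sign on the first summand and \<open>d\<close> the sign on the
  second. All four sign pairs are kept instead of normalising up to conjugation; only whether
  \<open>e = d\<close> matters in the end.\<close>

definition acs_signs :: "(mat4 \<Rightarrow> mat4) \<Rightarrow> real \<Rightarrow> real \<Rightarrow> bool" where
  "acs_signs J e d \<longleftrightarrow> linear J \<and> (e = 1 \<or> e = - 1) \<and> (d = 1 \<or> d = - 1) \<and>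
     (\<forall>p q r s t m. J (mmC_mat p q r s t m) = mmC_mat (\<i> * of_real e * p) (- (\<i> * of_real e * q))
        (\<i> * of_real e * r) (- (\<i> * of_real e * s)) (\<i> * of_real d * t) (- (\<i> * of_real d * m)))"

lemma invariant_acs_signs:
  assumes "invariant_acs J"
  obtains e d where "acs_signs J e d"
proof -
  obtain \<epsilon> :: "root \<Rightarrow> int" where J: "linear J"
    and \<epsilon>: "\<And>\<alpha>. \<alpha> \<in> roots1 \<union> roots2 \<Longrightarrow> \<epsilon> \<alpha> \<in> {1, - 1} \<and> \<epsilon> (- \<alpha>) = - \<epsilon> \<alpha>"
    and e12: "\<epsilon> root1 = \<epsilon> root2"
    and JX: "\<And>\<alpha> X. \<alpha> \<in> roots1 \<union> roots2 \<Longrightarrow> X \<in> root_space \<alpha> \<Longrightarrow> J X = cmul (\<i> * of_int (\<epsilon> \<alpha>)) X"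
    using assms unfolding invariant_acs_def by blast
  have mem: "root1 \<in> roots1 \<union> roots2" "- root1 \<in> roots1 \<union> roots2" "root2 \<in> roots1 \<union> roots2"
    "- root2 \<in> roots1 \<union> roots2" "root3 \<in> roots1 \<union> roots2" "- root3 \<in> roots1 \<union> roots2"
    by (simp_all add: roots1_def roots2_def)
  let ?e = "\<i> * of_int (\<epsilon> root1) :: complex" and ?d = "\<i> * of_int (\<epsilon> root3) :: complex"
  have Jr: "J (mmC_mat c 0 0 0 0 0) = mmC_mat (?e * c) 0 0 0 0 0"
    "J (mmC_mat 0 c 0 0 0 0) = mmC_mat 0 (- (?e * c)) 0 0 0 0"
        "J (mmC_mat 0 0 c 0 0 0) = mmC_mat 0 0 (?e * c) 0 0 0"
    "J (mmC_mat 0 0 0 c 0 0) = mmC_mat 0 0 0 (- (?e * c)) 0 0"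
        "J (mmC_mat 0 0 0 0 c 0) = mmC_mat 0 0 0 0 (?d * c) 0"
    "J (mmC_mat 0 0 0 0 0 c) = mmC_mat 0 0 0 0 0 (- (?d * c))" for c
    using JX[OF mem(1) mmC_mat_in_root_space(1)] JX[OF mem(2) mmC_mat_in_root_space(2)]
      JX[OF mem(3) mmC_mat_in_root_space(3)] JX[OF mem(4) mmC_mat_in_root_space(4)]
      JX[OF mem(5) mmC_mat_in_root_space(5)] JX[OF mem(6) mmC_mat_in_root_space(6)]
      \<epsilon>[OF mem(1)] \<epsilon>[OF mem(3)] \<epsilon>[OF mem(5)] e12
    by (simp_all add: mmC_mat_cmul)
  have "J (mmC_mat p q r s t m) = mmC_mat (?e * p) (- (?e * q)) (?e * r) (- (?e * s)) (?d * t)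
      (- (?d * m))"
    for p q r s t m
  proof -
    have "mmC_mat p q r s t m = mmC_mat p 0 0 0 0 0 + mmC_mat 0 q 0 0 0 0 + mmC_mat 0 0 r 0 0 0
        + mmC_mat 0 0 0 s 0 0
        + mmC_mat 0 0 0 0 t 0 + mmC_mat 0 0 0 0 0 m" by (simp add: mmC_mat_add)
    then show ?thesis by (simp add: linear_add[OF J] Jr) (simp add: mmC_mat_add)
  qed
  moreover have "\<epsilon> root1 = 1 \<or> \<epsilon> root1 = - 1" "\<epsilon> root3 = 1 \<or> \<epsilon> root3 = - 1"
    using \<epsilon>[OF mem(1)] \<epsilon>[OF mem(5)] by auto
  ultimately have "acs_signs J (of_int (\<epsilon> root1)) (of_int (\<epsilon> root3))"
    using J unfolding acs_signs_def by auto
  then show ?thesis using that by blast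
qed

lemma acs_mm_mat:
  "acs_signs J e d \<Longrightarrow> J (mm_mat z w u)
      = mm_mat (\<i> * of_real e * z) (\<i> * of_real e * w) (\<i> * of_real d * u)"
  by (simp add: acs_signs_def mm_mat_mmC_mat)

lemma acs_linear: "acs_signs J e d \<Longrightarrow> linear J"
  by (simp add: acs_signs_def)

lemma acs_cases:
  assumes "acs_signs J e d"
  obtains "e = 1" "d = 1" | "e = 1" "d = - 1" | "e = - 1" "d = 1" | "e = - 1" "d = - 1"
  using assms unfolding acs_signs_def by blast

lemma acs_mm: "acs_signs J e d \<Longrightarrow> a \<in> mm \<Longrightarrow> J a \<in> mm"
  by (elim mm_cases) (simp add: acs_mm_mat)

lemma acs_square: "acs_signs J e d \<Longrightarrow> a \<in> mm \<Longrightarrow> J (J a) = - a"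
  by (elim mm_cases, frule acs_cases) (auto simp: acs_mm_mat sp2_mat_minus sp2_mat_inject)

lemma acs_isometry: "acs_signs J e d \<Longrightarrow> a \<in> mm \<Longrightarrow> b \<in> mm \<Longrightarrow> metric_form x y (J a) (J b)
    = metric_form x y a b"
  by (elim mm_cases, frule acs_cases) (auto simp: acs_mm_mat metric_form_def inner_complex_def
      algebra_simps)

lemma acs_skew:
  assumes J: "acs_signs J e d" and ab: "a \<in> mm" "b \<in> mm"
  shows "metric_form x y (J a) b = - metric_form x y a (J b)"
  using acs_isometry[OF J ab(1) acs_mm[OF J ab(2)], of x y] acs_square[OF J ab(2)]
  by (simp add: metric_form_distribs)

lemma acs_conjugate:
  assumes J: "acs_signs J e d" and h: "h \<in> isotropy" and X: "X \<in> mm"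
  shows "J (adj h ** X ** h) = adj h ** J X ** h"
  using h X by (elim isotropy_cases mm_cases)
    (simp add: isotropy_mat_conjugate_mm_mat acs_mm_mat[OF J] sp2_mat_inject,
        simp add: algebra_simps)

lemma acs_bounded_linear: "acs_signs J e d \<Longrightarrow> bounded_linear J"
  by (simp add: linear_conv_bounded_linear[symmetric] acs_linear)

lemma vector_field_acs:
  assumes J: "acs_signs J e d" and X: "vector_field X"
  shows "vector_field (J \<circ> X)"
  using X unfolding vector_field_def
  by (auto simp: comp_def acs_mm[OF J] acs_conjugate[OF J]
      intro: smooth_linear[OF acs_bounded_linear[OF J]])

lemma derivative_acs:
  assumes J: "acs_signs J e d" and X: "vector_field X"
  shows "frechet_derivative (J \<circ> X) (at p) v = J (frechet_derivative X (at p) v)"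
  unfolding comp_def
  by (rule frechet_derivative_linear[OF acs_bounded_linear[OF J] vector_field_smooth[OF X]])

lemma derivative_field_in_mm: "vector_field X \<Longrightarrow> frechet_derivative X (at p) v \<in> mm"
  by (intro derivative_in_mm vector_field_smooth vector_field_mm)

lemmas acs_distribs = linear_add[OF acs_linear] linear_diff[OF acs_linear] linear_neg[OF acs_linear]

section \<open>The covariant derivative of \<open>J\<close> and the Chern connection\<close>

definition covJ_form :: "(mat4 \<Rightarrow> mat4 \<Rightarrow> mat4) \<Rightarrow> (mat4 \<Rightarrow> mat4) \<Rightarrow> mat4 \<Rightarrow> mat4 \<Rightarrow> mat4" where
  "covJ_form \<Lambda> J a c = \<Lambda> a (J c) - J (\<Lambda> a c)"

text \<open>\<open>J\<close> is a constant linear map in the left-invariant frame, so it commutes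
  with differentiation and only the algebraic part of the connection contributes.\<close>

lemma covJ_eq:
  assumes J: "acs_signs J e d" and D: "represents D \<Lambda>"
    and X: "vector_field X" and Z: "vector_field Z" and p: "p \<in> Sp2"
  shows "covJ D J X Z p = covJ_form \<Lambda> J (X p) (Z p)"
  using D X Z p vector_field_acs[OF J Z]
  by (simp add: covJ_def represents_def nomizu_connection_def covJ_form_def derivative_acs[OF J]
      acs_distribs[OF J])

text \<open>The Chern connection differentiates (1,0) vectors along (0,1) directions by the (1,0)
  part of the bracket, and metric compatibility gives the rest. For \<open>e = d\<close> this means
  a = 1, b = 0 and c = 2 x / y. For opposite signs such brackets have no component in
  \<open>mm\<close>, and the canonical connection of the reductive space remains.\<close>

definition chern_form :: "real \<Rightarrow> real \<Rightarrow> real \<Rightarrow> real \<Rightarrow> mat4 \<Rightarrow> mat4 \<Rightarrow> mat4" where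
  "chern_form x y e d = (if e = d then nomizu 1 0 (2 * x / y) else nomizu 0 0 0)"

lemma equivariant_bilinear_chern_form: "equivariant_bilinear (chern_form x y e d)"
  by (simp add: chern_form_def equivariant_bilinear_nomizu)

text \<open>The defining formula of the Gauduchon connection at parameter 1, on tangent vectors:
  \<open>a\<close>, \<open>c\<close>, \<open>b\<close> stand for X, Z, Y.\<close>

lemma chern_form_identity:
  assumes xy: "x > 0" "y > 0" and J: "acs_signs J e d" and abc: "a \<in> mm" "c \<in> mm" "b \<in> mm"
  shows "metric_form x y (chern_form x y e d a c) b = metric_form x y (lc_form x y a c) b
      - 1 / 2 * metric_form x y (J (covJ_form (lc_form x y) J a c)) b
     + 1 / 4 * metric_form x y (covJ_form (lc_form x y) J (J b) a
         + J (covJ_form (lc_form x y) J b a)) c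
     - 1 / 4 * metric_form x y (covJ_form (lc_form x y) J (J c) a
         + J (covJ_form (lc_form x y) J c a)) b"
proof -
  define r where "r = y / (2 * x)"
  have y: "y = 2 * x * r" and r: "r \<noteq> 0" using xy by (simp_all add: r_def)
  have lc_form: "lc_form x y = nomizu r (1 - r) 1" by (simp add: lc_form_def r_def)
  have ch: "chern_form x y e d = (if e = d then nomizu 1 0 (1 / r) else nomizu 0 0 0)"
    using xy by (simp add: chern_form_def r_def)
  obtain z w u where a: "a = mm_mat z w u" using abc(1) by (rule mm_cases)
  obtain z' w' u' where c: "c = mm_mat z' w' u'" using abc(2) by (rule mm_cases)
  obtain z'' w'' u'' where b: "b = mm_mat z'' w'' u''" using abc(3) by (rule mm_cases)
  show ?thesis
    unfolding ch lc_form covJ_form_def a b c unfolding y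
    by (rule acs_cases[OF J];
        simp add: nomizu_sp2_mat acs_mm_mat[OF J] metric_form_def inner_complex_def sp2_mat_add
            sp2_mat_diff r;
        simp add: field_simps r)
qed

text \<open>The explicit connection satisfies the formula, so the choice is possible; testing both
  solutions against the field \<open>Y\<close> equal to their difference gives a vector of length
  zero.\<close>

lemma gauduchon_represents:
  assumes xy: "x > 0" "y > 0" and J: "acs_signs J e d"
  shows "represents (gauduchon x y J 1) (chern_form x y e d)"
proof -
  define D where "D = levi_civita x y"
  have D: "represents D (lc_form x y)" unfolding D_def by (rule levi_civita_represents[OF xy])
  have "vector_field (gauduchon x y J 1 X Z) \<and> (\<forall>p\<in>Sp2. gauduchon x y J 1 X Z p
      = nomizu_connection (chern_form x y e d) X Z p)"
    if X: "vector_field X" and Z: "vector_field Z" for X Z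
  proof -
    define P where "P = (\<lambda>U. vector_field U \<and> (\<forall>Y. vector_field Y \<longrightarrow> (\<forall>p\<in>Sp2.
        metric x y U Y p = metric x y (D X Z) Y p
          - 1 / 2 * metric x y (J \<circ> covJ D J X Z) Y p
          + 1 / 4 * metric x y (\<lambda>q. covJ D J (J \<circ> Y) X q + J (covJ D J Y X q)) Z p
          - 1 / 4 * metric x y (\<lambda>q. covJ D J (J \<circ> Z) X q + J (covJ D J Z X q)) Y p)))"
    have P_eps: "gauduchon x y J 1 X Z = (SOME U. P U)"
      by (simp add: gauduchon_def P_def D_def Let_def)
    have V: "vector_field (nomizu_connection (chern_form x y e d) X Z)"
      by (rule vector_field_nomizu_connection[OF X Z equivariant_bilinear_chern_form])
    have rhs: "metric x y (D X Z) Y p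
          - 1 / 2 * metric x y (J \<circ> covJ D J X Z) Y p
          + 1 / 4 * metric x y (\<lambda>q. covJ D J (J \<circ> Y) X q + J (covJ D J Y X q)) Z p
          - 1 / 4 * metric x y (\<lambda>q. covJ D J (J \<circ> Z) X q + J (covJ D J Z X q)) Y p
        = metric_form x y (nomizu_connection (chern_form x y e d) X Z p) (Y p)"
      if Y: "vector_field Y" and p: "p \<in> Sp2" for Y p
    proof -
      note mm = vector_field_mm[OF X, of p] vector_field_mm[OF Y, of p] vector_field_mm[OF Z, of p]
      have dJmm: "covJ_form (lc_form x y) J s t \<in> mm" for s t
        unfolding covJ_form_def lc_form_def
          by (intro subspace_diff[OF subspace_mm] acs_mm[OF J]) simp_all
      have DXZ: "vector_field (D X Z)"
        and D_eq: "D X Z p = frechet_derivative Z (at p) (p ** X p) + lc_form x y (X p) (Z p)"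
        using D X Z p by (auto simp: represents_def nomizu_connection_def)
      show ?thesis
        using mm chern_form_identity[OF xy J mm(1) mm(3) mm(2)] vector_field_mm[OF DXZ, of p]
        by (simp add: metric_eq covJ_eq[OF J D] vector_field_acs[OF J] X Y Z p dJmm acs_mm[OF J]
            subspace_add[OF subspace_mm])
           (simp add: D_eq nomizu_connection_def metric_form_distribs)
    qed
    have "P (nomizu_connection (chern_form x y e d) X Z)"
      unfolding P_def using V rhs vector_field_mm by (auto simp: metric_eq)
    then have PU: "P (gauduchon x y J 1 X Z)" unfolding P_eps by (rule someI[of P])
    then have U: "vector_field (gauduchon x y J 1 X Z)" by (simp add: P_def)
    have "gauduchon x y J 1 X Z p = nomizu_connection (chern_form x y e d) X Z p"
        if p: "p \<in> Sp2" for p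
    proof -
      define Y where "Y = (\<lambda>q. gauduchon x y J 1 X Z q
          - nomizu_connection (chern_form x y e d) X Z q)"
      have Y: "vector_field Y" unfolding Y_def by (rule vector_field_diff[OF U V])
      have "metric x y (gauduchon x y J 1 X Z) Y p
          = metric_form x y (nomizu_connection (chern_form x y e d) X Z p) (Y p)"
        using PU Y p rhs[OF Y p] unfolding P_def by simp
      then have "metric_form x y (Y p) (Y p) = 0"
        using vector_field_mm[OF U] vector_field_mm[OF Y]
          by (simp add: metric_eq Y_def metric_form_distribs)
      then have "Y p = 0" using metric_form_eq_0[OF xy vector_field_mm[OF Y]] by blast
      then show ?thesis by (simp add: Y_def)
    qed
    then show ?thesis using U by blast
  qed
  then show ?thesis unfolding represents_def by blast
qed

section \<open>The Nijenhuis tensor and the differential of the fundamental form\<close>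

lemma bracket_eq:
  "vector_field X \<Longrightarrow> vector_field Y \<Longrightarrow> p \<in> Sp2 \<Longrightarrow> bracket X Y p =
     frechet_derivative Y (at p) (p ** X p) - frechet_derivative X (at p) (p ** Y p)
         + nomizu 1 1 2 (X p) (Y p)"
  by (simp add: bracket(2) lie_def nomizu_connection_def)

definition nij_form :: "(mat4 \<Rightarrow> mat4) \<Rightarrow> mat4 \<Rightarrow> mat4 \<Rightarrow> mat4" where
  "nij_form J a b = nomizu 1 1 2 a b - nomizu 1 1 2 (J a) (J b) + J (nomizu 1 1 2 (J a) b)
      + J (nomizu 1 1 2 a (J b))"

text \<open>The derivatives of the fields cancel in pairs because the square of \<open>J\<close> is
  -1; the brackets contribute only their algebraic part.\<close>

lemma nijenhuis_eq:
  assumes J: "acs_signs J e d" and X: "vector_field X" and Y: "vector_field Y" and p: "p \<in> Sp2"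
  shows "nijenhuis J X Y p = nij_form J (X p) (Y p)"
  using X Y p
  by (simp add: nijenhuis_def nij_form_def bracket_eq vector_field_acs[OF J] derivative_acs[OF J]
      acs_distribs[OF J] acs_square[OF J] derivative_field_in_mm)

lemma N3_eq:
  assumes J: "acs_signs J e d" and p: "p \<in> Sp2" and abc: "a \<in> mm" "b \<in> mm" "c \<in> mm"
  shows "N3 x y J p a b c = metric_form x y (nij_form J a b) c"
proof -
  have "nij_form J a b \<in> mm"
    unfolding nij_form_def by (intro subspace_diff[OF subspace_mm] subspace_add[OF subspace_mm]
        acs_mm[OF J]) simp_all
  then show ?thesis
    using abc by (simp add: N3_def metric_eq nijenhuis_eq[OF J] extend p)
qed

lemma deriv_along_fund:
  assumes J: "acs_signs J e d" and Y: "vector_field Y" and Z: "vector_field Z"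
  shows "deriv_along X (fund x y J Y Z) p
      = metric_form x y (J (frechet_derivative Y (at p) (p ** X p))) (Z p)
     + metric_form x y (J (Y p)) (frechet_derivative Z (at p) (p ** X p))"
  unfolding fund_def
  using deriv_along_metric[of "J \<circ> Y" Z X x y p] vector_field_acs[OF J Y] Y Z
  by (simp add: vector_field_smooth vector_field_mm derivative_acs[OF J] acs_mm[OF J])

lemma fund_eq:
  "acs_signs J e d \<Longrightarrow> X p \<in> mm \<Longrightarrow> Y p \<in> mm \<Longrightarrow> fund x y J X Y p = metric_form x y (J (X p)) (Y p)"
  by (simp add: fund_def metric_eq acs_mm)

definition dF_form :: "real \<Rightarrow> real \<Rightarrow> (mat4 \<Rightarrow> mat4) \<Rightarrow> form3" where
  "dF_form x y J a b c = metric_form x y (J (nomizu 1 1 2 a c)) b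
      - metric_form x y (J (nomizu 1 1 2 a b)) c
      - metric_form x y (J (nomizu 1 1 2 b c)) a"

text \<open>The fundamental form is constant in the left-invariant frame and skew, so the
  derivatives of the fields cancel against those in the brackets.\<close>

lemma d_fund_eq:
  assumes J: "acs_signs J e d" and X: "vector_field X" and Y: "vector_field Y"
      and Z: "vector_field Z"
    and p: "p \<in> Sp2"
  shows "d_fund x y J X Y Z p = dF_form x y J (X p) (Y p) (Z p)"
proof -
  have skew: "metric_form x y (J (T p)) (frechet_derivative S (at p) v)
      = - metric_form x y (J (frechet_derivative S (at p) v)) (T p)"
    if "vector_field T" "vector_field S" for T S v
    using acs_skew[OF J vector_field_mm[OF that(1)] derivative_field_in_mm[OF that(2)]]
        metric_form_commute by metis
  have br: "bracket S T p \<in> mm" if "vector_field S" "vector_field T" for S T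
    using vector_field_mm bracket(1) that by blast
  show ?thesis
    unfolding d_fund_def Let_def
    using X Y Z br
    by (simp add: deriv_along_fund[OF J] fund_eq[OF J] vector_field_mm skew dF_form_def)
       (simp add: bracket_eq p acs_distribs[OF J] metric_form_distribs)
qed

lemma dF_eq:
  assumes "acs_signs J e d" "p \<in> Sp2" "a \<in> mm" "b \<in> mm" "c \<in> mm"
  shows "dF x y J p a b c = dF_form x y J a b c"
  unfolding dF_def using assms by (simp add: d_fund_eq extend)

lemma cov_fund_eq:
  assumes xy: "x > 0" "y > 0" and J: "acs_signs J e d" and X: "vector_field X"
      and Y: "vector_field Y"
    and Z: "vector_field Z" and p: "p \<in> Sp2"
  shows "cov_fund x y J X Y Z p = - metric_form x y (J (lc_form x y (X p) (Y p))) (Z p)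
      - metric_form x y (J (Y p)) (lc_form x y (X p) (Z p))"
proof -
  have lc_form: "vector_field (levi_civita x y X T)"
      "levi_civita x y X T p = nomizu_connection (lc_form x y) X T p"
    if "vector_field T" for T
    using levi_civita_represents[OF xy] X that p by (auto simp: represents_def)
  show ?thesis
    unfolding cov_fund_def Let_def
    by (simp add: deriv_along_fund[OF J] fund_eq[OF J] vector_field_mm Y Z lc_form(1))
       (simp add: lc_form(2) Y Z nomizu_connection_def acs_distribs[OF J] metric_form_distribs)
qed

section \<open>Traces over frames\<close>

lemma gens_m_mm: "e \<in> gens_m \<Longrightarrow> e \<in> mm"
  by (auto simp: gens_m_def)

lemma sum_gens_m: "(\<Sum>e\<in>gens_m. f e) = f (mm_mat 1 0 0) + f (mm_mat \<i> 0 0) + f (mm_mat 0 1 0)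
    + f (mm_mat 0 \<i> 0)
    + f (mm_mat 0 0 1) + f (mm_mat 0 0 \<i>)"
  for f :: "mat4 \<Rightarrow> 'a::comm_monoid_add"
  unfolding gens_m_def by (simp add: sp2_mat_inject add.assoc)

lemma gens_m_expansion:
  assumes "x > 0" "y > 0" "v \<in> mm"
  shows "v = (\<Sum>e\<in>gens_m. (metric_form x y v e / metric_form x y e e) *\<^sub>R e)"
proof -
  obtain z w u where v: "v = mm_mat z w u" using assms(3) by (rule mm_cases)
  show ?thesis
    using assms(1,2)
    by (simp add: v sum_gens_m metric_form_def sp2_mat_scaleR sp2_mat_add sp2_mat_inject
        inner_complex_def)
       (simp add: complex_eq_iff)
qed

text \<open>Spanning is obtained by counting: six orthonormal vectors are independent, and
  \<open>mm\<close> is spanned by the six elements of \<open>gens_m\<close>.\<close>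

lemma orthonormal_frame_expansion:
  assumes f: "orthonormal_frame x y f" and v: "v \<in> mm"
  shows "v = (\<Sum>i<6. metric_form x y v (f i) *\<^sub>R f i)"
proof -
  have fmm: "f i \<in> mm" if "i < 6" for i using f that by (simp add: orthonormal_frame_def)
  have on: "metric_form x y (f i) (f j) = (if i = j then 1 else 0)" if "i < 6" "j < 6" for i j
    using f that by (auto simp: orthonormal_frame_def inner_xy_eq[symmetric])
  have coeff: "metric_form x y (\<Sum>i<6. c i *\<^sub>R f i) (f j) = c j" if "j < 6" for c j
  proof -
    have "metric_form x y (\<Sum>i<6. c i *\<^sub>R f i) (f j) = (\<Sum>i<6. c i * metric_form x y (f i) (f j))"
      by (simp add: bounded_bilinear.sum_left[OF bounded_bilinear_metric_form] metric_form_distribs)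
    also have "\<dots> = (\<Sum>i<6. if i = j then c j else 0)"
      using that by (intro sum.cong) (auto simp: on)
    finally show ?thesis using that by simp
  qed
  have inj: "inj_on f {..<6}"
    by (rule inj_onI) (metis lessThan_iff on zero_neq_one)
  have "independent (f ` {..<6})"
  proof (rule independent_if_scalars_zero)
    fix c a assume "(\<Sum>a\<in>f ` {..<6}. c a *\<^sub>R a) = 0" and a: "a \<in> f ` {..<6}"
    then have 0: "(\<Sum>i<6. c (f i) *\<^sub>R f i) = 0" by (simp add: sum.reindex[OF inj])
    obtain j where j: "j < 6" "a = f j" using a by auto
    have "c (f j) = metric_form x y (\<Sum>i<6. c (f i) *\<^sub>R f i) (f j)" using coeff[OF j(1), of
        "\<lambda>i. c (f i)"] by simp
    then show "c a = 0"
      unfolding 0 j(2) by (simp add: bounded_bilinear.zero_left[OF bounded_bilinear_metric_form])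
  qed simp
  moreover have "f ` {..<6} \<subseteq> mm" using fmm by auto
  moreover have "dim mm \<le> card (f ` {..<6})"
  proof -
    have "mm \<subseteq> span gens_m" using span_gens_m by (auto elim: mm_cases)
    then have "dim mm \<le> card gens_m" by (rule dim_le_card) (simp add: gens_m_def)
    also have "\<dots> \<le> 6" unfolding gens_m_def by (intro card_insert_le_m1) simp_all
    finally show ?thesis by (simp add: card_image[OF inj])
  qed
  ultimately have "v \<in> span (f ` {..<6})" using card_ge_dim_independent v by blast
  then obtain c where "v = (\<Sum>a\<in>f ` {..<6}. c a *\<^sub>R a)"
    by (auto simp: span_finite)
  then have c: "v = (\<Sum>i<6. c (f i) *\<^sub>R f i)" by (simp add: sum.reindex[OF inj])
  then have "metric_form x y v (f j) = c (f j)" if "j < 6" for j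
    using coeff[OF that, of "\<lambda>i. c (f i)"] by simp
  then have "(\<Sum>i<6. metric_form x y v (f i) *\<^sub>R f i) = (\<Sum>i<6. c (f i) *\<^sub>R f i)" by simp
  then show ?thesis using c by (rule trans[rotated, OF sym])
qed

text \<open>The trace of a bilinear form does not depend on the frame; this replaces a frame known
  only by choice with \<open>gens_m\<close>. The divisors compensate for the lengths of the
  generators.\<close>

lemma frame_trace:
  fixes \<beta> :: "mat4 \<Rightarrow> mat4 \<Rightarrow> real"
  assumes xy: "x > 0" "y > 0" and f: "orthonormal_frame x y f"
    and l1: "\<And>b. linear (\<lambda>a. \<beta> a b)" and l2: "\<And>a. linear (\<beta> a)"
  shows "(\<Sum>i<6. \<beta> (f i) (f i)) = (\<Sum>e\<in>gens_m. \<beta> e e / metric_form x y e e)"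
proof -
  have fmm: "f i \<in> mm" if "i < 6" for i using f that by (simp add: orthonormal_frame_def)
  have "\<beta> (f i) (f i) = (\<Sum>e\<in>gens_m. metric_form x y (f i) e / metric_form x y e e * \<beta> e (f i))" if
      "i < 6" for i
  proof -
    have "\<beta> (f i) b = (\<Sum>e\<in>gens_m. metric_form x y (f i) e / metric_form x y e e * \<beta> e b)" for b
      by (subst gens_m_expansion[OF xy fmm[OF that]])
         (simp add: linear_sum[OF l1] linear_cmul[OF l1])
    then show ?thesis .
  qed
  then have "(\<Sum>i<6. \<beta> (f i) (f i))
      = (\<Sum>i<6. \<Sum>e\<in>gens_m. metric_form x y (f i) e / metric_form x y e e * \<beta> e (f i))"
    by simp
  also have "\<dots> = (\<Sum>e\<in>gens_m. \<beta> e (\<Sum>i<6. metric_form x y e (f i) *\<^sub>R f i) / metric_form x y e e)"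
    by (subst sum.swap)
       (simp add: linear_sum[OF l2] linear_cmul[OF l2] sum_divide_distrib
           metric_form_commute[of x y _ "f _"])
  also have "\<dots> = (\<Sum>e\<in>gens_m. \<beta> e e / metric_form x y e e)"
    by (intro sum.cong refl) (simp add: orthonormal_frame_expansion[OF f, symmetric] gens_m_mm)
  finally show ?thesis .
qed

lemma orthonormal_frame_exists:
  assumes "x > 0" "y > 0"
  shows "orthonormal_frame x y
      (\<lambda>i. [mm_mat (of_real (1 / sqrt (24 * x))) 0 0, mm_mat (\<i> * of_real (1 / sqrt (24 * x))) 0 0,
     mm_mat 0 (of_real (1 / sqrt (24 * x))) 0, mm_mat 0 (\<i> * of_real (1 / sqrt (24 * x))) 0,
     mm_mat 0 0 (of_real (1 / sqrt (12 * y))), mm_mat 0 0 (\<i> * of_real (1 / sqrt (12 * y)))] ! i)"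
proof -
  have all6: "(\<forall>i<6::nat. P i) \<longleftrightarrow> P 0 \<and> P 1 \<and> P 2 \<and> P 3 \<and> P 4 \<and> P 5" for P
  proof -
    have "i < 6 \<longleftrightarrow> i = 0 \<or> i = 1 \<or> i = 2 \<or> i = 3 \<or> i = 4 \<or> i = 5" for i :: nat by arith
    then show ?thesis by auto
  qed
  show ?thesis
    unfolding orthonormal_frame_def all6
    using assms by (simp add: inner_xy_eq) (simp add: metric_form_def inner_complex_def field_simps)
qed

lemma frame: "x > 0 \<Longrightarrow> y > 0 \<Longrightarrow> orthonormal_frame x y (frame x y)"
  unfolding frame_def by (rule someI[of "orthonormal_frame x y", OF orthonormal_frame_exists])

section \<open>Symmetries of the curvature and the Riemannian scalar curvature\<close>

lemma curv_form_linear: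
  assumes "bounded_bilinear \<Lambda>"
  shows "linear (\<lambda>a. curv_form \<Lambda> a b c)" "linear (\<lambda>b. curv_form \<Lambda> a b c)"
      "linear (\<lambda>c. curv_form \<Lambda> a b c)"
proof -
  note bils = bounded_bilinear.add_left[OF assms] bounded_bilinear.add_right[OF assms]
    bounded_bilinear.scaleR_left[OF assms] bounded_bilinear.scaleR_right[OF assms]
  have cd: "comm (A - B) C = comm A C - comm B C" for A B C
    by (simp add: comm_def mult4_distribs)
  show "linear (\<lambda>a. curv_form \<Lambda> a b c)" "linear (\<lambda>b. curv_form \<Lambda> a b c)"
      "linear (\<lambda>c. curv_form \<Lambda> a b c)"
    by (rule linearI; simp add: curv_form_def bils nomizu_distribs comm_distribs cd algebra_simps)+
qed

lemma curv_form_skew: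
  assumes "bounded_bilinear \<Lambda>"
  shows "curv_form \<Lambda> a b c = - curv_form \<Lambda> b a c"
proof -
  have L: "nomizu 1 1 2 a b = - nomizu 1 1 2 b a"
    by (simp add: nomizu_def sp2_mat_minus sp2_mat_inject)
  have C: "comm (comm a b - - nomizu 1 1 2 b a) c = - comm (comm b a - nomizu 1 1 2 b a) c"
    by (simp add: comm_def mult4_distribs)
  show ?thesis
    unfolding curv_form_def L C by (simp add: bounded_bilinear.minus_left[OF assms])
qed

text \<open>Each \<Lambda> a is skew by hypothesis, the isotropy algebra acts by skew maps, and
  commutators of skew maps are skew.\<close>

lemma curv_form_metric_skew:
  assumes met: "\<And>a b c. a \<in> mm \<Longrightarrow> b \<in> mm \<Longrightarrow> c \<in> mm \<Longrightarrow> metric_form x y (\<Lambda> a b) c =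
      - metric_form x y b (\<Lambda> a c)"
    and L: "\<And>a b. \<Lambda> a b \<in> mm" and mm: "a \<in> mm" "b \<in> mm" "c \<in> mm" "d \<in> mm"
  shows "metric_form x y (curv_form \<Lambda> a b c) d = - metric_form x y (curv_form \<Lambda> a b d) c"
proof -
  obtain k l v where "comm a b - proj_mm (comm a b) = sp2_mat k l v 0 0 0"
    using comm_in_sp2[of a b] mm mm_sp2 sp2_diff_proj_mm by metis
  then have H: "comm a b - nomizu 1 1 2 a b = sp2_mat k l v 0 0 0" using mm
    by (simp add: proj_mm_comm)
  have h: "metric_form x y (comm (sp2_mat k l v 0 0 0) c) d =
      - metric_form x y c (comm (sp2_mat k l v 0 0 0) d)"
    using mm(3,4)
    by (elim mm_cases) (simp add: comm_sp2_mat metric_form_def inner_complex_def algebra_simps)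
  have 2: "metric_form x y (\<Lambda> s (\<Lambda> t c)) d = metric_form x y c (\<Lambda> t (\<Lambda> s d))" if "s \<in> mm"
      "t \<in> mm" for s t
    using met[OF that(1) L mm(4), of t c] met[OF that(2) mm(3) L, of s d] by simp
  show ?thesis
    unfolding curv_form_def H metric_form_commute[of x y _ c]
    by (simp add: metric_form_distribs 2 mm h met L)
qed

lemma comm_zero: "comm 0 X = 0" "comm X 0 = 0" "comm X X = 0"
  by (simp_all add: comm_def)

lemma nomizu_zero: "nomizu a b c X 0 = 0" "nomizu a b c 0 X = 0"
  by (simp_all add: nomizu_def sp2_mat_0)

lemma scalar_curvature_eq:
  assumes xy: "x > 0" "y > 0" and p: "p \<in> Sp2"
  shows "scalar_curvature x y p = (4 * x\<^sup>2 + 12 * x * y - y\<^sup>2) / (6 * x\<^sup>2 * y)"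
proof -
  let ?f = "frame x y"
  have f: "orthonormal_frame x y ?f" by (rule frame[OF xy])
  have eb: "equivariant_bilinear (lc_form x y)"
    by (simp add: lc_form_def equivariant_bilinear_nomizu)
  then have bil: "bounded_bilinear (lc_form x y)" by (simp add: equivariant_bilinear_def)
  define T where "T = (\<lambda>a b c d. - metric_form x y (curv_form (lc_form x y) a b c) d)"
  have T1: "linear (\<lambda>a. T a b c d)" and T2: "linear (\<lambda>b. T a b c d)"
      and T3: "linear (\<lambda>c. T a b c d)"
    and T4: "linear (\<lambda>d. T a b c d)" for a b c d
    unfolding T_def
    by (rule linearI; simp add: metric_form_distribs linear_add[OF curv_form_linear(1)[OF bil]]
        linear_add[OF curv_form_linear(2)[OF bil]]
      linear_add[OF curv_form_linear(3)[OF bil]] linear_cmul[OF curv_form_linear(1)[OF bil]]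
      linear_cmul[OF curv_form_linear(2)[OF bil]] linear_cmul[OF curv_form_linear(3)[OF bil]])+
  have "scalar_curvature x y p = (\<Sum>i<6. \<Sum>j<6. T (?f i) (?f j) (?f i) (?f j))"
    unfolding scalar_curvature_def T_def
    using curv_tensor_eq[OF levi_civita_represents[OF xy] eb p] f
    by (intro sum.cong refl) (simp add: orthonormal_frame_def)
  also have "\<dots> = (\<Sum>i<6. \<Sum>e\<in>gens_m. T (?f i) e (?f i) e / metric_form x y e e)"
    by (intro sum.cong refl frame_trace[OF xy f] T2 T4)
  also have "\<dots> = (\<Sum>e\<in>gens_m. (\<Sum>i<6. T (?f i) e (?f i) e) / metric_form x y e e)"
    by (subst sum.swap) (simp add: sum_divide_distrib)
  also have "\<dots> = (\<Sum>e\<in>gens_m. (\<Sum>e'\<in>gens_m. T e' e e' e / metric_form x y e' e') / metric_form x y e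
      e)"
  proof (intro sum.cong refl arg_cong2[where f = "(/)"])
    fix e show "(\<Sum>i<6. T (?f i) e (?f i) e) = (\<Sum>e'\<in>gens_m. T e' e e' e / metric_form x y e' e')"
      by (rule frame_trace[OF xy f, of "\<lambda>a b. T a e b e"]) (rule T1 T3)+
  qed
  also have "\<dots> = (4 * x\<^sup>2 + 12 * x * y - y\<^sup>2) / (6 * x\<^sup>2 * y)"
  proof -
    define r where "r = y / (2 * x)"
    have y: "y = 2 * x * r" and r: "r > 0" using xy by (simp_all add: r_def)
    have lc_form: "lc_form x y = nomizu r (1 - r) 1" by (simp add: lc_form_def r_def)
    show ?thesis
      unfolding T_def sum_gens_m curv_form_def lc_form using xy r unfolding y
      by (simp add: comm_sp2_mat comm_zero nomizu_zero sp2_mat_0 nomizu_sp2_mat sp2_mat_diff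
          metric_form_def inner_complex_def)
        (simp add: field_simps power2_eq_square)
  qed
  finally show ?thesis .
qed

section \<open>Vectors of type (1,0) and unitary frames\<close>

lemma re_part_mmC_mat: "re_part (mmC_mat p q r s t m)
    = mm_mat ((p - cnj q) / 2) ((r - cnj s) / 2) ((t - cnj m) / 2)"
  by (simp add: re_part_def conj_mm_def mmC_mat_adj mmC_mat_minus mmC_mat_add mmC_mat_cmul
      mm_mat_mmC_mat mmC_mat_inject field_simps)

lemma im_part_mmC_mat: "im_part (mmC_mat p q r s t m)
    = mm_mat (- \<i> * (p + cnj q) / 2) (- \<i> * (r + cnj s) / 2) (- \<i> * (t + cnj m) / 2)"
  by (simp add: im_part_def conj_mm_def mmC_mat_adj mmC_mat_minus mmC_mat_diff mmC_mat_cmul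
      mm_mat_mmC_mat mmC_mat_inject)

lemma conj_mm_parts: "re_part (conj_mm X) = re_part X" "im_part (conj_mm X) = - im_part X"
  by (simp_all add: re_part_def im_part_def conj_mm_def mat4_eq_iff adj_nth cmul_nth algebra_simps)

lemma type10_parts:
  assumes J: "acs_signs J e d" and X: "X \<in> mmC" "J X = cmul \<i> X"
  shows "re_part X \<in> mm" and "im_part X = - J (re_part X)"
proof -
  obtain p q r s t m where mmC_mat: "X = mmC_mat p q r s t m" using X(1) by (auto simp: mmC_eq)
  show "re_part X \<in> mm" by (simp add: mmC_mat re_part_mmC_mat)
  have "mmC_mat (\<i> * of_real e * p) (- (\<i> * of_real e * q)) (\<i> * of_real e * r)
      (- (\<i> * of_real e * s))
      (\<i> * of_real d * t) (- (\<i> * of_real d * m))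
          = mmC_mat (\<i> * p) (\<i> * q) (\<i> * r) (\<i> * s) (\<i> * t) (\<i> * m)"
    using X(2) J unfolding mmC_mat mmC_mat_cmul acs_signs_def by simp
  then show "im_part X = - J (re_part X)"
    using J by (elim acs_cases)
     (auto simp: mmC_mat mmC_mat_inject re_part_mmC_mat im_part_mmC_mat acs_mm_mat[OF J]
         sp2_mat_minus sp2_mat_inject)
qed

lemma type10_exists:
  assumes J: "acs_signs J e d" and a: "a \<in> mm"
  defines "X \<equiv> a - cmul \<i> (J a)"
  shows "X \<in> mmC" and "J X = cmul \<i> X" and "re_part X = a"
proof -
  obtain z w u where a: "a = mm_mat z w u" using a by (rule mm_cases)
  have X: "X = mmC_mat ((1 + of_real e) * z) ((of_real e - 1) * cnj z) ((1 + of_real e) * w)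
      ((of_real e - 1) * cnj w)
      ((1 + of_real d) * u) ((of_real d - 1) * cnj u)"
    unfolding X_def a acs_mm_mat[OF J]
        unfolding mm_mat_mmC_mat mmC_mat_cmul mmC_mat_diff mmC_mat_inject
      by (simp add: algebra_simps)
  show "X \<in> mmC" unfolding X mmC_eq by blast
  have JX: "J (mmC_mat p q r s t m) = mmC_mat (\<i> * of_real e * p) (- (\<i> * of_real e * q))
        (\<i> * of_real e * r) (- (\<i> * of_real e * s)) (\<i> * of_real d * t)
            (- (\<i> * of_real d * m))" for p q r s t m
    using J by (simp add: acs_signs_def)
  show "J X = cmul \<i> X"
    using J unfolding X JX mmC_mat_cmul mmC_mat_inject by (elim acs_cases) simp_all
  show "re_part X = a"
    using J unfolding X re_part_mmC_mat a sp2_mat_inject by (elim acs_cases) simp_all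
qed

text \<open>A (1,0) vector is \<open>a - cmul \<i> (J a)\<close> with \<open>a\<close> its real
  part. Unitarity of a frame thus means that the real parts have squared length 1/2 and are
  orthogonal to each other and to their images under \<open>J\<close>.\<close>

lemma cext2_type10:
  assumes J: "acs_signs J e d" and X: "X \<in> mmC" "J X = cmul \<i> X" and Y: "Y \<in> mmC" "J Y = cmul \<i> Y"
  shows "cext2 (inner_xy x y) X (conj_mm Y)
     = Complex (2 * metric_form x y (re_part X) (re_part Y)) (2 * metric_form x y (re_part X)
         (J (re_part Y)))"
proof -
  note parts = type10_parts[OF J X] type10_parts[OF J Y]
  have m: "- a \<in> mm" if "a \<in> mm" for a using subspace_neg[OF subspace_mm that] .
  show ?thesis
    unfolding cext2_def cext_def conj_mm_parts parts(2,4)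
    using parts(1,3) acs_skew[OF J parts(1,3), of x y] acs_isometry[OF J parts(1,3), of x y]
    by (simp add: inner_xy_eq acs_mm[OF J] m metric_form_distribs complex_eq_iff)
qed

lemma unitary_frame_exists:
  assumes xy: "x > 0" "y > 0" and J: "acs_signs J e d"
  shows "\<exists>u. unitary_frame x y J u"
proof -
  \<comment> \<open>The coefficients give squared length 1/2, as the passage to
    \<open>a - cmul \<i> (J a)\<close> doubles it.\<close>
  define a where "a = (\<lambda>i. [mm_mat (of_real (1 / sqrt (48 * x))) 0 0, mm_mat 0
      (of_real (1 / sqrt (48 * x))) 0,
     mm_mat 0 0 (of_real (1 / sqrt (24 * y)))] ! i)"
  define u where "u = (\<lambda>i. a i - cmul \<i> (J (a i)))"
  have all3: "(\<forall>i<3::nat. P i) \<longleftrightarrow> P 0 \<and> P 1 \<and> P 2" for P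
  proof -
    have "i < 3 \<longleftrightarrow> i = 0 \<or> i = 1 \<or> i = 2" for i :: nat by arith
    then show ?thesis by auto
  qed
  have amm: "\<forall>i<3. a i \<in> mm" unfolding all3 by (simp add: a_def)
  have g: "\<forall>i<3. \<forall>j<3. 2 * metric_form x y (a i) (a j) = (if i = j then 1 else 0)
      \<and> metric_form x y (a i) (J (a j)) = 0"
    unfolding all3 a_def using xy
      by (simp add: acs_mm_mat[OF J]) (simp add: metric_form_def inner_complex_def field_simps)
  have u10: "u i \<in> mmC" "J (u i) = cmul \<i> (u i)" "re_part (u i) = a i" if "i < 3" for i
    using type10_exists[OF J, of "a i"] amm that by (simp_all add: u_def)
  have "unitary_frame x y J u"
    unfolding unitary_frame_def
    using g by (auto simp: cext2_type10[OF J] u10 complex_eq_iff)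
  then show ?thesis by blast
qed

lemma sum_lessThan_3: "(\<Sum>i<3. f i) = f 0 + f 1 + f (2 :: nat)" for f :: "nat \<Rightarrow> 'a::comm_monoid_add"
  by (simp add: numeral_eq_Suc)

lemma sum_lessThan_6: "(\<Sum>i<6. f i) = f 0 + f 1 + f 2 + f 3 + f 4 + f (5 :: nat)"
  for f :: "nat \<Rightarrow> 'a::comm_monoid_add"
  by (simp add: numeral_eq_Suc)

lemma chern_form_metric:
  assumes xy: "x > 0" "y > 0" and mm: "a \<in> mm" "b \<in> mm" "c \<in> mm"
  shows "metric_form x y (chern_form x y e d a b) c = - metric_form x y b (chern_form x y e d a c)"
proof -
  define s where "s = x / y"
  have x: "x = s * y" and ch:
      "chern_form x y e d = (if e = d then nomizu 1 0 (2 * s) else nomizu 0 0 0)"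
    using xy by (simp_all add: s_def chern_form_def)
  show ?thesis
    unfolding ch unfolding x using mm
    by (elim mm_cases) (simp add: nomizu_sp2_mat metric_form_def inner_complex_def algebra_simps)
qed

text \<open>If \<open>u\<^sub>i = a\<^sub>i - \<i> J a\<^sub>i\<close> is a unitary frame, then the vectors \<open>sqrt 2 a\<^sub>i\<close> and \<open>sqrt 2 J a\<^sub>i\<close> form a real
  orthonormal frame \<open>f\<close>, and the sum over \<open>u\<close> is a quarter of the sum of the
  \<open>T (f\<^sub>k, J f\<^sub>k, f\<^sub>l, J f\<^sub>l)\<close>, which does not depend on the frame.\<close>

lemma hermitian_frame_sum:
  fixes T :: "mat4 \<Rightarrow> mat4 \<Rightarrow> mat4 \<Rightarrow> mat4 \<Rightarrow> real"
  assumes xy: "x > 0" "y > 0" and J: "acs_signs J e d" and u: "unitary_frame x y J u"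
    and T1: "\<And>b c d. linear (\<lambda>a. T a b c d)" and T2: "\<And>a c d. linear (\<lambda>b. T a b c d)"
    and T3: "\<And>a b d. linear (\<lambda>c. T a b c d)" and T4: "\<And>a b c. linear (\<lambda>d. T a b c d)"
    and sk1: "\<And>a b c d. T a b c d = - T b a c d"
    and sk2: "\<And>a b c d. a \<in> mm \<Longrightarrow> b \<in> mm \<Longrightarrow> c \<in> mm \<Longrightarrow> d \<in> mm \<Longrightarrow> T a b c d = - T a b d c"
    and S: "\<And>a b c d. a \<in> mm \<Longrightarrow> b \<in> mm \<Longrightarrow> c \<in> mm \<Longrightarrow> d \<in> mm \<Longrightarrow> S a b c d = T a b c d"
  shows "(\<Sum>i<3. \<Sum>j<3. cext4 S (conj_mm (u i)) (u i) (u j) (conj_mm (u j)))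
     = of_real (1 / 4 * (\<Sum>e\<in>gens_m. (\<Sum>e'\<in>gens_m. T e (J e) e' (J e') / metric_form x y e' e') /
         metric_form x y e e))"
proof -
  define a where "a = (\<lambda>i. re_part (u i))"
  have u10: "u i \<in> mmC" "J (u i) = cmul \<i> (u i)" if "i < 3" for i
    using u that by (auto simp: unitary_frame_def)
  have amm: "a i \<in> mm" and im: "im_part (u i) = - J (a i)" if "i < 3" for i
    using type10_parts[OF J u10[OF that]] by (simp_all add: a_def)
  have g: "metric_form x y (a i) (a j) = (if i = j then 1 / 2 else 0)"
      "metric_form x y (a i) (J (a j)) = 0"
    if "i < 3" "j < 3" for i j
  proof -
    have "Complex (2 * metric_form x y (a i) (a j)) (2 * metric_form x y (a i) (J (a j)))
        = (if i = j then 1 else 0)"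
      using cext2_type10[OF J u10[OF that(1)] u10[OF that(2)], of x y] u that
      unfolding unitary_frame_def a_def by simp
    then show "metric_form x y (a i) (a j) = (if i = j then 1 / 2 else 0)"
        "metric_form x y (a i) (J (a j)) = 0"
      by (auto simp: complex_eq_iff split: if_splits)
  qed
  have Tm: "T (- a) b c d = - T a b c d" "T a (- b) c d = - T a b c d" "T a b (- c) d = - T a b c d"
    "T a b c (- d) = - T a b c d" for a b c d
    using linear_neg[OF T1] linear_neg[OF T2] linear_neg[OF T3] linear_neg[OF T4] by auto
  have T0: "T a a c d = 0" for a c d using sk1[of a a c d] by simp
  \<comment> \<open>Of the sixteen terms, skewness in the first and in the last two arguments kills
    all but four, which are equal.\<close>
  have cext4_eq: "cext4 S (conj_mm (u i)) (u i) (u j) (conj_mm (u j))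
      = of_real (4 * T (a i) (J (a i)) (a j) (J (a j)))"
    if "i < 3" "j < 3" for i j
  proof -
    note mm = amm[OF that(1)] acs_mm[OF J amm[OF that(1)]] amm[OF that(2)]
        acs_mm[OF J amm[OF that(2)]]
    have neg: "- b \<in> mm" if "b \<in> mm" for b using subspace_neg[OF subspace_mm that] .
    have sk2': "T b b' (J (a j)) (a j) = - T b b' (a j) (J (a j))" "T b b' (a j) (a j) = 0"
       "T b b' (J (a j)) (J (a j)) = 0" if "b \<in> mm" "b' \<in> mm" for b b'
      using sk2[OF that mm(4,3)] sk2[OF that mm(3,3)] sk2[OF that mm(4,4)] by simp_all
    have ri: "re_part (u k) = a k" for k by (simp add: a_def)
    show ?thesis
      unfolding cext4_def cext_def conj_mm_parts im[OF that(1)] im[OF that(2)] ri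
      using mm by (simp add: S neg Tm T0 sk2' sk1[of "J (a i)" "a i"] complex_eq_iff)
  qed
  define f where "f = (\<lambda>i. sqrt 2 *\<^sub>R (if i < 3 then a i else J (a (i - 3))))"
  have g': "metric_form x y (J (a i)) (J (a j)) = (if i = j then 1 / 2 else 0)"
      "metric_form x y (J (a i)) (a j) = 0"
    if "i < 3" "j < 3" for i j
    using g[OF that] acs_isometry[OF J amm[OF that(1)] amm[OF that(2)], of x y]
      acs_skew[OF J amm[OF that(1)] amm[OF that(2)], of x y] by simp_all
  have f: "orthonormal_frame x y f"
  proof -
    have fmm: "f i \<in> mm" if "i < 6" for i
      using that unfolding f_def
      by (auto intro!: subspace_scale[OF subspace_mm] amm acs_mm[OF J])
    have "metric_form x y (f i) (f j) = (if i = j then 1 else 0)" if "i < 6" "j < 6" for i j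
      using that unfolding f_def by (auto simp: metric_form_distribs g g')
    then show ?thesis
      unfolding orthonormal_frame_def using fmm by (simp add: inner_xy_eq)
  qed
  \<comment> \<open>The vectors \<open>a i\<close> and \<open>J (a i)\<close> contribute equally,
    and each carries a factor 2 from \<open>sqrt 2\<close>. The rule is used once for each pair of
    arguments, which makes 16 in total.\<close>
  have double: "(\<Sum>i<6. \<beta> (f i) (J (f i))) = 4 * (\<Sum>i<3. \<beta> (a i) (J (a i)))"
    if b1: "\<And>b. linear (\<lambda>a. \<beta> a b)" and b2: "\<And>a. linear (\<beta> a)"
        and sk: "\<And>a b. a \<in> mm \<Longrightarrow> b \<in> mm \<Longrightarrow> \<beta> a b = - \<beta> b a"
    for \<beta> :: "mat4 \<Rightarrow> mat4 \<Rightarrow> real"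
  proof -
    have Jf: "J (c *\<^sub>R b) = c *\<^sub>R J b" for c b using linear_cmul[OF acs_linear[OF J]] .
    have s: "\<beta> (sqrt 2 *\<^sub>R b) (sqrt 2 *\<^sub>R c) = 2 * \<beta> b c" for b c
      using linear_cmul[OF b1] linear_cmul[OF b2] by simp
    have J2: "\<beta> (J (a i)) (J (J (a i))) = \<beta> (a i) (J (a i))" if "i < 3" for i
      using acs_square[OF J amm[OF that]] linear_neg[OF b2] sk[OF acs_mm[OF J amm[OF that]]
          amm[OF that]] by simp
    show ?thesis
      unfolding sum_lessThan_6 sum_lessThan_3 by (simp add: f_def Jf s J2)
  qed
  have trace: "(\<Sum>i<6. \<beta> (f i) (J (f i))) = (\<Sum>e\<in>gens_m. \<beta> e (J e) / metric_form x y e e)"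
    if b1: "\<And>b. linear (\<lambda>a. \<beta> a b)" and b2: "\<And>a. linear (\<beta> a)" for \<beta> :: "mat4 \<Rightarrow> mat4 \<Rightarrow> real"
  proof (rule frame_trace[OF xy f, of "\<lambda>a b. \<beta> a (J b)"])
    show "linear (\<lambda>a. \<beta> a (J b))" for b by (rule b1)
    show "linear (\<lambda>b. \<beta> a (J b))" for a
      using linear_compose[OF acs_linear[OF J] b2] by (simp add: comp_def)
  qed
  define h where "h = (\<lambda>b c. \<Sum>e\<in>gens_m. T b c e (J e) / metric_form x y e e)"
  have inner_sum: "4 * (\<Sum>j<3. T b c (a j) (J (a j))) = h b c" if "b \<in> mm" "c \<in> mm" for b c
    using double[OF T3 T4 sk2[OF that]] trace[OF T3 T4, of b c]
    by (simp add: h_def)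
  have h1: "linear (\<lambda>b. h b c)" and h2: "linear (h b)" for b c
    unfolding h_def
    by (rule linearI; simp add: linear_add[OF T1] linear_add[OF T2] linear_cmul[OF T1]
        linear_cmul[OF T2]
        add_divide_distrib sum.distrib sum_distrib_left)+
  have hs: "h b c = - h c b" for b c
    unfolding h_def by (subst sk1) (simp add: sum_negf)
  have "(\<Sum>i<3. \<Sum>j<3. cext4 S (conj_mm (u i)) (u i) (u j) (conj_mm (u j)))
     = of_real (\<Sum>i<3. 4 * (\<Sum>j<3. T (a i) (J (a i)) (a j) (J (a j))))"
    by (simp add: cext4_eq sum_distrib_left)
  also have "(\<Sum>i<3. 4 * (\<Sum>j<3. T (a i) (J (a i)) (a j) (J (a j)))) = (\<Sum>i<3. h (a i) (J (a i)))"
    using inner_sum amm acs_mm[OF J] by (intro sum.cong refl) simp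
  also have "\<dots> = 1 / 4 * (\<Sum>e\<in>gens_m. h e (J e) / metric_form x y e e)"
    using double[OF h1 h2 hs] trace[OF h1 h2] by simp
  finally show ?thesis by (simp add: h_def)
qed

section \<open>The Hermitian scalar curvature and the Gray-Hervella classes\<close>

text \<open>The Chern connection is complex linear, so in the trace over the last two arguments the
  commutator drops out, and so does the term with \<Lambda>, which exchanges the two summands. The
  isotropy part of \<open>comm e (J e)\<close> remains; it enters through the signed sum of the
  three positive roots. This sum is zero for opposite signs because \<alpha>1 + \<alpha>2 =
  \<alpha>3.\<close>

lemma chern_scalar_eq:
  assumes xy: "x > 0" "y > 0" and J: "acs_signs J e d" and p: "p \<in> Sp2"
  shows "chern_scalar x y J p = of_real (if e = d then 2 * (x + y) / (3 * x * y) else 0)"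
proof -
  let ?L = "chern_form x y e d"
  define u where "u = (SOME u. unitary_frame x y J u)"
  have u: "unitary_frame x y J u"
    unfolding u_def using unitary_frame_exists[OF xy J] by (rule someI_ex)
  have eb: "equivariant_bilinear ?L" by (rule equivariant_bilinear_chern_form)
  then have bil: "bounded_bilinear ?L" and Lmm: "\<And>a b. ?L a b \<in> mm"
    by (auto simp: equivariant_bilinear_def)
  define T where "T = (\<lambda>a b c d. - metric_form x y (curv_form ?L a b c) d)"
  have T1: "linear (\<lambda>a. T a b c d)" and T2: "linear (\<lambda>b. T a b c d)"
      and T3: "linear (\<lambda>c. T a b c d)"
    and T4: "linear (\<lambda>d. T a b c d)" for a b c d
    unfolding T_def
    by (rule linearI; simp add: metric_form_distribs linear_add[OF curv_form_linear(1)[OF bil]]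
        linear_add[OF curv_form_linear(2)[OF bil]]
      linear_add[OF curv_form_linear(3)[OF bil]] linear_cmul[OF curv_form_linear(1)[OF bil]]
      linear_cmul[OF curv_form_linear(2)[OF bil]] linear_cmul[OF curv_form_linear(3)[OF bil]])+
  have sk1: "T a b c d = - T b a c d" for a b c d
    unfolding T_def by (subst curv_form_skew[OF bil]) (simp add: metric_form_distribs)
  have sk2: "T a b c d = - T a b d c" if "a \<in> mm" "b \<in> mm" "c \<in> mm" "d \<in> mm" for a b c d
    unfolding T_def using curv_form_metric_skew[OF chern_form_metric[OF xy] Lmm that] by simp
  have S: "curv_tensor x y (gauduchon x y J 1) p a b c d = T a b c d"
    if "a \<in> mm" "b \<in> mm" "c \<in> mm" "d \<in> mm" for a b c d
    unfolding T_def by (rule curv_tensor_eq[OF gauduchon_represents[OF xy J] eb p that])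
  have "chern_scalar x y J p
     = of_real (1 / 4 * (\<Sum>e\<in>gens_m. (\<Sum>e'\<in>gens_m. T e (J e) e' (J e') / metric_form x y e' e') /
         metric_form x y e e))"
    unfolding chern_scalar_def hermitian_scalar_def Let_def u_def[symmetric]
    by (rule hermitian_frame_sum[OF xy J u T1 T2 T3 T4 sk1 sk2 S])
  also have "1 / 4 * (\<Sum>e\<in>gens_m. (\<Sum>e'\<in>gens_m. T e (J e) e' (J e') / metric_form x y e' e') /
      metric_form x y e e)
      = (if e = d then 2 * (x + y) / (3 * x * y) else 0)"
    unfolding T_def sum_gens_m curv_form_def chern_form_def using xy
    by - (rule acs_cases[OF J];
        simp add: comm_sp2_mat comm_zero nomizu_zero sp2_mat_0 nomizu_sp2_mat sp2_mat_diff
            metric_form_def inner_complex_def acs_mm_mat[OF J];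
        simp add: field_simps power2_eq_square)
  finally show ?thesis .
qed

section \<open>Integrability and the type of the differential of the fundamental form\<close>

lemma nij_form_integrable:
  assumes J: "acs_signs J e e" and ab: "a \<in> mm" "b \<in> mm"
  shows "nij_form J a b = 0"
  by (insert ab J, elim mm_cases, frule acs_cases)
    (auto simp: nij_form_def nomizu_sp2_mat acs_mm_mat sp2_mat_diff sp2_mat_add sp2_mat_inject
        sp2_mat_0[symmetric] algebra_simps)

lemma integrable_acs_iff:
  assumes J: "acs_signs J e d"
  shows "integrable_acs J \<longleftrightarrow> e = d"
proof
  assume "e = d"
  then show "integrable_acs J"
    using J by (auto simp: integrable_acs_def nijenhuis_eq[OF J] nij_form_integrable
        vector_field_mm)
next
  assume int: "integrable_acs J"
  have one: "mat 1 \<in> Sp2" by (simp add: Sp2_def adj_mat1 transpose_mat)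
  \<comment> \<open>The relation \<alpha>1 + \<alpha>2 = \<alpha>3 makes this pair sensitive to both
    signs: the last coordinate of the value is \<open>4 - 4 * e * d\<close>.\<close>
  have "nij_form J (mm_mat 1 0 0) (mm_mat 0 1 0) = 0"
    using int nijenhuis_eq[OF J extend(1)[OF one] extend(1)[OF one] one]
      extend[OF one, of "mm_mat 1 0 0"] extend[OF one, of "mm_mat 0 1 0"] one
    unfolding integrable_acs_def by (metis mm_mat_in_mm)
  then show "e = d"
    using J by (elim acs_cases)
      (simp_all add: nij_form_def nomizu_sp2_mat acs_mm_mat[OF J] sp2_mat_diff sp2_mat_add
          sp2_mat_inject sp2_mat_0[symmetric])
qed

text \<open>For a real form the two summands are conjugate, so the result is twice the real part of
  the form on the three (1,0) components; the factors 1/2 of these components give 2/8 =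
  1/4.\<close>

lemma minus_part_eq:
  assumes J: "acs_signs J e d"
    and \<psi>: "\<And>a b c. a \<in> mm \<Longrightarrow> b \<in> mm \<Longrightarrow> c \<in> mm \<Longrightarrow> \<psi> a b c = dF_form x y J a b c"
    and mm: "a \<in> mm" "b \<in> mm" "c \<in> mm"
  shows "minus_part J \<psi> a b c = 1 / 4 * (dF_form x y J a b c - dF_form x y J (J a) (J b) c
      - dF_form x y J (J a) b (J c) - dF_form x y J a (J b) (J c))"
proof -
  have J_adj: "adj (J v) = - J v" "adj v = - v" if "v \<in> mm" for v
    using mm_sp2[OF that] mm_sp2[OF acs_mm[OF J that]] by (simp_all add: sp2_def)
  have parts: "re_part (hol_part J v) = (1 / 2) *\<^sub>R v" "im_part (hol_part J v) = - ((1 / 2) *\<^sub>R J v)"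
    "re_part (antihol_part J v) = (1 / 2) *\<^sub>R v" "im_part (antihol_part J v) = (1 / 2) *\<^sub>R J v"
    if "v \<in> mm" for v
  proof -
    have "cnj (J v $ j $ i) = - J v $ i $ j" "cnj (v $ j $ i) = - v $ i $ j" for i j
      using J_adj[OF that] by (metis adj_nth vector_uminus_component)+
    then show "re_part (hol_part J v) = (1 / 2) *\<^sub>R v" "im_part (hol_part J v) = - ((1 / 2) *\<^sub>R J v)"
    "re_part (antihol_part J v) = (1 / 2) *\<^sub>R v" "im_part (antihol_part J v) = (1 / 2) *\<^sub>R J v"
      by (simp_all add: mat4_eq_iff re_part_def im_part_def conj_mm_def hol_part_def
          antihol_part_def
          cmul_nth adj_nth scaleR_conv_of_real[where 'a = complex] algebra_simps)
  qed
  have neg: "- v \<in> mm" if "v \<in> mm" for v using subspace_neg[OF subspace_mm that] .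
  have half: "(1 / 2) *\<^sub>R v \<in> mm" if "v \<in> mm" for v using subspace_scale[OF subspace_mm that] .
  have scale: "dF_form x y J (s *\<^sub>R u) v w = s * dF_form x y J u v w"
      "dF_form x y J u (s *\<^sub>R v) w = s * dF_form x y J u v w"
    "dF_form x y J u v (s *\<^sub>R w) = s * dF_form x y J u v w" for s u v w
    by (simp_all add: dF_form_def nomizu_distribs linear_cmul[OF acs_linear[OF J]]
        metric_form_distribs algebra_simps)
  have negs: "dF_form x y J (- u) v w = - dF_form x y J u v w"
      "dF_form x y J u (- v) w = - dF_form x y J u v w"
    "dF_form x y J u v (- w) = - dF_form x y J u v w" for u v w
    using scale(1)[of "- 1"] scale(2)[of _ "- 1"] scale(3)[of _ _ "- 1"] by simp_all
  show ?thesis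
    unfolding minus_part_def cext3_def cext_def
    using mm by (simp add: parts \<psi> neg half acs_mm[OF J] negs scale)
qed

text \<open>Up to conjugation every product in \<open>dF_form\<close> has one factor from each of
  \<open>z\<close>, \<open>w\<close> and \<open>cnj u\<close>, taken from different arguments. With
  equal signs \<open>z\<close> and \<open>w\<close> have one type and \<open>cnj u\<close> the
  other.\<close>

lemma dF_form_minus_integrable:
  assumes "acs_signs J e e" "a \<in> mm" "b \<in> mm" "c \<in> mm"
  shows "dF_form x y J a b c - dF_form x y J (J a) (J b) c - dF_form x y J (J a) b (J c)
      - dF_form x y J a (J b) (J c) = 0"
  by (insert assms, elim mm_cases, frule acs_cases)
    (auto simp: dF_form_def nomizu_sp2_mat acs_mm_mat metric_form_def inner_complex_def
        algebra_simps)

text \<open>With opposite signs \<open>z\<close>, \<open>w\<close> and \<open>cnj u\<close> all have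
  the same type, so their products are of type (3,0) or (0,3).\<close>

lemma dF_form_plus_nonintegrable:
  assumes "acs_signs J e d" "e \<noteq> d" "a \<in> mm" "b \<in> mm" "c \<in> mm"
  shows "1 / 4 * (dF_form x y J a b c - dF_form x y J (J a) (J b) c - dF_form x y J (J a) b (J c)
      - dF_form x y J a (J b) (J c))
    = dF_form x y J a b c"
  by (insert assms, elim mm_cases, frule acs_cases)
    (auto simp: dF_form_def nomizu_sp2_mat acs_mm_mat metric_form_def inner_complex_def
        algebra_simps)

lemma dF_form_kaehler:
  assumes "acs_signs J e e" "a \<in> mm" "b \<in> mm" "c \<in> mm"
  shows "dF_form x (2 * x) J a b c = 0"
  by (insert assms, elim mm_cases, frule acs_cases)
    (auto simp: dF_form_def nomizu_sp2_mat acs_mm_mat metric_form_def inner_complex_def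
        algebra_simps)

text \<open>The hypothesis says that the projection to type (3,0) + (0,3) fixes
  \<open>dF_form\<close>. It holds for the non-integrable structure by type, and in the Kaehler case
  because both sides are zero.\<close>

lemma dF_plus0_vanishes:
  assumes xy: "x > 0" "y > 0" and J: "acs_signs J e d"
    and plus: "\<And>a b c. a \<in> mm \<Longrightarrow> b \<in> mm \<Longrightarrow> c \<in> mm \<Longrightarrow>
      1 / 4 * (dF_form x y J a b c - dF_form x y J (J a) (J b) c - dF_form x y J (J a) b (J c)
          - dF_form x y J a (J b) (J c))
        = dF_form x y J a b c"
  shows "vanishes3 (dF_plus0 x y J)"
  unfolding vanishes3_def
proof (intro ballI)
  fix p a b c assume p: "p \<in> Sp2" and abc: "a \<in> mm" "b \<in> mm" "c \<in> mm"
  have 0: "plus_part J (dF x y J p) a b c = 0" if "a \<in> mm" "b \<in> mm" "c \<in> mm" for a b c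
  proof -
    have "minus_part J (dF x y J p) a b c = dF_form x y J a b c"
      by (rule trans[OF minus_part_eq[OF J dF_eq[OF J p] that] plus[OF that]])
    then show ?thesis by (simp add: plus_part_def dF_eq[OF J p that])
  qed
  have "frame x y i \<in> mm" if "i < 6" for i
    using frame[OF xy] that by (simp add: orthonormal_frame_def)
  then have "contraction x y J (plus_part J (dF x y J p)) a = 0" if "a \<in> mm" for a
    using that by (simp add: contraction_def 0 acs_mm[OF J])
  then show "dF_plus0 x y J p a b c = 0"
    unfolding dF_plus0_def primitive_part_def Let_def using abc by (simp add: 0)
qed

lemma dF_minus_vanishes:
  assumes J: "acs_signs J e e"
  shows "vanishes3 (dF_minus x y J)"
  unfolding vanishes3_def dF_minus_def
  using minus_part_eq[OF J dF_eq[OF J]] dF_form_minus_integrable[OF J] by simp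

lemma N0_vanishes:
  assumes J: "acs_signs J e e"
  shows "vanishes3 (N0 x y J)"
  unfolding vanishes3_def N0_def
  by (simp add: N3_eq[OF J] nij_form_integrable[OF J]
      bounded_bilinear.zero_left[OF bounded_bilinear_metric_form])

text \<open>The trace vanishes term by term: a generator \<open>e\<close> has one non-zero
  coordinate, so \<open>lc_form x y e e = 0\<close>, and \<open>lc_form x y e b\<close> is zero in
  just the coordinate where \<open>J e\<close> lives. Conceptually, \<open>mm\<close> has no
  non-zero vector fixed by the isotropy group.\<close>

lemma lee_form_vanishes:
  assumes xy: "x > 0" "y > 0" and J: "acs_signs J e d"
  shows "vanishes1 (lee_form x y J)"
  unfolding vanishes1_def
proof (intro ballI)
  fix p a assume p: "p \<in> Sp2" and a: "a \<in> mm"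
  define b where "b = J a"
  have b: "b \<in> mm" unfolding b_def by (rule acs_mm[OF J a])
  have f: "orthonormal_frame x y (frame x y)" by (rule frame[OF xy])
  have fmm: "frame x y i \<in> mm" if "i < 6" for i using f that by (simp add: orthonormal_frame_def)
  define \<beta> where "\<beta> = (\<lambda>v w. - metric_form x y (J (lc_form x y v w)) b
      - metric_form x y (J v) (lc_form x y w b))"
  have "codiff_F x y J p b = - (\<Sum>i<6. \<beta> (frame x y i) (frame x y i))"
    unfolding codiff_F_def \<beta>_def using fmm b
    by (simp add: cov_fund_eq[OF xy J _ _ _ p] extend p)
  also have "(\<Sum>i<6. \<beta> (frame x y i) (frame x y i)) = (\<Sum>e\<in>gens_m. \<beta> e e / metric_form x y e e)"
    unfolding \<beta>_def
    by (rule frame_trace[OF xy f]; rule linearI;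
        simp add: lc_form_def nomizu_distribs metric_form_distribs acs_distribs[OF J]
            linear_cmul[OF acs_linear[OF J]] algebra_simps)
  also have "\<dots> = 0"
  proof -
    obtain z w u where "b = mm_mat z w u" using b by (rule mm_cases)
    then show ?thesis
      by (simp add: \<beta>_def sum_gens_m lc_form_def nomizu_sp2_mat acs_mm_mat[OF J] metric_form_def
          inner_complex_def sp2_mat_0
          linear_0[OF acs_linear[OF J]])
  qed
  finally show "lee_form x y J p a = 0" by (simp add: lee_form_def b_def)
qed

theorem theorem1p6:
  fixes x y :: real and J :: "mat4 \<Rightarrow> mat4"
  assumes "x > 0" and "y > 0" and "invariant_acs J"
  shows "((\<forall>p\<in>Sp2. 2 * chern_scalar x y J p - of_real (scalar_curvature x y p) = 0) \<longleftrightarrow>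
            (class_W1_W2 x y J \<and> \<not> integrable_acs J \<and> y = 2 * x * (sqrt 10 + 3)) \<or>
            (class_W3 x y J \<and> integrable_acs J \<and> y = 2 * x)) \<and>
         (class_W3 x y J \<and> integrable_acs J \<and> y = 2 * x \<longrightarrow> kaehler x y J)"
proof -
  note xy = assms(1,2)
  obtain e d where J: "acs_signs J e d" using assms(3) by (rule invariant_acs_signs)
  \<comment> \<open>A point of \<open>Sp2\<close> is needed to pass from the statement for all
    points to the equation between numbers.\<close>
  have one: "mat 1 \<in> Sp2" by (simp add: Sp2_def adj_mat1 transpose_mat)
  let ?s1 = "if e = d then 2 * (x + y) / (3 * x * y) else 0"
  let ?s = "(4 * x\<^sup>2 + 12 * x * y - y\<^sup>2) / (6 * x\<^sup>2 * y)"
  have "(\<forall>p\<in>Sp2. 2 * chern_scalar x y J p - of_real (scalar_curvature x y p) = 0)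
      \<longleftrightarrow> (\<forall>p\<in>Sp2. complex_of_real (2 * ?s1 - ?s) = 0)"
    by (intro ball_cong refl) (simp only: chern_scalar_eq[OF xy J] scalar_curvature_eq[OF xy], simp)
  then have lhs: "(\<forall>p\<in>Sp2. 2 * chern_scalar x y J p - of_real (scalar_curvature x y p) = 0) \<longleftrightarrow> 2 * ?s1 - ?s = 0"
    using one by (auto simp only: of_real_eq_0_iff)
  note lee = lee_form_vanishes[OF xy J]
  show ?thesis
  proof (cases "e = d")
    case True
    then have J': "acs_signs J e e" using J by simp
    have "2 * ?s1 - ?s = (y - 2 * x)\<^sup>2 / (6 * x\<^sup>2 * y)"
      using True xy by (simp add: field_simps power2_eq_square)
    then have "2 * ?s1 - ?s = 0 \<longleftrightarrow> y = 2 * x" using xy by simp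
    moreover have "integrable_acs J" using integrable_acs_iff[OF J] True by simp
    moreover have "class_W3 x y J"
      using dF_minus_vanishes[OF J'] N0_vanishes[OF J'] lee by (simp add: class_W3_def)
    moreover have "kaehler x y J" if "y = 2 * x"
      using dF_minus_vanishes[OF J'] N0_vanishes[OF J'] lee
        dF_plus0_vanishes[OF xy J'] dF_form_kaehler[OF J'] acs_mm[OF J'] that
      by (simp add: kaehler_def)
    ultimately show ?thesis using lhs by simp
  next
    case False
    \<comment> \<open>As a quadratic in \<open>y\<close> this has the roots
      \<open>2 * x * (3 + sqrt 10)\<close> and \<open>2 * x * (3 - sqrt 10)\<close>; the latter is
      negative, so its factor stays positive.\<close>
    have factor: "4 * x\<^sup>2 + 12 * x * y - y\<^sup>2 = (2 * x * (sqrt 10 + 3) - y) * (y + 2 * x * (sqrt 10 - 3))"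
      using real_sqrt_pow2[of 10] by (simp add: power2_eq_square algebra_simps)
    have "sqrt 10 > 3" by (rule real_less_rsqrt) simp
    then have "y + 2 * x * (sqrt 10 - 3) > 0" using xy by (simp add: add_pos_pos)
    then have "4 * x\<^sup>2 + 12 * x * y - y\<^sup>2 = 0 \<longleftrightarrow> y = 2 * x * (sqrt 10 + 3)"
      unfolding factor by auto
    then have "2 * ?s1 - ?s = 0 \<longleftrightarrow> y = 2 * x * (sqrt 10 + 3)" using False xy by simp
    moreover have "\<not> integrable_acs J" using integrable_acs_iff[OF J] False by simp
    moreover have "class_W1_W2 x y J"
      using dF_plus0_vanishes[OF xy J dF_form_plus_nonintegrable[OF J False]] lee
      by (simp add: class_W1_W2_def)
    ultimately show ?thesis using lhs by simp
  qed
qed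

end
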